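(* Let $0\leq k<n$, let $X_{n,k}=\mathrm{Sp}(n)/\mathrm{Sp}(n-k)$ be the quaternionic Stiefel manifold, and let $h\colon X_{n,k}\to\mathbb{R}$ be the function $h(x)=\mathrm{Tr}(P^*P)$ for $x=\begin{bmatrix}T\\ P\end{bmatrix}\in X_{n,k}$. Then: 1) The function $h$ is Morse-Bott. 2) The critical levels (i.e. the critical values) of $h$ are exactly - $q=0,\dots,k$, if $n\geq 2k$; - $q=2k-n,\dots,k$, if $n\leq 2k$. 3) For each such $q$, with $p=k-q$, the critical submanifold $\Sigma_q$ is the total space of a principal fibration with fibre $\mathrm{Sp}(k)$ and base space the product of Grassmannians $\mathrm{Gr}_{n-k,p}\times \mathrm{Gr}_{k,k-p}$. The index of $\Sigma_q$ is $4(n-2k+q)q$.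
   Context: $\mathbb{H}$ denotes the quaternions; $\mathbb{H}^n$ is a right $\mathbb{H}$-vector space with Hermitian product $\langle u,v\rangle=u^*v$. $\mathrm{Sp}(n)$ is the Lie group of $n\times n$ quaternionic matrices $A$ with $A^*A=I_n$. For $0\le k\le n$, $X_{n,k}$ is the Stiefel manifold of matrices $x\in\mathbb{H}^{n\times k}$ with $x^*x=I_k$, written in blocks $x=\begin{bmatrix}T\\ P\end{bmatrix}$ with $T\in\mathbb{H}^{(n-k)\times k}$, $P\in\mathbb{H}^{k\times k}$, so that $T^*T+P^*P=I_k$. $\mathrm{Sp}(n)$ acts transitively on $X_{n,k}$ by left multiplication, with isotropy group of $\begin{bmatrix}0\\ I_k\end{bmatrix}$ isomorphic to $\mathrm{Sp}(n-k)$, so $X_{n,k}\cong \mathrm{Sp}(n)/\mathrm{Sp}(n-k)$. $X_{n,k}$ carries the Riemannian metric induced from the Euclidean space $\mathbb{H}^{n\times k}$ with $\langle u,v\rangle=\Re\,\mathrm{Tr}(u^*v)$. $\Sigma_q$ denotes the set of critical points $x$ of $h$ with $h(x)=q$. $\mathrm{Gr}_{m,l}$ denotes the Grassmannian of $l$-dimensional quaternionic subspaces of $\mathbb{H}^m$. A smooth function is Morse-Bott if its critical set is a disjoint union of submanifolds that are nondegenerate, i.e. the kernel of the Hessian at each critical point coincides with the tangent space of the critical submanifold there. The index of $\Sigma_q$ is the real dimension of the largest subspace of the tangent space of $X_{n,k}$, at a point of $\Sigma_q$, on which the Hessian is negative definite. A principal fibration with fibre $\mathrm{Sp}(k)$ is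 a principal fibre bundle with structure group $\mathrm{Sp}(k)$. *)

theory Defs
  imports "HOL-Analysis.Analysis" "HOL-Algebra.Group"
begin

datatype quat = Quat (qRe: real) (qI: real) (qJ: real) (qK: real)

lemma quat_eq_iff: "x = y \<longleftrightarrow> qRe x = qRe y \<and> qI x = qI y \<and> qJ x = qJ y \<and> qK x = qK y"
  by (cases x; cases y) auto

definition qcnj :: "quat \<Rightarrow> quat"
  where "qcnj x = Quat (qRe x) (- qI x) (- qJ x) (- qK x)"

lemma qcnj_sel [simp]:
  "qRe (qcnj x) = qRe x" "qI (qcnj x) = - qI x" "qJ (qcnj x) = - qJ x" "qK (qcnj x) = - qK x"
  by (simp_all add: qcnj_def)

instantiation quat :: ab_group_add
begin

definition "0 = Quat 0 0 0 0"
definition "x + y = Quat (qRe x + qRe y) (qI x + qI y) (qJ x + qJ y) (qK x + qK y)"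
definition "- x = Quat (- qRe x) (- qI x) (- qJ x) (- qK x)"
definition "x - y = Quat (qRe x - qRe y) (qI x - qI y) (qJ x - qJ y) (qK x - qK y)"

instance
  by standard (simp_all add: zero_quat_def plus_quat_def uminus_quat_def minus_quat_def)

end

lemma quat_add_sel [simp]:
  "qRe 0 = 0" "qI 0 = 0" "qJ 0 = 0" "qK 0 = 0"
  "qRe (x + y) = qRe x + qRe y" "qI (x + y) = qI x + qI y"
  "qJ (x + y) = qJ x + qJ y" "qK (x + y) = qK x + qK y"
  "qRe (- x) = - qRe x" "qI (- x) = - qI x" "qJ (- x) = - qJ x" "qK (- x) = - qK x"
  "qRe (x - y) = qRe x - qRe y" "qI (x - y) = qI x - qI y"
  "qJ (x - y) = qJ x - qJ y" "qK (x - y) = qK x - qK y"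
  by (simp_all add: zero_quat_def plus_quat_def uminus_quat_def minus_quat_def)

instantiation quat :: real_vector
begin

definition "r *\<^sub>R x = Quat (r * qRe x) (r * qI x) (r * qJ x) (r * qK x)"

instance
  by standard (simp_all add: quat_eq_iff scaleR_quat_def algebra_simps)

end

lemma quat_scaleR_sel [simp]:
  "qRe (r *\<^sub>R x) = r * qRe x" "qI (r *\<^sub>R x) = r * qI x"
  "qJ (r *\<^sub>R x) = r * qJ x" "qK (r *\<^sub>R x) = r * qK x"
  by (simp_all add: scaleR_quat_def)

instantiation quat :: real_inner
begin

definition "inner x y = qRe x * qRe y + qI x * qI y + qJ x * qJ y + qK x * qK y"
definition "norm (x :: quat) = sqrt (inner x x)"
definition "sgn (x :: quat) = x /\<^sub>R norm x"
definition "dist x y = norm (x - y :: quat)"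
definition [code del]:
  "(uniformity :: (quat \<times> quat) filter) = (INF e\<in>{0 <..}. principal {(x, y). dist x y < e})"
definition [code del]:
  "open (U :: quat set) \<longleftrightarrow> (\<forall>x\<in>U. eventually (\<lambda>(x', y). x' = x \<longrightarrow> y \<in> U) uniformity)"

instance
proof
  fix x y z :: quat and r :: real and U :: "quat set"
  show "inner x y = inner y x" "inner (x + y) z = inner x z + inner y z"
    "inner (r *\<^sub>R x) y = r * inner x y" "0 \<le> inner x x"
    by (simp_all add: inner_quat_def algebra_simps)
  have *: "a * a + b * b + c * c + d * d = 0 \<longleftrightarrow> a = 0 \<and> b = 0 \<and> c = 0 \<and> d = 0"
    for a b c d :: real
    by (simp add: add_nonneg_eq_0_iff)
  show "inner x x = 0 \<longleftrightarrow> x = 0"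
    unfolding inner_quat_def * by (simp add: quat_eq_iff)
qed (rule norm_quat_def sgn_quat_def dist_quat_def uniformity_quat_def open_quat_def)+

end

declare uniformity_Abort[where 'a = quat, code]

instantiation quat :: ring_1
begin

definition "1 = Quat 1 0 0 0"
definition "x * y = Quat
  (qRe x * qRe y - qI x * qI y - qJ x * qJ y - qK x * qK y)
  (qRe x * qI y + qI x * qRe y + qJ x * qK y - qK x * qJ y)
  (qRe x * qJ y - qI x * qK y + qJ x * qRe y + qK x * qI y)
  (qRe x * qK y + qI x * qJ y - qJ x * qI y + qK x * qRe y)"

lemma quat_mult_sel [simp]:
  fixes x y :: quat
  shows
    "qRe 1 = 1" "qI 1 = 0" "qJ 1 = 0" "qK 1 = 0"
    "qRe (x * y) = qRe x * qRe y - qI x * qI y - qJ x * qJ y - qK x * qK y"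
    "qI (x * y) = qRe x * qI y + qI x * qRe y + qJ x * qK y - qK x * qJ y"
    "qJ (x * y) = qRe x * qJ y - qI x * qK y + qJ x * qRe y + qK x * qI y"
    "qK (x * y) = qRe x * qK y + qI x * qJ y - qJ x * qI y + qK x * qRe y"
  by (simp_all add: times_quat_def one_quat_def)

instance
  by standard (simp_all add: quat_eq_iff algebra_simps)

end

instantiation quat :: real_normed_div_algebra
begin

definition "inverse x = qcnj x /\<^sub>R inner x x"
definition "x div y = x * inverse (y :: quat)"

instance
proof
  fix x y :: quat and r :: real
  show "r *\<^sub>R x * y = r *\<^sub>R (x * y)" "x * r *\<^sub>R y = r *\<^sub>R (x * y)"
    by (simp_all add: quat_eq_iff algebra_simps)
  show "x div y = x * inverse y"
    by (rule divide_quat_def)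
  show "inverse (0 :: quat) = 0"
    by (simp add: quat_eq_iff inverse_quat_def)
  have *: "qcnj x * x = inner x x *\<^sub>R 1" "x * qcnj x = inner x x *\<^sub>R 1"
    by (simp_all add: quat_eq_iff inner_quat_def)
  have l: "(r *\<^sub>R x) * y = r *\<^sub>R (x * y)" "x * (r *\<^sub>R y) = r *\<^sub>R (x * y)" for r and x y :: quat
    by (simp_all add: quat_eq_iff algebra_simps)
  show "inverse x * x = 1" "x * inverse x = 1" if "x \<noteq> 0"
    using that by (simp_all add: inverse_quat_def l *)
  show "norm (x * y) = norm x * norm y"
    unfolding norm_quat_def real_sqrt_mult[symmetric]
    by (rule arg_cong[where f = sqrt]) (simp only: inner_quat_def quat_mult_sel, algebra)
qed

end

instantiation quat :: euclidean_space
begin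

definition "Basis = {Quat 1 0 0 0, Quat 0 1 0 0, Quat 0 0 1 0, Quat 0 0 0 1}"

instance
proof
  fix u v x :: quat
  show "(Basis :: quat set) \<noteq> {}" "finite (Basis :: quat set)"
    by (simp_all add: Basis_quat_def)
  show "inner u v = (if u = v then 1 else 0)" if "u \<in> Basis" "v \<in> Basis"
    using that unfolding Basis_quat_def inner_quat_def by (elim insertE emptyE; simp)
  show "(\<forall>u\<in>Basis. inner x u = 0) \<longleftrightarrow> x = 0"
    unfolding Basis_quat_def inner_quat_def ball_simps quat.sel by (simp add: quat_eq_iff[of x])
qed

end

text \<open>
  Scalars act on vectors from the right, so that left multiplication by a matrix is linear.
  A space \<open>H\<^sup>m\<close> of quaternionic vectors is represented by an index set \<open>I\<close> with \<open>card I = m\<close> inside a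
  finite type: vectors and matrices indexed by subsets are extended by zero.  Index types
  themselves would exclude \<open>m = 0\<close>, since types are never empty.
\<close>

definition rscale :: "quat ^ 'n \<Rightarrow> quat \<Rightarrow> quat ^ 'n"
  where "rscale v a = (\<chi> i. v $ i * a)"

definition qadj :: "quat ^ 'n ^ 'm \<Rightarrow> quat ^ 'm ^ 'n"
  where "qadj A = (\<chi> i j. qcnj (A $ j $ i))"

definition qvecs :: "'n set \<Rightarrow> (quat ^ 'n) set"
  where "qvecs I = {v. \<forall>i. i \<notin> I \<longrightarrow> v $ i = 0}"

definition qmats :: "'m set \<Rightarrow> 'n set \<Rightarrow> (quat ^ 'n ^ 'm) set"
  where "qmats I J = {A. \<forall>i j. i \<notin> I \<or> j \<notin> J \<longrightarrow> A $ i $ j = 0}"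

definition qid :: "'n set \<Rightarrow> quat ^ 'n ^ 'n"
  where "qid I = (\<chi> i j. if i = j \<and> i \<in> I then 1 else 0)"

definition row_block :: "'m set \<Rightarrow> quat ^ 'n ^ 'm \<Rightarrow> quat ^ 'n ^ 'm"
  where "row_block I A = (\<chi> i j. if i \<in> I then A $ i $ j else 0)"

lemma trace_qadj_mult_real:
  fixes A :: "quat ^ 'n ^ 'n"
  shows "trace (qadj A ** A) = of_real (\<Sum>i\<in>UNIV. \<Sum>j\<in>UNIV. (norm (A $ i $ j))\<^sup>2)"
proof -
  have *: "qcnj x * x = of_real ((norm x)\<^sup>2)" for x
    by (simp add: norm_quat_def of_real_def quat_eq_iff inner_quat_def)
  show ?thesis
    unfolding trace_def matrix_matrix_mult_def qadj_def
    by (simp add: *) (rule sum.swap)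
qed

lemma inner_qmat:
  fixes A B :: "quat ^ 'n ^ 'n"
  shows "A \<bullet> B = qRe (trace (qadj A ** B))"
proof -
  have *: "qRe (sum f S) = (\<Sum>i\<in>S. qRe (f i))" for f and S :: "'n set"
    by (induction S rule: infinite_finite_induct) simp_all
  have **: "qRe (qcnj x * y) = x \<bullet> y" for x y
    by (simp add: inner_quat_def)
  show ?thesis
    unfolding trace_def matrix_matrix_mult_def qadj_def inner_vec_def
    by (simp add: * ** del: quat_mult_sel) (rule sum.swap)
qed

definition Sp :: "'n::finite set \<Rightarrow> (quat ^ 'n ^ 'n) monoid"
  where "Sp I = \<lparr>carrier = {A \<in> qmats I I. qadj A ** A = qid I}, mult = (**), one = qid I\<rparr>"

text \<open>
  The Stiefel manifold of \<open>n \<times> k\<close> matrices, \<open>n = CARD('n)\<close> and \<open>k = card K\<close>: columns are indexed by \<open>K\<close>,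
  and the rows in \<open>K\<close> form the square block \<open>P\<close>, the other rows the block \<open>T\<close>.
\<close>

definition stiefel :: "'n::finite set \<Rightarrow> (quat ^ 'n ^ 'n) set"
  where "stiefel K = {x \<in> qmats UNIV K. qadj x ** x = qid K}"

definition height :: "'n::finite set \<Rightarrow> quat ^ 'n ^ 'n \<Rightarrow> real"
  where "height K x = (let P = row_block K x in qRe (trace (qadj P ** P)))"

definition right_subspace :: "(quat ^ 'n) set \<Rightarrow> bool"
  where "right_subspace V \<longleftrightarrow>
    0 \<in> V \<and> (\<forall>u\<in>V. \<forall>v\<in>V. u + v \<in> V) \<and> (\<forall>v\<in>V. \<forall>a. rscale v a \<in> V)"

definition right_basis :: "(quat ^ 'n) set \<Rightarrow> (quat ^ 'n) set \<Rightarrow> bool"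
  where "right_basis B V \<longleftrightarrow> finite B \<and>
    {\<Sum>b\<in>B. rscale b (c b) | c. True} = V \<and>
    (\<forall>c. (\<Sum>b\<in>B. rscale b (c b)) = 0 \<longrightarrow> (\<forall>b\<in>B. c b = 0))"

definition Gr :: "'n::finite set \<Rightarrow> nat \<Rightarrow> (quat ^ 'n) set set"
  where "Gr I l = {V. right_subspace V \<and> V \<subseteq> qvecs I \<and> (\<exists>B. right_basis B V \<and> card B = l)}"

lemma qcnj_mult: "qcnj (x * y) = qcnj y * qcnj x"
  by (simp add: quat_eq_iff)

lemma qcnj_sum: "qcnj (sum f S) = (\<Sum>i\<in>S. qcnj (f i))"
proof (induction S rule: infinite_finite_induct)
  case (insert x F) then show ?case by (simp add: quat_eq_iff)
qed (simp_all add: quat_eq_iff)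

lemma qadj_mult: "qadj (A ** B) = qadj B ** qadj A"
  by (simp add: qadj_def matrix_matrix_mult_def vec_eq_iff qcnj_sum qcnj_mult)

lemma qadj_adjoint:
  fixes A :: "quat ^ 'n ^ 'm"
  shows "(qadj A *v v) \<bullet> w = v \<bullet> (A *v w)"
proof -
  have 1: "(qcnj a * x) \<bullet> y = x \<bullet> (a * y)" for a x y
    by (simp add: inner_quat_def algebra_simps)
  show ?thesis
    unfolding matrix_vector_mult_def qadj_def inner_vec_def
    by (simp add: inner_sum_left inner_sum_right 1 del: quat_mult_sel) (rule sum.swap)
qed

lemma orth_proj_ex1:
  fixes V :: "(quat ^ 'n) set"
  assumes "right_subspace V"
  shows "\<exists>!A. qadj A = A \<and> A ** A = A \<and> range (\<lambda>v. A *v v) = V"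
proof (rule ex_ex1I)
  fix A B :: "quat ^ 'n ^ 'n"
  assume A: "qadj A = A \<and> A ** A = A \<and> range (\<lambda>v. A *v v) = V"
    and B: "qadj B = B \<and> B ** B = B \<and> range (\<lambda>v. B *v v) = V"
  have "A *v (B *v v) = B *v v" for v
  proof -
    obtain w where "B *v v = A *v w" using A B by (metis rangeE rangeI)
    then show ?thesis using A by (simp add: matrix_vector_mul_assoc)
  qed
  then have AB: "A ** B = B" by (simp add: matrix_eq matrix_vector_mul_assoc)
  have "B *v (A *v v) = A *v v" for v
  proof -
    obtain w where "A *v v = B *v w" using A B by (metis rangeE rangeI)
    then show ?thesis using B by (simp add: matrix_vector_mul_assoc)
  qed
  then have BA: "B ** A = A" by (simp add: matrix_eq matrix_vector_mul_assoc)
  have "A = qadj (B ** A)" using A BA by simp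
  also have "\<dots> = B" using A B AB by (simp add: qadj_mult)
  finally show "A = B" .
next
  have sc: "r *\<^sub>R v = rscale v (of_real r)" for r and v :: "quat ^ 'n"
    by (simp add: rscale_def vec_eq_iff of_real_def)
  have V0: "0 \<in> V" and Vadd: "\<And>u v. u \<in> V \<Longrightarrow> v \<in> V \<Longrightarrow> u + v \<in> V"
    and Vsc: "\<And>v a. v \<in> V \<Longrightarrow> rscale v a \<in> V"
    using assms by (auto simp: right_subspace_def)
  have sub: "subspace V"
    unfolding subspace_def sc using V0 Vadd Vsc by blast
  have inr: "rscale u a \<bullet> w = u \<bullet> rscale w (qcnj a)" for u w :: "quat ^ 'n" and a
  proof -
    have "(x * a) \<bullet> y = x \<bullet> (y * qcnj a)" for x y
      by (simp add: inner_quat_def algebra_simps)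
    then show ?thesis by (simp add: inner_vec_def rscale_def)
  qed
  have "\<exists>y z. y \<in> V \<and> (\<forall>w\<in>V. z \<bullet> w = 0) \<and> v = y + z" for v
    using orthogonal_subspace_decomp_exists[of V v] sub
    by (metis orthogonal_def span_eq_iff)
  then obtain p where pV: "p v \<in> V" and po: "w \<in> V \<Longrightarrow> (v - p v) \<bullet> w = 0" for v w
    by (metis add_diff_cancel_left')
  have puniq: "p v = y" if "y \<in> V" "\<And>w. w \<in> V \<Longrightarrow> (v - y) \<bullet> w = 0" for v y
  proof -
    have "p v - y \<in> V" using that pV sub by (simp add: subspace_diff)
    then have "(v - y) \<bullet> (p v - y) - (v - p v) \<bullet> (p v - y) = 0"
      using that po by simp
    then show ?thesis by (simp add: inner_diff_left[symmetric])
  qed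
  have padd: "p (u + v) = p u + p v" for u v
  proof (rule puniq)
    fix w assume "w \<in> V"
    moreover have "(u + v - (p u + p v)) \<bullet> w = (u - p u) \<bullet> w + (v - p v) \<bullet> w"
      by (simp add: inner_add_left inner_diff_left)
    ultimately show "(u + v - (p u + p v)) \<bullet> w = 0" using po by simp
  qed (use Vadd pV in auto)
  have psc: "p (rscale v a) = rscale (p v) a" for v a
  proof (rule puniq)
    fix w assume "w \<in> V"
    then have "(v - p v) \<bullet> rscale w (qcnj a) = 0" using po Vsc by simp
    moreover have "rscale v a - rscale (p v) a = rscale (v - p v) a"
      by (simp add: rscale_def vec_eq_iff left_diff_distrib)
    ultimately show "(rscale v a - rscale (p v) a) \<bullet> w = 0" by (simp add: inr)
  qed (use Vsc pV in auto)
  have psum: "p (sum f S) = (\<Sum>i\<in>S. p (f i))" if "finite S" for f and S :: "'n set"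
    using that
  proof induction
    case empty show ?case using V0 by (auto intro: puniq)
  qed (simp add: padd)
  define A :: "quat ^ 'n ^ 'n" where "A = (\<chi> i j. p (axis j 1) $ i)"
  have Ap: "A *v v = p v" for v
  proof -
    have "v = (\<Sum>j\<in>UNIV. rscale (axis j 1) (v $ j))"
      by (simp add: vec_eq_iff rscale_def axis_def if_distrib[of "\<lambda>x. x * _"] cong: if_cong)
    then have "p v = (\<Sum>j\<in>UNIV. rscale (p (axis j 1)) (v $ j))"
      by (metis (no_types, lifting) psum psc finite sum.cong)
    then show ?thesis
      by (simp add: A_def matrix_vector_mult_def vec_eq_iff rscale_def)
  qed
  have fixed: "p v = v" if "v \<in> V" for v
    using that by (intro puniq) auto
  have "v \<bullet> p w = p v \<bullet> p w" "p v \<bullet> w = p v \<bullet> p w" for v w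
    using po[OF pV[of w], of v] po[OF pV[of v], of w]
    by (simp_all add: inner_diff_left inner_diff_right inner_commute)
  then have sa: "v \<bullet> p w = p v \<bullet> w" for v w by metis
  have "(qadj A *v v) \<bullet> w = (A *v v) \<bullet> w" for v w
    by (simp add: qadj_adjoint Ap sa)
  then have "qadj A = A"
    unfolding matrix_eq by (metis vector_eq_rdot)
  moreover have "A ** A = A"
    by (simp add: matrix_eq matrix_vector_mul_assoc[symmetric] Ap fixed pV)
  moreover have "range (\<lambda>v. A *v v) = V"
  proof
    show "V \<subseteq> range (\<lambda>v. A *v v)" unfolding Ap using fixed by (metis rangeI subsetI)
  qed (use pV in \<open>auto simp: Ap\<close>)
  ultimately show "\<exists>A. qadj A = A \<and> A ** A = A \<and> range (\<lambda>v. A *v v) = V" by blast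
qed

text \<open>
  The smooth structure of the Grassmannian is the one induced by its standard embedding into
  Euclidean space, which sends a subspace to the matrix of the orthogonal projection onto it.
\<close>

definition orth_proj :: "(quat ^ 'n) set \<Rightarrow> quat ^ 'n ^ 'n"
  where "orth_proj V = (THE A. qadj A = A \<and> A ** A = A \<and> range (\<lambda>v. A *v v) = V)"

definition Gr_manifold :: "'n::finite set \<Rightarrow> nat \<Rightarrow> (quat ^ 'n ^ 'n) set"
  where "Gr_manifold I l = orth_proj ` Gr I l"

text \<open>Meaningful for open \<open>S\<close> only, as the derivatives are taken in the ambient space.\<close>

primrec Ck_on :: "nat \<Rightarrow> ('a::euclidean_space \<Rightarrow> 'b::euclidean_space) \<Rightarrow> 'a set \<Rightarrow> bool"
  where
    "Ck_on 0 f S \<longleftrightarrow> continuous_on S f"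
  | "Ck_on (Suc r) f S \<longleftrightarrow> (\<forall>x\<in>S. f differentiable (at x)) \<and>
       (\<forall>v. Ck_on r (\<lambda>x. frechet_derivative f (at x) v) S)"

text \<open>On arbitrary subsets, smooth means locally extendable to a smooth map.\<close>

definition smooth_on :: "'a::euclidean_space set \<Rightarrow> ('a \<Rightarrow> 'b::euclidean_space) \<Rightarrow> bool"
  where "smooth_on S f \<longleftrightarrow> (\<forall>x\<in>S. \<exists>U g. open U \<and> x \<in> U \<and> (\<forall>r. Ck_on r g U) \<and> (\<forall>y\<in>U \<inter> S. g y = f y))"

definition diffeo :: "'a::euclidean_space set \<Rightarrow> 'b::euclidean_space set \<Rightarrow> ('a \<Rightarrow> 'b) \<Rightarrow> bool"
  where "diffeo S T f \<longleftrightarrow> bij_betw f S T \<and> smooth_on S f \<and> smooth_on T (inv_into S f)"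

definition submanifold :: "nat \<Rightarrow> 'a::euclidean_space set \<Rightarrow> bool"
  where "submanifold d S \<longleftrightarrow> (\<forall>x\<in>S. \<exists>U V L. \<exists>\<phi> :: 'a \<Rightarrow> 'a.
    open U \<and> x \<in> U \<and> open V \<and> diffeo U V \<phi> \<and> subspace L \<and> dim L = d \<and> \<phi> ` (U \<inter> S) = V \<inter> L)"

definition tangent_space :: "'a::euclidean_space set \<Rightarrow> 'a \<Rightarrow> 'a set"
  where "tangent_space S x = {v. \<exists>W (\<gamma> :: real \<Rightarrow> 'a).
    open W \<and> 0 \<in> W \<and> smooth_on W \<gamma> \<and> \<gamma> ` W \<subseteq> S \<and> \<gamma> 0 = x \<and> (\<gamma> has_vector_derivative v) (at 0)}"

text \<open>Here \<open>X\<close> is a submanifold of a Euclidean space and \<open>f\<close> is a smooth function on it.\<close>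

definition critical_points :: "'a::euclidean_space set \<Rightarrow> ('a \<Rightarrow> real) \<Rightarrow> 'a set"
  where "critical_points X f = {x \<in> X. \<forall>W (\<gamma> :: real \<Rightarrow> 'a).
    open W \<and> 0 \<in> W \<and> smooth_on W \<gamma> \<and> \<gamma> ` W \<subseteq> X \<and> \<gamma> 0 = x \<longrightarrow>
    ((\<lambda>t. f (\<gamma> t)) has_real_derivative 0) (at 0)}"

definition critical_level_set :: "'a::euclidean_space set \<Rightarrow> ('a \<Rightarrow> real) \<Rightarrow> real \<Rightarrow> 'a set"
  where "critical_level_set X f c = {x \<in> critical_points X f. f x = c}"

text \<open>
  At a critical point \<open>x\<close>, the value of the Hessian on tangent vectors \<open>u\<close> and \<open>v\<close> is the mixed second
  derivative of \<open>f\<close> along any smooth two-parameter family \<open>\<sigma>\<close> in \<open>X\<close> through \<open>x\<close> with partial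
  velocities \<open>u\<close> and \<open>v\<close>; at a critical point this does not depend on the choice of \<open>\<sigma>\<close>.
\<close>

definition hessian :: "'a::euclidean_space set \<Rightarrow> ('a \<Rightarrow> real) \<Rightarrow> 'a \<Rightarrow> 'a \<Rightarrow> 'a \<Rightarrow> real"
  where "hessian X f x u v = (THE c. \<forall>W (\<sigma> :: real \<times> real \<Rightarrow> 'a).
    open W \<and> (0, 0) \<in> W \<and> smooth_on W \<sigma> \<and> \<sigma> ` W \<subseteq> X \<and> \<sigma> (0, 0) = x \<and>
    ((\<lambda>s. \<sigma> (s, 0)) has_vector_derivative u) (at 0) \<and>
    ((\<lambda>t. \<sigma> (0, t)) has_vector_derivative v) (at 0) \<longrightarrow>
    deriv (\<lambda>s. deriv (\<lambda>t. f (\<sigma> (s, t))) 0) 0 = c)"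

definition hessian_kernel :: "'a::euclidean_space set \<Rightarrow> ('a \<Rightarrow> real) \<Rightarrow> 'a \<Rightarrow> 'a set"
  where "hessian_kernel X f x =
    {u \<in> tangent_space X x. \<forall>v\<in>tangent_space X x. hessian X f x u v = 0}"

definition morse_index :: "'a::euclidean_space set \<Rightarrow> ('a \<Rightarrow> real) \<Rightarrow> 'a \<Rightarrow> nat"
  where "morse_index X f x = Max {dim V | V. subspace V \<and> V \<subseteq> tangent_space X x \<and>
    (\<forall>v\<in>V. v \<noteq> 0 \<longrightarrow> hessian X f x v v < 0)}"

text \<open>
  The critical submanifolds may have different dimensions.  Openness expresses that the critical
  set is their disjoint union as a topological space.
\<close>

definition Morse_Bott :: "'a::euclidean_space set \<Rightarrow> ('a \<Rightarrow> real) \<Rightarrow> bool"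
  where "Morse_Bott X f \<longleftrightarrow> smooth_on X f \<and>
    (\<exists>\<C>. \<Union>\<C> = critical_points X f \<and> pairwise disjnt \<C> \<and>
      (\<forall>C\<in>\<C>. openin (top_of_set (critical_points X f)) C \<and> (\<exists>d. submanifold d C) \<and>
        (\<forall>x\<in>C. hessian_kernel X f x = tangent_space C x)))"

definition lie_group :: "('g::euclidean_space) monoid \<Rightarrow> bool"
  where "lie_group G \<longleftrightarrow> group G \<and> (\<exists>d. submanifold d (carrier G)) \<and>
    smooth_on (carrier G \<times> carrier G) (\<lambda>(a, b). a \<otimes>\<^bsub>G\<^esub> b) \<and>
    smooth_on (carrier G) (\<lambda>a. inv\<^bsub>G\<^esub> a)"

definition smooth_right_action ::
    "('g::euclidean_space) monoid \<Rightarrow> 'e::euclidean_space set \<Rightarrow> ('e \<Rightarrow> 'g \<Rightarrow> 'e) \<Rightarrow> bool"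
  where "smooth_right_action G E act \<longleftrightarrow>
    (\<forall>x\<in>E. \<forall>a\<in>carrier G. act x a \<in> E) \<and>
    (\<forall>x\<in>E. act x \<one>\<^bsub>G\<^esub> = x) \<and>
    (\<forall>x\<in>E. \<forall>a\<in>carrier G. \<forall>b\<in>carrier G. act (act x a) b = act x (a \<otimes>\<^bsub>G\<^esub> b)) \<and>
    smooth_on (E \<times> carrier G) (\<lambda>(x, a). act x a)"

text \<open>
  A principal bundle with structure group \<open>G\<close>: a fibre-preserving right action on the total space \<open>E\<close>,
  with \<open>G\<close>-equivariant local trivialisations over the base \<open>B\<close>.
\<close>

definition principal_bundle ::
    "('g::euclidean_space) monoid \<Rightarrow> 'e::euclidean_space set \<Rightarrow> 'b::euclidean_space set \<Rightarrow>
      ('e \<Rightarrow> 'b) \<Rightarrow> ('e \<Rightarrow> 'g \<Rightarrow> 'e) \<Rightarrow> bool"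
  where "principal_bundle G E B \<pi> act \<longleftrightarrow>
    lie_group G \<and> (\<exists>d. submanifold d E) \<and> (\<exists>d. submanifold d B) \<and>
    \<pi> ` E \<subseteq> B \<and> smooth_on E \<pi> \<and>
    smooth_right_action G E act \<and> (\<forall>x\<in>E. \<forall>a\<in>carrier G. \<pi> (act x a) = \<pi> x) \<and>
    (\<forall>b\<in>B. \<exists>U \<tau>. openin (top_of_set B) U \<and> b \<in> U \<and>
      diffeo (E \<inter> \<pi> -` U) (U \<times> carrier G) (\<lambda>x. (\<pi> x, \<tau> x)) \<and>
      (\<forall>x\<in>E \<inter> \<pi> -` U. \<forall>a\<in>carrier G. \<tau> (act x a) = \<tau> x \<otimes>\<^bsub>G\<^esub> a))"

end

theory Submission
  imports Defs
begin

text \<open>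
  Let \<open>e\<close> be the diagonal projection onto the coordinates in \<open>K\<close>, so that the height of a frame \<open>x\<close> is
  \<open>\<parallel>e x\<parallel>\<^sup>2\<close>, and put \<open>Q = x x\<^sup>*\<close> and \<open>S = x\<^sup>* e x\<close>.  A vector \<open>v\<close> is tangent to the Stiefel manifold at \<open>x\<close>
  when \<open>x\<^sup>* v\<close> is skew, and the derivative of the height along \<open>v\<close> is \<open>2 \<langle>e x, v\<rangle>\<close>.  Hence \<open>x\<close> is critical
  exactly if \<open>e x = x S\<close> (\<open>critical_points_stiefel\<close>), which means that \<open>e\<close> commutes with \<open>Q\<close>.  Then \<open>S\<close> is
  itself an orthogonal projection and the height is its rank \<open>q\<close>.  The commuting projections \<open>(1 - e) Q\<close>
  and \<open>e Q\<close>, of ranks \<open>p = k - q\<close> and \<open>q\<close>, describe a pair of subspaces, one on each side of the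
  decomposition given by \<open>e\<close>.  Every such pair occurs, because projections of equal rank are related by
  a partial isometry, and two frames give the same pair exactly when they differ by an element of
  \<open>Sp(K)\<close> acting on the right.  This yields the critical values and the principal bundle.

  At a critical point the Hessian is \<open>2 \<langle>e u - u S, v\<rangle>\<close> (\<open>hessian_eq\<close>).  Split a tangent vector as
  \<open>v = x a + w\<close> with \<open>a = x\<^sup>* v\<close> skew and \<open>x\<^sup>* w = 0\<close>.  The part \<open>x a\<close> does not contribute, and half of the
  quadratic form is \<open>\<parallel>e w (e - S)\<parallel>\<^sup>2 - \<parallel>(1 - e) w S\<parallel>\<^sup>2\<close>.  Its kernel is given by \<open>e w = w S\<close>, which is also
  the linearisation of the equation \<open>e x = x S\<close>; this is the Morse-Bott condition.  A maximal
  negative space consists of the \<open>w\<close> with \<open>w = (1 - e) (1 - Q) w S\<close>, and its dimension is computed by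
  the trace formula \<open>dim {w. A w B = w} = 4 tr A tr B\<close> for projections \<open>A\<close> and \<open>B\<close> (\<open>dim_sandwich\<close>).

  For the smooth structures, all the manifolds are presented as smooth retracts of open sets of
  matrices.  For a retract, charts come from the inverse function theorem and the tangent space is
  the fixed space of the derivative of the retraction (\<open>submanifold_retract\<close>, \<open>tangent_space_retract\<close>).
  All the retractions are built from a single function, \<open>N \<mapsto> N\<^bsup>-1/2\<^esup>\<close> near the identity: the polar
  decomposition \<open>y (y\<^sup>* y)\<^bsup>-1/2\<^esup>\<close> makes a matrix orthonormal, and \<open>(1 + Z (Z\<^sup>2)\<^bsup>-1/2\<^esup>) / 2\<close> with \<open>Z = 2 M - 1\<close>
  rounds a hermitian matrix close to a projection to a projection.  The same polar decomposition
  gives the local sections of the bundle.  In each computation of a velocity the argument of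
  \<open>N\<^bsup>-1/2\<^esup>\<close> passes through the identity with velocity zero, so that this factor can be treated as
  constant.
\<close>

section \<open>Calculus of smooth maps\<close>

lemma Ck_on_cong:
  fixes f g :: "'a::euclidean_space \<Rightarrow> 'b::euclidean_space"
  assumes "open S" "\<And>x. x \<in> S \<Longrightarrow> f x = g x" "Ck_on r f S"
  shows "Ck_on r g S"
  using assms
proof (induction r arbitrary: f g)
  case 0
  then show ?case by (metis Ck_on.simps(1) continuous_on_cong)
next
  case (Suc r)
  have D: "(g has_derivative frechet_derivative f (at x)) (at x)" if "x \<in> S" for x
  proof (rule has_derivative_transform_within_open)
    have "f differentiable at x" using Suc.prems that by simp
    then show "(f has_derivative frechet_derivative f (at x)) (at x)"
      unfolding frechet_derivative_works .
  qed (use Suc.prems that in auto)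
  have "frechet_derivative g (at x) = frechet_derivative f (at x)" if "x \<in> S" for x
    using frechet_derivative_at[OF D[OF that]] by simp
  then show ?case
    using Suc.prems D Suc.IH[OF \<open>open S\<close>] by (auto simp: differentiable_def)
qed

lemma Ck_on_subset: "Ck_on r f S \<Longrightarrow> T \<subseteq> S \<Longrightarrow> Ck_on r f T"
  by (induction r arbitrary: f) (auto intro: continuous_on_subset)

lemma Ck_on_imp_continuous_on: "Ck_on r f S \<Longrightarrow> continuous_on S f"
  by (cases r) (auto intro!: differentiable_imp_continuous_on differentiable_at_imp_differentiable_on)

lemma Ck_on_SucD: "Ck_on (Suc r) f S \<Longrightarrow> Ck_on r f S"
proof (induction r arbitrary: f)
  case 0
  then show ?case using Ck_on_imp_continuous_on by fastforce
qed auto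

lemma Ck_on_SucI:
  assumes "open S" "\<And>x. x \<in> S \<Longrightarrow> (f has_derivative f' x) (at x)"
    and "\<And>v. Ck_on r (\<lambda>x. f' x v) S"
  shows "Ck_on (Suc r) f S"
proof -
  have eq: "f' x = frechet_derivative f (at x)" if "x \<in> S" for x
    using assms(2)[OF that] frechet_derivative_at by blast
  have "Ck_on r (\<lambda>x. frechet_derivative f (at x) v) S" for v
    by (rule Ck_on_cong[OF assms(1) _ assms(3)[of v]]) (simp add: eq)
  then show ?thesis using assms(2) by (auto simp: differentiable_def)
qed

lemma Ck_on_SucE:
  assumes "Ck_on (Suc r) f S" "x \<in> S"
  shows "(f has_derivative frechet_derivative f (at x)) (at x)"
proof -
  have "f differentiable at x" using assms by simp
  then show ?thesis unfolding frechet_derivative_works .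
qed

lemma Ck_on_local:
  assumes "\<And>x. x \<in> S \<Longrightarrow> \<exists>U. open U \<and> x \<in> U \<and> Ck_on r f U"
  shows "Ck_on r f S"
  using assms
proof (induction r arbitrary: f)
  case 0
  have "isCont f x" if x: "x \<in> S" for x
  proof -
    obtain U where "open U" "x \<in> U" "continuous_on U f" using 0[OF x] by auto
    then show ?thesis using continuous_on_eq_continuous_at by blast
  qed
  then show ?case by (simp add: continuous_at_imp_continuous_on)
next
  case (Suc r)
  have "\<exists>U. open U \<and> x \<in> U \<and> Ck_on r (\<lambda>x. frechet_derivative f (at x) v) U" if "x \<in> S" for x v
    using Suc.prems[OF that] by auto
  then have "Ck_on r (\<lambda>x. frechet_derivative f (at x) v) S" for v
    using Suc.IH by simp
  moreover have "f differentiable at x" if "x \<in> S" for x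
    using Suc.prems[OF that] by auto
  ultimately show ?case by simp
qed

lemma Ck_on_const: "open S \<Longrightarrow> Ck_on r (\<lambda>x. c) S"
proof (induction r arbitrary: c)
  case (Suc r)
  then show ?case by (intro Ck_on_SucI[where f' = "\<lambda>x v. 0"]) auto
qed auto

lemma Ck_on_linear: "open S \<Longrightarrow> bounded_linear f \<Longrightarrow> Ck_on r f S"
proof (induction r)
  case 0
  then show ?case by (simp add: linear_continuous_on)
next
  case (Suc r)
  then show ?case
    by (intro Ck_on_SucI[where f' = "\<lambda>x. f"] Ck_on_const) (auto intro: bounded_linear_imp_has_derivative)
qed

lemma Ck_on_linear_compose:
  "open S \<Longrightarrow> bounded_linear L \<Longrightarrow> Ck_on r f S \<Longrightarrow> Ck_on r (\<lambda>x. L (f x)) S"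
proof (induction r arbitrary: f)
  case 0
  then show ?case by (simp add: bounded_linear.continuous_on)
next
  case (Suc r)
  show ?case
  proof (rule Ck_on_SucI[OF \<open>open S\<close>])
    show "((\<lambda>x. L (f x)) has_derivative (\<lambda>v. L (frechet_derivative f (at x) v))) (at x)" if "x \<in> S" for x
      by (rule bounded_linear.has_derivative[OF Suc.prems(2) Ck_on_SucE[OF Suc.prems(3) that]])
    show "Ck_on r (\<lambda>x. L (frechet_derivative f (at x) v)) S" for v
      using Suc by simp
  qed
qed

lemma Ck_on_add:
  "open S \<Longrightarrow> Ck_on r f S \<Longrightarrow> Ck_on r g S \<Longrightarrow> Ck_on r (\<lambda>x. f x + g x) S"
proof (induction r arbitrary: f g)
  case 0
  then show ?case by (simp add: continuous_on_add)
next
  case (Suc r)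
  show ?case
  proof (rule Ck_on_SucI[OF \<open>open S\<close>])
    show "((\<lambda>x. f x + g x) has_derivative
        (\<lambda>v. frechet_derivative f (at x) v + frechet_derivative g (at x) v)) (at x)" if "x \<in> S" for x
      by (intro has_derivative_add Ck_on_SucE[OF Suc.prems(2) that] Ck_on_SucE[OF Suc.prems(3) that])
    show "Ck_on r (\<lambda>x. frechet_derivative f (at x) v + frechet_derivative g (at x) v) S" for v
      using Suc by simp
  qed
qed

lemma Ck_on_sum:
  assumes "open S" "\<And>i. i \<in> I \<Longrightarrow> Ck_on r (f i) S"
  shows "Ck_on r (\<lambda>x. \<Sum>i\<in>I. f i x) S"
  using assms(2) by (induction I rule: infinite_finite_induct) (auto intro: Ck_on_add Ck_on_const assms(1))

lemma Ck_on_bilinear: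
  assumes "open S" "bounded_bilinear B" "Ck_on r f S" "Ck_on r g S"
  shows "Ck_on r (\<lambda>x. B (f x) (g x)) S"
  using assms
proof (induction r arbitrary: f g)
  case 0
  then show ?case by (simp add: bounded_bilinear.continuous_on)
next
  case (Suc r)
  show ?case
  proof (rule Ck_on_SucI[OF \<open>open S\<close>])
    show "((\<lambda>x. B (f x) (g x)) has_derivative
        (\<lambda>v. B (f x) (frechet_derivative g (at x) v) + B (frechet_derivative f (at x) v) (g x))) (at x)"
      if "x \<in> S" for x
      by (intro bounded_bilinear.FDERIV[OF Suc.prems(2)] Ck_on_SucE[OF Suc.prems(3) that]
          Ck_on_SucE[OF Suc.prems(4) that])
    show "Ck_on r (\<lambda>x. B (f x) (frechet_derivative g (at x) v)
        + B (frechet_derivative f (at x) v) (g x)) S" for v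
      using Suc.prems Ck_on_SucD[OF Suc.prems(3)] Ck_on_SucD[OF Suc.prems(4)]
      by (intro Ck_on_add Suc.IH) auto
  qed
qed

lemma linear_basis_expansion:
  fixes L :: "'a::euclidean_space \<Rightarrow> 'b::real_vector"
  assumes "linear L"
  shows "L v = (\<Sum>b\<in>Basis. (v \<bullet> b) *\<^sub>R L b)"
  using euclidean_representation[of v] linear_sum[OF assms] linear_scale[OF assms]
  by (metis (no_types, lifting) sum.cong)

text \<open>
  The derivative of a composite is a linear map depending on the point, applied to a vector depending
  on the point.  Expanding in a basis reduces the differentiability of such a term to sums of products.
\<close>

lemma Ck_on_apply_linear:
  assumes "open S" "\<And>x. x \<in> S \<Longrightarrow> linear (L x)" "Ck_on r f S"
    and "\<And>b. Ck_on r (\<lambda>x. L x b) S"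
  shows "Ck_on r (\<lambda>x. L x (f x)) S"
proof (rule Ck_on_cong[OF assms(1)])
  show "(\<Sum>b\<in>Basis. (f x \<bullet> b) *\<^sub>R L x b) = L x (f x)" if "x \<in> S" for x
    using linear_basis_expansion[OF assms(2)[OF that]] by metis
  show "Ck_on r (\<lambda>x. \<Sum>b\<in>Basis. (f x \<bullet> b) *\<^sub>R L x b) S"
    by (intro Ck_on_sum Ck_on_bilinear[OF _ bounded_bilinear_scaleR] assms
        Ck_on_linear_compose[OF _ bounded_linear_inner_left])
qed

lemma Ck_on_compose:
  assumes "open S" "open T" "Ck_on r f S" "f ` S \<subseteq> T" "Ck_on r g T"
  shows "Ck_on r (\<lambda>x. g (f x)) S"
  using assms
proof (induction r arbitrary: g)
  case 0
  then show ?case by (auto intro: continuous_on_compose2[of T g S f])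
next
  case (Suc r)
  have fT: "f x \<in> T" if "x \<in> S" for x using that Suc.prems by blast
  show ?case
  proof (rule Ck_on_SucI[OF \<open>open S\<close>])
    show "((\<lambda>x. g (f x)) has_derivative
        (\<lambda>v. frechet_derivative g (at (f x)) (frechet_derivative f (at x) v))) (at x)" if "x \<in> S" for x
      by (rule has_derivative_compose[OF Ck_on_SucE[OF Suc.prems(3) that]
            Ck_on_SucE[OF Suc.prems(5) fT[OF that]]])
    show "Ck_on r (\<lambda>x. frechet_derivative g (at (f x)) (frechet_derivative f (at x) v)) S" for v
    proof (rule Ck_on_apply_linear[OF \<open>open S\<close>, where L = "\<lambda>x. frechet_derivative g (at (f x))"])
      show "linear (frechet_derivative g (at (f x)))" if "x \<in> S" for x
        using Ck_on_SucE[OF Suc.prems(5) fT[OF that]] has_derivative_linear by blast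
      show "Ck_on r (\<lambda>x. frechet_derivative f (at x) v) S" using Suc.prems by simp
      show "Ck_on r (\<lambda>x. frechet_derivative g (at (f x)) b) S" for b
        using Suc.prems Ck_on_SucD[OF Suc.prems(3)] by (intro Suc.IH) auto
    qed
  qed
qed

lemma Ck_on_Pair:
  assumes "open S" "Ck_on r f S" "Ck_on r g S"
  shows "Ck_on r (\<lambda>x. (f x, g x)) S"
proof -
  have "bounded_linear (\<lambda>x :: 'b. (x, 0 :: 'c))" "bounded_linear (\<lambda>x :: 'c. (0 :: 'b, x))"
    by (auto intro!: bounded_linear_Pair bounded_linear_ident bounded_linear_zero)
  then have "Ck_on r (\<lambda>x. (f x, 0) + (0, g x)) S"
    by (intro Ck_on_add assms Ck_on_linear_compose[where L = "\<lambda>x. (x, 0)"]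
        Ck_on_linear_compose[where L = "\<lambda>x. (0, x)"])
  then show ?thesis by simp
qed

text \<open>
  Smoothness on an arbitrary set is local extendability, so each closure property is obtained by
  extending the given maps and intersecting the neighbourhoods.
\<close>

lemma smooth_onE:
  assumes "smooth_on S f" "x \<in> S"
  obtains U g where "open U" "x \<in> U" "\<And>r. Ck_on r g U" "\<And>y. y \<in> U \<Longrightarrow> y \<in> S \<Longrightarrow> g y = f y"
proof -
  have "\<exists>U g. open U \<and> x \<in> U \<and> (\<forall>r. Ck_on r g U) \<and> (\<forall>y\<in>U \<inter> S. g y = f y)"
    using assms(1) unfolding smooth_on_def by (rule bspec) (rule assms(2))
  then show thesis
    by (elim exE conjE) (rule that, assumption, assumption, erule spec, erule bspec, simp)
qed

lemma smooth_onI: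
  assumes "\<And>x. x \<in> S \<Longrightarrow>
    \<exists>U g. open U \<and> x \<in> U \<and> (\<forall>r. Ck_on r g U) \<and> (\<forall>y\<in>U \<inter> S. g y = f y)"
  shows "smooth_on S f"
  unfolding smooth_on_def by (intro ballI assms)

lemma smooth_onI_Ck:
  assumes "open S" "\<And>r. Ck_on r f S"
  shows "smooth_on S f"
  by (rule smooth_onI, intro exI[of _ S] exI[of _ f] conjI allI ballI refl assms)

lemma smooth_on_imp_Ck_on:
  assumes "open S" "smooth_on S f"
  shows "Ck_on r f S"
proof (rule Ck_on_local)
  fix x assume "x \<in> S"
  then obtain U g where U: "open U" "x \<in> U" "\<And>r. Ck_on r g U" "\<And>y. y \<in> U \<Longrightarrow> y \<in> S \<Longrightarrow> g y = f y"
    using smooth_onE[OF assms(2)] by metis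
  have "Ck_on r f (U \<inter> S)"
  proof (rule Ck_on_cong[of _ g])
    show "Ck_on r g (U \<inter> S)" by (rule Ck_on_subset[OF U(3)]) simp
  qed (use U assms in auto)
  then show "\<exists>U. open U \<and> x \<in> U \<and> Ck_on r f U"
    using U assms(1) \<open>x \<in> S\<close> by (intro exI[of _ "U \<inter> S"]) auto
qed

lemma smooth_on_subset:
  assumes "smooth_on S f" "T \<subseteq> S"
  shows "smooth_on T f"
proof (rule smooth_onI)
  fix x assume "x \<in> T"
  then have "x \<in> S" using assms(2) by blast
  then obtain U g where "open U" "x \<in> U" "\<And>r. Ck_on r g U" "\<And>y. y \<in> U \<Longrightarrow> y \<in> S \<Longrightarrow> g y = f y"
    using smooth_onE[OF assms(1)] by metis
  then show "\<exists>U g. open U \<and> x \<in> U \<and> (\<forall>r. Ck_on r g U) \<and> (\<forall>y\<in>U \<inter> T. g y = f y)"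
    using assms(2) by (intro exI[of _ U] exI[of _ g]) auto
qed

lemma smooth_on_cong:
  assumes "smooth_on S f" "\<And>x. x \<in> S \<Longrightarrow> f x = g x"
  shows "smooth_on S g"
  using assms unfolding smooth_on_def by simp

lemma smooth_on_UNIV_imp: "smooth_on UNIV f \<Longrightarrow> smooth_on S f"
  by (rule smooth_on_subset) auto

lemma smooth_on_const: "smooth_on S (\<lambda>x. c)"
  by (rule smooth_on_UNIV_imp) (intro smooth_onI_Ck Ck_on_const open_UNIV)

lemma smooth_on_linear: "bounded_linear f \<Longrightarrow> smooth_on S f"
  by (rule smooth_on_UNIV_imp) (intro smooth_onI_Ck Ck_on_linear open_UNIV)

lemma smooth_on_compose:
  assumes "smooth_on S f" "smooth_on T g" "f ` S \<subseteq> T"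
  shows "smooth_on S (\<lambda>x. g (f x))"
proof (rule smooth_onI)
  fix x assume x: "x \<in> S"
  then have fx: "f x \<in> T" using assms(3) by blast
  obtain U f' where U: "open U" "x \<in> U" "\<And>r. Ck_on r f' U" "\<And>y. y \<in> U \<Longrightarrow> y \<in> S \<Longrightarrow> f' y = f y"
    using smooth_onE[OF assms(1) x] by metis
  obtain V g' where V: "open V" "f x \<in> V" "\<And>r. Ck_on r g' V" "\<And>y. y \<in> V \<Longrightarrow> y \<in> T \<Longrightarrow> g' y = g y"
    using smooth_onE[OF assms(2) fx] by metis
  define W where "W = U \<inter> f' -` V"
  have "open W" unfolding W_def
    by (rule continuous_open_preimage[OF Ck_on_imp_continuous_on[OF U(3)[of 0]] U(1) V(1)])
  moreover have "x \<in> W" using U V x by (simp add: W_def)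
  moreover have "Ck_on r (\<lambda>x. g' (f' x)) W" for r
    by (rule Ck_on_compose[OF \<open>open W\<close> V(1) _ _ V(3)]) (auto simp: W_def intro: Ck_on_subset[OF U(3)])
  moreover have "g' (f' y) = g (f y)" if "y \<in> W \<inter> S" for y
    using U(4)[of y] V(4)[of "f y"] assms(3) that by (auto simp: W_def)
  ultimately show "\<exists>U h. open U \<and> x \<in> U \<and> (\<forall>r. Ck_on r h U) \<and> (\<forall>y\<in>U \<inter> S. h y = g (f y))"
    by (intro exI[of _ W] exI[of _ "\<lambda>x. g' (f' x)"] conjI allI ballI)
qed

lemma smooth_on_Pair:
  assumes "smooth_on S f" "smooth_on S g"
  shows "smooth_on S (\<lambda>x. (f x, g x))"
proof (rule smooth_onI)
  fix x assume x: "x \<in> S"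
  obtain U f' where U: "open U" "x \<in> U" "\<And>r. Ck_on r f' U" "\<And>y. y \<in> U \<Longrightarrow> y \<in> S \<Longrightarrow> f' y = f y"
    using smooth_onE[OF assms(1) x] by metis
  obtain V g' where V: "open V" "x \<in> V" "\<And>r. Ck_on r g' V" "\<And>y. y \<in> V \<Longrightarrow> y \<in> S \<Longrightarrow> g' y = g y"
    using smooth_onE[OF assms(2) x] by metis
  have "Ck_on r (\<lambda>x. (f' x, g' x)) (U \<inter> V)" for r
    by (intro Ck_on_Pair open_Int U(1) V(1) Ck_on_subset[OF U(3)] Ck_on_subset[OF V(3)]) auto
  then show "\<exists>U h. open U \<and> x \<in> U \<and> (\<forall>r. Ck_on r h U) \<and> (\<forall>y\<in>U \<inter> S. h y = (f y, g y))"
    using U V by (intro exI[of _ "U \<inter> V"] exI[of _ "\<lambda>x. (f' x, g' x)"]) auto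
qed

lemma smooth_on_linear_compose:
  "bounded_linear L \<Longrightarrow> smooth_on S f \<Longrightarrow> smooth_on S (\<lambda>x. L (f x))"
  by (rule smooth_on_compose[OF _ smooth_on_linear[of L UNIV]]) auto

lemma smooth_on_bilinear:
  assumes "bounded_bilinear B" "smooth_on S f" "smooth_on S g"
  shows "smooth_on S (\<lambda>x. B (f x) (g x))"
proof -
  have "smooth_on UNIV (\<lambda>p. B (fst p) (snd p))"
    by (rule smooth_onI_Ck[OF open_UNIV], rule Ck_on_bilinear[OF open_UNIV assms(1)])
      (intro Ck_on_linear open_UNIV bounded_linear_fst bounded_linear_snd)+
  from smooth_on_compose[OF smooth_on_Pair[OF assms(2,3)] this] show ?thesis by simp
qed

named_theorems smooth_intros

lemma smooth_on_ident [smooth_intros]: "smooth_on S (\<lambda>x. x)"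
  by (rule smooth_on_linear) (rule bounded_linear_ident)

lemma smooth_on_add [smooth_intros]:
  assumes "smooth_on S f" "smooth_on S g"
  shows "smooth_on S (\<lambda>x. f x + g x)"
  using smooth_on_linear_compose[OF bounded_linear_add[OF bounded_linear_fst bounded_linear_snd]
      smooth_on_Pair[OF assms]] by simp

lemma smooth_on_diff [smooth_intros]:
  assumes "smooth_on S f" "smooth_on S g"
  shows "smooth_on S (\<lambda>x. f x - g x)"
  using smooth_on_linear_compose[OF bounded_linear_sub[OF bounded_linear_fst bounded_linear_snd]
      smooth_on_Pair[OF assms]] by simp

lemmas smooth_on_scaleR [smooth_intros] = smooth_on_bilinear[OF bounded_bilinear_scaleR]
lemmas smooth_on_inner [smooth_intros] = smooth_on_bilinear[OF bounded_bilinear_inner]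
lemmas smooth_on_fst [smooth_intros] = smooth_on_linear_compose[OF bounded_linear_fst]
lemmas smooth_on_snd [smooth_intros] = smooth_on_linear_compose[OF bounded_linear_snd]
lemmas [smooth_intros] = smooth_on_const smooth_on_Pair

lemma smooth_on_imp_continuous_on:
  assumes "smooth_on S f"
  shows "continuous_on S f"
  unfolding continuous_on_eq_continuous_within
proof
  fix x assume x: "x \<in> S"
  obtain U g where U: "open U" "x \<in> U" "\<And>r. Ck_on r g U" "\<And>y. y \<in> U \<Longrightarrow> y \<in> S \<Longrightarrow> g y = f y"
    using smooth_onE[OF assms x] by metis
  have "isCont g x"
    using Ck_on_imp_continuous_on[OF U(3)[of 0]] U(1,2) continuous_on_eq_continuous_at by blast
  then have "(g \<longlongrightarrow> f x) (at x within S)"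
    using U(4)[OF U(2) x] continuous_at_imp_continuous_within continuous_within by metis
  moreover have "\<forall>\<^sub>F y in at x within S. g y = f y"
    using U(1,2,4) unfolding eventually_at_topological by metis
  ultimately have "(f \<longlongrightarrow> f x) (at x within S)"
    by (rule Lim_transform_eventually)
  then show "continuous (at x within S) f" by (simp add: continuous_within)
qed

lemma smooth_on_has_derivative:
  assumes "open S" "smooth_on S f" "x \<in> S"
  shows "(f has_derivative frechet_derivative f (at x)) (at x)"
  using assms(3) by (rule Ck_on_SucE[OF smooth_on_imp_Ck_on[OF assms(1,2), of "Suc 0"]])

lemma smooth_on_frechet_derivative:
  assumes "open S" "smooth_on S f"
  shows "smooth_on S (\<lambda>x. frechet_derivative f (at x) v)"
proof (rule smooth_onI_Ck[OF assms(1)])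
  show "Ck_on r (\<lambda>x. frechet_derivative f (at x) v) S" for r
    using smooth_on_imp_Ck_on[OF assms, of "Suc r"] by simp
qed

text \<open>
  The derivative of \<open>w = A\<^bsup>-1\<^esup> v\<close> is \<open>- A\<^bsup>-1\<^esup> A' w\<close>, which involves the inverse operator to the same
  order as \<open>w\<close> itself; induction on the order of differentiability then needs only the case of one
  derivative.  For the latter, \<open>(y, w) \<mapsto> (y, A y w)\<close> is a differentiable bijection with invertible
  derivative.
\<close>

section \<open>The smooth inverse function theorem\<close>

lemma Ck_on_inverse_operator:
  fixes A B :: "'a::euclidean_space \<Rightarrow> 'b::euclidean_space \<Rightarrow> 'b"
  assumes "open V" and lin: "\<And>y. y \<in> V \<Longrightarrow> linear (A y)"
    and AB: "\<And>y v. y \<in> V \<Longrightarrow> A y (B y v) = v" and BA: "\<And>y v. y \<in> V \<Longrightarrow> B y (A y v) = v"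
    and "\<And>v. Ck_on r (\<lambda>y. A y v) V"
  shows "Ck_on r (\<lambda>y. B y v) V"
  using assms(5)
proof (induction r arbitrary: v)
  let ?VU = "V \<times> (UNIV :: 'b set)"
  have "linear (B y)" if "y \<in> V" for y
  proof (rule linearI)
    fix u v :: 'b and c :: real
    have "A y (B y u + B y v) = u + v" "A y (c *\<^sub>R B y u) = c *\<^sub>R u"
      using lin[OF that] AB[OF that] by (simp_all add: linear_add linear_scale)
    then show "B y (u + v) = B y u + B y v" "B y (c *\<^sub>R u) = c *\<^sub>R B y u"
      using BA[OF that] by metis+
  qed
  note linB = this
  define F where "F = (\<lambda>p :: 'a \<times> 'b. (fst p, A (fst p) (snd p)))"
  define G where "G = (\<lambda>p :: 'a \<times> 'b. (fst p, B (fst p) (snd p)))"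
  have open_VU: "open ?VU" by (simp add: \<open>open V\<close> open_Times)
  have F: "Ck_on r F ?VU" if "\<And>v. Ck_on r (\<lambda>y. A y v) V" for r
    unfolding F_def
  proof (rule Ck_on_Pair[OF open_VU Ck_on_linear[OF open_VU bounded_linear_fst]])
    show "Ck_on r (\<lambda>p. A (fst p) (snd p)) ?VU"
    proof (rule Ck_on_apply_linear[where L = "\<lambda>p. A (fst p)", OF open_VU])
      show "Ck_on r (\<lambda>p. A (fst p) b) ?VU" for b
        by (rule Ck_on_compose[where f = fst and g = "\<lambda>y. A y b", OF open_VU \<open>open V\<close> _ _ that])
          (auto intro: Ck_on_linear open_VU bounded_linear_fst)
    qed (auto intro: lin Ck_on_linear open_VU bounded_linear_snd)
  qed
  have FG: "F (G p) = p" "G (F p) = p" if "p \<in> ?VU" for p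
    using that AB BA by (auto simp: F_def G_def)
  have mem: "F p \<in> ?VU" "G p \<in> ?VU" if "p \<in> ?VU" for p
    using that by (auto simp: F_def G_def mem_Times_iff)
  have im: "F ` ?VU = ?VU"
  proof (intro equalityI subsetI)
    fix p assume "p \<in> ?VU"
    then have "p = F (G p)" "G p \<in> ?VU" using FG mem by auto
    then show "p \<in> F ` ?VU" by (rule image_eqI)
  qed (use mem in blast)
  \<comment> \<open>The fibrewise linear map \<open>F\<close> is a continuous bijection between open sets, so invariance of
    domain gives the continuity of its inverse without any estimate.\<close>
  have G: "continuous_on ?VU G" if "continuous_on ?VU F"
  proof -
    have "continuous_on (F ` ?VU) G"
      by (rule continuous_on_inverse_open[OF open_VU that])
        (use FG in auto)
    then show ?thesis by (simp add: im)
  qed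
  {
    case 0
    have "continuous_on ?VU G"
      by (rule G, rule Ck_on_imp_continuous_on[OF F[OF 0]])
    then have "continuous_on V (\<lambda>y. snd (G (y, v)))"
      by (intro continuous_on_snd continuous_on_compose2[where g = G and f = "\<lambda>y. (y, v)"]
          continuous_on_Pair continuous_on_id continuous_on_const) auto
    then show ?case by (simp add: G_def)
  next
    case (Suc r)
    have contG: "continuous_on ?VU G"
      by (rule G, rule Ck_on_imp_continuous_on[OF F[OF Suc.prems]])
    define A' where "A' = (\<lambda>b y. frechet_derivative (\<lambda>y. A y b) (at y))"
    have A': "((\<lambda>y. A y b) has_derivative A' b y) (at y)" if "y \<in> V" for b y
      unfolding A'_def by (rule Ck_on_SucE[OF Suc.prems that])
    have diff: "(\<lambda>y. B y v) differentiable (at y)" if y: "y \<in> V" for y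
    proof -
      let ?p = "(y, B y v)"
      define D where "D = frechet_derivative F (at ?p)"
      have D: "(F has_derivative D) (at (G (y, v)))"
        unfolding D_def using Ck_on_SucE[OF F[OF Suc.prems], of ?p] y by (simp add: G_def)
      have fstD: "fst (D q) = fst q" for q
      proof -
        have "((\<lambda>p. fst (F p)) has_derivative (\<lambda>q. fst (D q))) (at (G (y, v)))"
          by (rule has_derivative_fst[OF D])
        moreover have "((\<lambda>p. fst (F p)) has_derivative fst) (at (G (y, v)))"
          unfolding F_def by (simp add: bounded_linear_fst bounded_linear_imp_has_derivative)
        ultimately have "(\<lambda>q. fst (D q)) = fst" by (rule has_derivative_unique)
        then show ?thesis by metis
      qed
      have D0: "D (0, k) = (0, A y k)" for k
      proof -
        have "((\<lambda>w. F (y, w)) has_derivative (\<lambda>k. D (0, k))) (at (B y v))"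
          by (rule has_derivative_compose[of "Pair y" "Pair 0" "B y v" UNIV F D])
            (use D in \<open>auto intro!: derivative_eq_intros simp: G_def\<close>)
        moreover have "((\<lambda>w. F (y, w)) has_derivative (\<lambda>k. (0, A y k))) (at (B y v))"
          unfolding F_def using lin[OF y]
          by (auto intro!: has_derivative_Pair bounded_linear_imp_has_derivative simp: linear_conv_bounded_linear)
        ultimately have "(\<lambda>k. D (0, k)) = (\<lambda>k. (0, A y k))" by (rule has_derivative_unique)
        then show ?thesis by metis
      qed
      have linD: "linear D" using D has_derivative_linear by blast
      have "inj D"
      proof (subst linear_injective_0[OF linD], intro allI impI)
        fix q assume q: "D q = 0"
        then have "q = (0, snd q)" using fstD[of q] by (simp add: prod_eq_iff)
        then have "D (0, snd q) = 0" using q by metis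
        then have "A y (snd q) = 0" using D0[of "snd q"] by (simp add: prod_eq_iff)
        then have "snd q = 0" using BA[OF y] linear_0[OF lin[OF y]] by metis
        then show "q = 0" using \<open>q = (0, snd q)\<close> by (metis zero_prod_def)
      qed
      then obtain D' where D': "linear D'" "D' \<circ> D = id"
        using linear_injective_left_inverse[OF linD] by blast
      have yv: "(y, v) \<in> ?VU" using y by simp
      have DG: "(G has_derivative D') (at (y, v))"
      proof (rule has_derivative_inverse_basic[where f = F and f' = D and T = ?VU])
        show "isCont G (y, v)"
          using contG continuous_on_eq_continuous_at[OF open_VU] yv by blast
        show "bounded_linear D'" using D'(1) by (simp add: linear_conv_bounded_linear)
      qed (fact D D'(2) open_VU yv FG(1))+
      then have "((\<lambda>y. snd (G (y, v))) has_derivative (\<lambda>h. snd (D' (h, 0)))) (at y)"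
        by (intro has_derivative_snd has_derivative_compose[of "\<lambda>y. (y, v)" "\<lambda>h. (h, 0)" y UNIV G D']
            has_derivative_Pair has_derivative_ident has_derivative_const)
      then show ?thesis unfolding differentiable_def by (auto simp: G_def)
    qed
    \<comment> \<open>differentiating \<open>A w = v\<close> expresses the derivative of \<open>w\<close> by \<open>A\<^bsup>-1\<^esup>\<close> and the derivative of \<open>A\<close>\<close>
    define w where "w = (\<lambda>y. B y v)"
    define E where "E = (\<lambda>y h. - B y (\<Sum>b\<in>Basis. (w y \<bullet> b) *\<^sub>R A' b y h))"
    have "(w has_derivative E y) (at y)" if y: "y \<in> V" for y
    proof -
      obtain w' where w': "(w has_derivative w') (at y)"
        using diff[OF y] unfolding w_def differentiable_def by blast
      have "((\<lambda>y. \<Sum>b\<in>Basis. (w y \<bullet> b) *\<^sub>R A y b) has_derivative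
          (\<lambda>h. \<Sum>b\<in>Basis. (w y \<bullet> b) *\<^sub>R A' b y h + (w' h \<bullet> b) *\<^sub>R A y b)) (at y)"
        by (intro has_derivative_sum has_derivative_scaleR has_derivative_inner_left w' A'[OF y])
      moreover have "((\<lambda>y. \<Sum>b\<in>Basis. (w y \<bullet> b) *\<^sub>R A y b) has_derivative (\<lambda>h. 0)) (at y)"
      proof (rule has_derivative_transform_within_open[OF _ \<open>open V\<close> y])
        show "((\<lambda>y. v) has_derivative (\<lambda>h. 0)) (at y)" by simp
        show "v = (\<Sum>b\<in>Basis. (w x \<bullet> b) *\<^sub>R A x b)" if "x \<in> V" for x
          using linear_basis_expansion[OF lin[OF that], of "w x"] AB[OF that] by (simp add: w_def)
      qed
      ultimately have "(\<lambda>h. \<Sum>b\<in>Basis. (w y \<bullet> b) *\<^sub>R A' b y h + (w' h \<bullet> b) *\<^sub>R A y b) = (\<lambda>h. 0)"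
        by (rule has_derivative_unique)
      then have *: "(\<Sum>b\<in>Basis. (w y \<bullet> b) *\<^sub>R A' b y h) + A y (w' h) = 0" for h
        using linear_basis_expansion[OF lin[OF y], of "w' h"] by (simp add: sum.distrib) metis
      have "w' h = E y h" for h
      proof -
        have "w' h = B y (- (\<Sum>b\<in>Basis. (w y \<bullet> b) *\<^sub>R A' b y h))"
          using *[of h] BA[OF y, of "w' h"] by (metis add.commute eq_neg_iff_add_eq_0)
        then show ?thesis by (simp add: E_def linear_neg[OF linB[OF y]])
      qed
      then show ?thesis using w' by presburger
    qed
    moreover have "Ck_on r (\<lambda>y. E y h) V" for h
    proof -
      have A: "Ck_on r (\<lambda>y. A y v) V" for v
        by (rule Ck_on_SucD[OF Suc.prems])
      have 1: "Ck_on r (\<lambda>y. \<Sum>b\<in>Basis. (w y \<bullet> b) *\<^sub>R A' b y h) V"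
        using Suc.prems unfolding w_def A'_def
        by (intro Ck_on_sum Ck_on_bilinear[OF _ bounded_bilinear_scaleR] \<open>open V\<close>
            Ck_on_linear_compose[OF _ bounded_linear_inner_left] Suc.IH[OF A]) simp
      show ?thesis unfolding E_def
        by (intro Ck_on_linear_compose[OF \<open>open V\<close> bounded_linear_minus[OF bounded_linear_ident]]
            Ck_on_apply_linear[where L = B, OF \<open>open V\<close> linB 1 Suc.IH[OF A]])
    qed
    ultimately show ?case
      unfolding w_def by (rule Ck_on_SucI[OF \<open>open V\<close>, where f' = E])
  }
qed

text \<open>
  The inverse \<open>g\<close> produced by the continuously differentiable version of the theorem satisfies
  \<open>g' = (f' \<circ> g)\<^bsup>-1\<^esup>\<close>, so that its order of differentiability can be raised one step at a time.
\<close>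

theorem smooth_inverse_function:
  fixes f :: "'a::euclidean_space \<Rightarrow> 'a"
  assumes "open W" "smooth_on W f" "x0 \<in> W"
    and f': "(f has_derivative f') (at x0)" "inj f'"
  obtains U V where "open U" "x0 \<in> U" "U \<subseteq> W" "open V" "diffeo U V f"
proof -
  define F' where "F' = (\<lambda>x. Blinfun (frechet_derivative f (at x)))"
  have df: "(f has_derivative frechet_derivative f (at x)) (at x)" if "x \<in> W" for x
    using smooth_on_has_derivative[OF assms(1,2) that] .
  have F': "blinfun_apply (F' x) = frechet_derivative f (at x)" if "x \<in> W" for x
    unfolding F'_def by (rule bounded_linear_Blinfun_apply) (rule has_derivative_bounded_linear[OF df[OF that]])
  have cont: "continuous_on W F'"
  proof (rule continuous_on_blinfun_componentwise)
    show "continuous_on W (\<lambda>x. blinfun_apply (F' x) i)" for i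
      using smooth_on_imp_continuous_on[OF smooth_on_frechet_derivative[OF assms(1,2), of i]]
      by (rule continuous_on_eq) (simp add: F')
  qed
  have f'x0: "frechet_derivative f (at x0) = f'"
    using frechet_derivative_at[OF f'(1)] by simp
  have "linear f'" using f'(1) by (rule has_derivative_linear)
  then obtain g0 where g0: "linear g0" "g0 \<circ> f' = id"
    using linear_injective_left_inverse f'(2) by blast
  have left_inv: "Blinfun g0 o\<^sub>L F' x0 = id_blinfun"
  proof (rule blinfun_eqI)
    fix v
    have "bounded_linear g0" using g0(1) by (simp add: linear_conv_bounded_linear)
    then show "blinfun_apply (Blinfun g0 o\<^sub>L F' x0) v = blinfun_apply id_blinfun v"
      using g0(2) F'[OF assms(3)] f'x0 by (simp add: bounded_linear_Blinfun_apply pointfree_idE)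
  qed
  obtain U V g g' where U: "open U" "U \<subseteq> W" "x0 \<in> U" "open V" "f x0 \<in> V"
    and hom: "homeomorphism U V f g"
    and g: "\<And>y. y \<in> V \<Longrightarrow> (g has_derivative (g' y)) (at y)"
      "\<And>y. y \<in> V \<Longrightarrow> g' y = inv_into UNIV (blinfun_apply (F' (g y)))"
      "\<And>y. y \<in> V \<Longrightarrow> bij (blinfun_apply (F' (g y)))"
    using inverse_function_theorem[OF assms(1) _ cont assms(3) left_inv] df F' by metis
  have gW: "g y \<in> W" if "y \<in> V" for y
    using hom that U(2) unfolding homeomorphism_def by blast
  have "Ck_on r g V" for r
  proof (induction r)
    case 0
    then show ?case using hom by (simp add: homeomorphism_def)
  next
    case (Suc r)
    define A where "A = (\<lambda>y. frechet_derivative f (at (g y)))"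
    have bijA: "bij (A y)" and g'A: "g' y = inv_into UNIV (A y)" if "y \<in> V" for y
      using g(2,3)[OF that] F'[OF gW[OF that]] by (simp_all add: A_def)
    show ?case
    proof (rule Ck_on_SucI[OF U(4) g(1)])
      show "Ck_on r (\<lambda>y. g' y v) V" for v
      proof (rule Ck_on_inverse_operator[OF U(4), where A = A])
        show "linear (A y)" if "y \<in> V" for y
          unfolding A_def using df[OF gW[OF that]] by (rule has_derivative_linear)
        show "A y (g' y v) = v" "g' y (A y v) = v" if "y \<in> V" for y v
          using bijA[OF that] g'A[OF that] by (simp_all add: bij_is_inj bij_is_surj surj_f_inv_f)
        show "Ck_on r (\<lambda>y. A y v) V" for v
          unfolding A_def
          by (rule Ck_on_compose[where g = "\<lambda>x. frechet_derivative f (at x) v", OF U(4) assms(1) Suc.IH])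
            (use gW smooth_on_imp_Ck_on[OF assms(1) smooth_on_frechet_derivative[OF assms(1,2)]] in auto)
      qed
    qed
  qed
  then have "smooth_on V g" by (rule smooth_onI_Ck[OF U(4)])
  moreover have "g y = inv_into U f y" if "y \<in> V" for y
    using hom that unfolding homeomorphism_def by (metis image_eqI inv_into_f_f inj_on_inverseI)
  ultimately have "smooth_on V (inv_into U f)" by (rule smooth_on_cong)
  moreover have "bij_betw f U V"
    using hom unfolding homeomorphism_def bij_betw_def by (metis inj_on_inverseI)
  ultimately have "diffeo U V f"
    unfolding diffeo_def using smooth_on_subset[OF assms(2) U(2)] by blast
  then show thesis using that U by blast
qed

lemma diffeoI:
  assumes "f ` S \<subseteq> T" "g ` T \<subseteq> S" "\<And>x. x \<in> S \<Longrightarrow> g (f x) = x" "\<And>y. y \<in> T \<Longrightarrow> f (g y) = y"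
    and "smooth_on S f" "smooth_on T g"
  shows "diffeo S T f"
proof -
  have bij: "bij_betw f S T" by (rule bij_betw_byWitness[where f' = g]) (use assms in auto)
  have "inv_into S f y = g y" if "y \<in> T" for y
    using bij that assms by (metis bij_betw_inv_into_left image_subset_iff)
  then show ?thesis
    unfolding diffeo_def using bij assms(5) smooth_on_cong[OF assms(6)] by metis
qed

lemma diffeo_restrict:
  assumes "diffeo U V f" "open V" "open U'" "U' \<subseteq> U"
  shows "open (f ` U')" "diffeo U' (f ` U') f"
proof -
  have bij: "bij_betw f U V" and sm: "smooth_on U f" "smooth_on V (inv_into U f)"
    using assms(1) unfolding diffeo_def by blast+
  have im: "f ` U' = V \<inter> inv_into U f -` U'"
  proof (intro equalityI subsetI)
    fix y assume "y \<in> V \<inter> inv_into U f -` U'"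
    then have "inv_into U f y \<in> U'" "f (inv_into U f y) = y"
      using bij bij_betw_inv_into_right by fastforce+
    then show "y \<in> f ` U'" by force
  next
    fix y assume "y \<in> f ` U'"
    then show "y \<in> V \<inter> inv_into U f -` U'"
      using bij assms(4) bij_betw_inv_into_left[OF bij] bij_betwE[OF bij] by auto
  qed
  show "open (f ` U')" unfolding im
    by (rule continuous_open_preimage[OF smooth_on_imp_continuous_on[OF sm(2)] assms(2,3)])
  show "diffeo U' (f ` U') f"
  proof (rule diffeoI[where g = "inv_into U f"])
    show "inv_into U f (f x) = x" if "x \<in> U'" for x
      using bij_betw_inv_into_left[OF bij] assms(4) that by blast
    then show "f (inv_into U f y) = y" if "y \<in> f ` U'" for y using that by auto
    show "inv_into U f ` f ` U' \<subseteq> U'" unfolding im by blast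
    show "smooth_on (f ` U') (inv_into U f)" by (rule smooth_on_subset[OF sm(2)]) (simp add: im)
    show "smooth_on U' f" by (rule smooth_on_subset[OF sm(1) assms(4)])
  qed simp
qed

section \<open>Submanifolds as smooth retracts\<close>

definition smooth_retraction :: "'a::euclidean_space set \<Rightarrow> 'a set \<Rightarrow> ('a \<Rightarrow> 'a) \<Rightarrow> bool"
  where "smooth_retraction W S r \<longleftrightarrow>
    open W \<and> smooth_on W r \<and> S \<subseteq> W \<and> r ` W \<subseteq> S \<and> (\<forall>x\<in>S. r x = x)"

lemma smooth_curve_line:
  fixes x v :: "'a::euclidean_space"
  shows "smooth_on W (\<lambda>t :: real. x + t *\<^sub>R v)"
  by (intro smooth_intros)

lemma has_derivative_imp_curve:
  assumes "(f has_derivative f') (at (\<gamma> t))" "(\<gamma> has_vector_derivative v) (at t)"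
  shows "((\<lambda>t. f (\<gamma> t)) has_vector_derivative f' v) (at t)"
proof -
  have "((\<lambda>t. f (\<gamma> t)) has_derivative (\<lambda>h. f' (h *\<^sub>R v))) (at t)"
    by (rule has_derivative_compose[OF assms(2)[unfolded has_vector_derivative_def] assms(1)])
  then show ?thesis
    unfolding has_vector_derivative_def
    by (simp add: linear_scale[OF has_derivative_linear[OF assms(1)]])
qed

lemma smooth_retraction_derivative_idem:
  assumes "smooth_retraction W S r" "x \<in> S"
  defines "P \<equiv> frechet_derivative r (at x)"
  shows "(r has_derivative P) (at x)" "P (P v) = P v"
proof -
  have W: "open W" "smooth_on W r" "x \<in> W" "r x = x"
    using assms(1,2) unfolding smooth_retraction_def by blast+
  show P: "(r has_derivative P) (at x)"
    unfolding P_def by (rule smooth_on_has_derivative[OF W(1-3)])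
  have "((\<lambda>y. r (r y)) has_derivative (\<lambda>v. P (P v))) (at x)"
    by (rule has_derivative_compose[OF P]) (use P W(4) in simp)
  then have "(r has_derivative (\<lambda>v. P (P v))) (at x)"
    by (rule has_derivative_transform_within_open[OF _ W(1,3)])
      (use assms(1) in \<open>auto simp: smooth_retraction_def\<close>)
  then show "P (P v) = P v" using has_derivative_unique[OF P] by metis
qed

text \<open>
  A curve \<open>\<gamma>\<close> in \<open>S\<close> satisfies \<open>r \<circ> \<gamma> = \<gamma>\<close>, so its velocity is fixed by the derivative of \<open>r\<close>; conversely a
  fixed vector \<open>v\<close> is the velocity of \<open>t \<mapsto> r (x + t v)\<close>.
\<close>

theorem tangent_space_retract:
  assumes "smooth_retraction W S r" "x \<in> S"
  defines "P \<equiv> frechet_derivative r (at x)"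
  shows "tangent_space S x = {v. P v = v}" "tangent_space S x = range P"
    and "subspace (tangent_space S x)"
proof -
  have W: "open W" "smooth_on W r" "x \<in> W" "r x = x" "r ` W \<subseteq> S" "\<And>y. y \<in> S \<Longrightarrow> r y = y"
    using assms(1,2) unfolding smooth_retraction_def by blast+
  note P = smooth_retraction_derivative_idem[OF assms(1,2), folded P_def]
  show eq: "tangent_space S x = {v. P v = v}"
  proof (intro equalityI subsetI)
    fix v assume "v \<in> tangent_space S x"
    then obtain D \<gamma> where \<gamma>: "open D" "0 \<in> D" "\<gamma> ` D \<subseteq> S" "\<gamma> 0 = x" "(\<gamma> has_vector_derivative v) (at (0 :: real))"
      unfolding tangent_space_def by blast
    have "((\<lambda>t. r (\<gamma> t)) has_vector_derivative P v) (at 0)"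
      by (rule has_derivative_imp_curve) (use P(1) \<gamma> in simp_all)
    then have "(\<gamma> has_vector_derivative P v) (at 0)"
      by (rule has_vector_derivative_transform_within_open[OF _ \<gamma>(1,2)]) (use \<gamma>(3) W(6) in auto)
    then show "v \<in> {v. P v = v}" using \<gamma>(5) vector_derivative_unique_at by blast
  next
    fix v assume v: "v \<in> {v. P v = v}"
    define D where "D = (\<lambda>t :: real. x + t *\<^sub>R v) -` W"
    have "open D" unfolding D_def by (rule open_vimage[OF W(1)]) (intro continuous_intros)
    moreover have "0 \<in> D" using W(3) by (simp add: D_def)
    moreover have "smooth_on D (\<lambda>t. r (x + t *\<^sub>R v))"
      by (rule smooth_on_compose[OF smooth_curve_line W(2)]) (auto simp: D_def)
    moreover have "(\<lambda>t. r (x + t *\<^sub>R v)) ` D \<subseteq> S" using W(5) by (auto simp: D_def)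
    moreover have "((\<lambda>t. r (x + t *\<^sub>R v)) has_vector_derivative P v) (at 0)"
      by (rule has_derivative_imp_curve) (use P(1) in \<open>auto intro!: derivative_eq_intros\<close>)
    ultimately show "v \<in> tangent_space S x"
      using v W(4) unfolding tangent_space_def
      by (intro CollectI exI[of _ D] exI[of _ "\<lambda>t. r (x + t *\<^sub>R v)"]) simp
  qed
  show "tangent_space S x = range P"
    unfolding eq using P(2) by (auto intro: rangeI) (metis rangeI)
  then show "subspace (tangent_space S x)"
    using linear_subspace_image[OF has_derivative_linear[OF P(1)] subspace_UNIV] by simp
qed

text \<open>
  With \<open>P\<close> the derivative of \<open>r\<close> at \<open>x0\<close>, a projection onto the tangent space \<open>L\<close>, the map
  \<open>\<phi> x = P (r x - x0) + (1 - P) (x - r x)\<close> has derivative \<open>1\<close> at \<open>x0\<close>.  Its first part parametrises \<open>S\<close> by \<open>L\<close>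
  and its second part measures the distance from \<open>S\<close> in the complementary direction.
\<close>

theorem submanifold_retract:
  assumes retr: "smooth_retraction W S r"
    and dim: "\<And>x. x \<in> S \<Longrightarrow> dim (tangent_space S x) = d"
  shows "submanifold d S"
  unfolding submanifold_def
proof
  fix x0 assume x0: "x0 \<in> S"
  have W: "open W" "smooth_on W r" "x0 \<in> W" "r x0 = x0" "r ` W \<subseteq> S" "\<And>y. y \<in> S \<Longrightarrow> r y = y"
    using retr x0 unfolding smooth_retraction_def by blast+
  define P where "P = frechet_derivative r (at x0)"
  define L where "L = tangent_space S x0"
  have P: "(r has_derivative P) (at x0)" "\<And>v. P (P v) = P v"
    using smooth_retraction_derivative_idem[OF retr x0, folded P_def] by blast+
  have linP: "linear P" using P(1) by (rule has_derivative_linear)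
  have blP: "bounded_linear P" using P(1) by (rule has_derivative_bounded_linear)
  have L: "L = {v. P v = v}" "subspace L" "dim L = d"
    using tangent_space_retract[OF retr x0, folded P_def L_def] dim[OF x0] by (auto simp: L_def)
  note Psimps = linear_diff[OF linP] linear_add[OF linP] linear_0[OF linP] P(2)
  define \<phi> where "\<phi> = (\<lambda>x. P (r x - x0) + ((x - r x) - P (x - r x)))"
  have sm\<phi>: "smooth_on W \<phi>"
    unfolding \<phi>_def by (intro smooth_intros W(2) smooth_on_linear_compose[OF blP])
  have "(\<phi> has_derivative (\<lambda>v. P (P v) + ((v - P v) - P (v - P v)))) (at x0)"
    unfolding \<phi>_def
    by (auto intro!: derivative_eq_intros bounded_linear.has_derivative[OF blP] P(1))
  moreover have "(\<lambda>v. P (P v) + ((v - P v) - P (v - P v))) = (\<lambda>v. v)"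
    by (simp add: Psimps)
  ultimately have d\<phi>: "(\<phi> has_derivative (\<lambda>v. v)) (at x0)" by simp
  obtain U V where UV: "open U" "x0 \<in> U" "U \<subseteq> W" "open V" "diffeo U V \<phi>"
    by (rule smooth_inverse_function[OF W(1) sm\<phi> W(3) d\<phi>]) simp_all
  \<comment> \<open>injectivity of \<open>\<phi>\<close> is applied to \<open>x\<close> and \<open>r x\<close>, so both have to lie in \<open>U\<close>\<close>
  define U' where "U' = U \<inter> r -` U"
  have "open U'" unfolding U'_def
    by (rule continuous_open_preimage[OF smooth_on_imp_continuous_on[OF smooth_on_subset[OF W(2) UV(3)]] UV(1,1)])
  have U'U: "U' \<subseteq> U" and x0U': "x0 \<in> U'" using UV(2) W(4) by (auto simp: U'_def)
  have inj: "inj_on \<phi> U" using UV(5) by (simp add: diffeo_def bij_betw_def)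
  have P\<phi>: "P (\<phi> x) = P (r x - x0)" for x by (simp add: \<phi>_def Psimps)
  \<comment> \<open>\<open>\<phi> (r x)\<close> is the component of \<open>\<phi> x\<close> in \<open>L\<close>, so injectivity forces \<open>x = r x\<close> when \<open>\<phi> x\<close> lies in \<open>L\<close>.\<close>
  have \<phi>r: "\<phi> (r x) = P (\<phi> x)" if "x \<in> W" for x
    using W(5,6) that P\<phi>[of x] by (force simp: \<phi>_def Psimps)
  have img: "\<phi> ` (U' \<inter> S) = \<phi> ` U' \<inter> L"
  proof (intro equalityI subsetI)
    fix y assume "y \<in> \<phi> ` (U' \<inter> S)"
    then obtain x where x: "y = \<phi> x" "x \<in> U'" "r x = x" using W(6) by blast
    then have "P y = y" by (simp add: \<phi>_def Psimps)
    then show "y \<in> \<phi> ` U' \<inter> L" using x by (simp add: L(1))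
  next
    fix y assume "y \<in> \<phi> ` U' \<inter> L"
    then obtain x where x: "y = \<phi> x" "x \<in> U'" "P (\<phi> x) = \<phi> x" by (auto simp: L(1))
    then have "\<phi> (r x) = \<phi> x" using \<phi>r UV(3) U'U by auto
    then have "r x = x" using inj x(2) by (auto simp: U'_def dest: inj_onD)
    moreover have "x \<in> W" using x(2) U'U UV(3) by blast
    ultimately have "x \<in> S" using W(5) by (metis image_subset_iff)
    then show "y \<in> \<phi> ` (U' \<inter> S)" using x by blast
  qed
  show "\<exists>U V L. \<exists>\<phi> :: 'a \<Rightarrow> 'a. open U \<and> x0 \<in> U \<and> open V \<and> diffeo U V \<phi> \<and> subspace L \<and> dim L = d \<and> \<phi> ` (U \<inter> S) = V \<inter> L"
    using \<open>open U'\<close> x0U' diffeo_restrict[OF UV(5,4) \<open>open U'\<close> U'U] L(2,3) img by blast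
qed

lemma smooth_retraction_Times:
  assumes "smooth_retraction W S r" "smooth_retraction W' S' r'"
  shows "smooth_retraction (W \<times> W') (S \<times> S') (\<lambda>p. (r (fst p), r' (snd p)))"
proof -
  have "smooth_on (W \<times> W') (\<lambda>p. (r (fst p), r' (snd p)))"
    using assms unfolding smooth_retraction_def
    by (intro smooth_on_Pair
        smooth_on_compose[where g = r and T = W, OF smooth_on_linear[OF bounded_linear_fst]]
        smooth_on_compose[where g = r' and T = W', OF smooth_on_linear[OF bounded_linear_snd]]) auto
  then show ?thesis using assms unfolding smooth_retraction_def by (auto simp: open_Times)
qed

lemma tangent_space_Times:
  "tangent_space (S \<times> S') (x, x') = tangent_space S x \<times> tangent_space S' x'"
proof (intro equalityI subsetI)
  fix p assume "p \<in> tangent_space (S \<times> S') (x, x')"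
  then obtain D \<gamma> where \<gamma>: "open D" "0 \<in> D" "smooth_on D \<gamma>" "\<gamma> ` D \<subseteq> S \<times> S'" "\<gamma> 0 = (x, x')"
    "(\<gamma> has_vector_derivative p) (at (0 :: real))"
    unfolding tangent_space_def by blast
  have "(\<lambda>t. fst (\<gamma> t)) ` D \<subseteq> S" "(\<lambda>t. snd (\<gamma> t)) ` D \<subseteq> S'" using \<gamma>(4) by force+
  moreover have "((\<lambda>t. fst (\<gamma> t)) has_vector_derivative fst p) (at 0)"
    "((\<lambda>t. snd (\<gamma> t)) has_vector_derivative snd p) (at 0)"
    by (rule bounded_linear.has_vector_derivative[OF bounded_linear_fst \<gamma>(6)]
        bounded_linear.has_vector_derivative[OF bounded_linear_snd \<gamma>(6)])+
  ultimately have "fst p \<in> tangent_space S x" "snd p \<in> tangent_space S' x'"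
    unfolding tangent_space_def using \<gamma>(1,2,5) smooth_on_fst[OF \<gamma>(3)] smooth_on_snd[OF \<gamma>(3)]
    by (intro CollectI exI[of _ D] exI[of _ "\<lambda>t. fst (\<gamma> t)"] exI[of _ "\<lambda>t. snd (\<gamma> t)"]; simp)+
  then show "p \<in> tangent_space S x \<times> tangent_space S' x'" by (simp add: mem_Times_iff)
next
  fix p assume "p \<in> tangent_space S x \<times> tangent_space S' x'"
  then have "fst p \<in> tangent_space S x" "snd p \<in> tangent_space S' x'" by auto
  then obtain D \<gamma> D' \<gamma>' where \<gamma>: "open D" "0 \<in> D" "smooth_on D \<gamma>" "\<gamma> ` D \<subseteq> S" "\<gamma> 0 = x"
    "(\<gamma> has_vector_derivative fst p) (at (0 :: real))"
    and \<gamma>': "open D'" "0 \<in> D'" "smooth_on D' \<gamma>'" "\<gamma>' ` D' \<subseteq> S'" "\<gamma>' 0 = x'"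
    "(\<gamma>' has_vector_derivative snd p) (at (0 :: real))"
    unfolding tangent_space_def by (elim CollectE exE conjE) blast
  have "smooth_on (D \<inter> D') (\<lambda>t. (\<gamma> t, \<gamma>' t))"
    by (intro smooth_on_Pair smooth_on_subset[OF \<gamma>(3)] smooth_on_subset[OF \<gamma>'(3)]) auto
  moreover have "((\<lambda>t. (\<gamma> t, \<gamma>' t)) has_vector_derivative p) (at 0)"
    using has_vector_derivative_Pair[OF \<gamma>(6) \<gamma>'(6)] by simp
  ultimately show "p \<in> tangent_space (S \<times> S') (x, x')"
    unfolding tangent_space_def using \<gamma> \<gamma>'
    by (intro CollectI exI[of _ "D \<inter> D'"] exI[of _ "\<lambda>t. (\<gamma> t, \<gamma>' t)"]) auto
qed

section \<open>Quaternionic matrices\<close>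

lemma matrix_mult_add_left: "(A + B) ** C = A ** C + B ** (C :: quat ^ 'p ^ 'n)"
  by (simp add: matrix_matrix_mult_def vec_eq_iff distrib_right sum.distrib)

lemma bounded_bilinear_matrix_mult:
  "bounded_bilinear (\<lambda>(A :: quat ^ 'n ^ 'm) (B :: quat ^ 'p ^ 'n). A ** B)"
  unfolding bilinear_conv_bounded_bilinear[symmetric] bilinear_def
  by (auto intro!: linearI simp: matrix_add_ldistrib matrix_mult_add_left matrix_scalar_ac scalar_matrix_assoc)

lemma bounded_linear_qadj: "bounded_linear (qadj :: quat ^ 'n ^ 'm \<Rightarrow> quat ^ 'm ^ 'n)"
  unfolding linear_conv_bounded_linear[symmetric]
  by (intro linearI) (simp_all add: qadj_def vec_eq_iff quat_eq_iff)

text \<open>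
  Matrix products are normalised to right-nested form.  An equation \<open>A B = C\<close> is therefore used
  together with its variant \<open>A (B Z) = C Z\<close>, supplied by \<open>mult_eq_assoc\<close> below.
\<close>

lemmas mult_simps =
  matrix_mul_assoc[symmetric]
  bounded_bilinear.add_left[OF bounded_bilinear_matrix_mult]
  bounded_bilinear.add_right[OF bounded_bilinear_matrix_mult]
  bounded_bilinear.diff_left[OF bounded_bilinear_matrix_mult]
  bounded_bilinear.diff_right[OF bounded_bilinear_matrix_mult]
  bounded_bilinear.minus_left[OF bounded_bilinear_matrix_mult]
  bounded_bilinear.minus_right[OF bounded_bilinear_matrix_mult]
  bounded_bilinear.scaleR_left[OF bounded_bilinear_matrix_mult]
  bounded_bilinear.scaleR_right[OF bounded_bilinear_matrix_mult]

lemma qadj_qadj [simp]: "qadj (qadj A) = A"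
  by (simp add: qadj_def vec_eq_iff quat_eq_iff)

lemma qadj_mat_1 [simp]: "qadj (mat 1) = mat 1"
  by (simp add: qadj_def mat_def vec_eq_iff quat_eq_iff)

lemma qadj_qid [simp]: "qadj (qid I) = qid I"
  by (simp add: qadj_def qid_def vec_eq_iff quat_eq_iff)

lemmas qadj_simps =
  qadj_mult
  linear_add[OF bounded_linear.linear[OF bounded_linear_qadj]]
  linear_diff[OF bounded_linear.linear[OF bounded_linear_qadj]]
  linear_neg[OF bounded_linear.linear[OF bounded_linear_qadj]]
  linear_scale[OF bounded_linear.linear[OF bounded_linear_qadj]]
  linear_0[OF bounded_linear.linear[OF bounded_linear_qadj]]

lemmas smooth_on_matrix_mult [smooth_intros] = smooth_on_bilinear[OF bounded_bilinear_matrix_mult]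
lemmas smooth_on_qadj [smooth_intros] = smooth_on_linear_compose[OF bounded_linear_qadj]

lemma mult_eq_assoc: "A ** B = C \<Longrightarrow> A ** (B ** Z) = C ** (Z :: quat ^ 'p ^ 'n)"
  by (metis matrix_mul_assoc)

text \<open>
  Left multiplication by \<open>B\<close> is an injective real-linear endomorphism of a finite-dimensional space;
  this avoids determinants, which are unavailable over a noncommutative ring.
\<close>

lemma matrix_left_inverse_imp_right:
  fixes A B :: "quat ^ 'n ^ 'n"
  assumes "A ** B = mat 1"
  shows "B ** A = mat 1"
proof -
  have lin: "linear (\<lambda>C :: quat ^ 'n ^ 'n. B ** C)"
    by (intro linearI) (simp_all add: mult_simps)
  have "inj (\<lambda>C :: quat ^ 'n ^ 'n. B ** C)"
    by (rule injI) (metis assms matrix_mul_assoc matrix_mul_lid)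
  then have "surj (\<lambda>C :: quat ^ 'n ^ 'n. B ** C)"
    using lin linear_injective_imp_surjective by blast
  then obtain C where "B ** C = mat 1" by (metis surjD)
  moreover have "C = A"
    by (metis assms \<open>B ** C = mat 1\<close> matrix_mul_assoc matrix_mul_lid matrix_mul_rid)
  ultimately show ?thesis by simp
qed

text \<open>
  The real part of the trace is cyclic although the quaternionic trace is not, and on orthogonal
  projections it is the quaternionic rank.
\<close>

definition rtr :: "quat ^ 'n ^ 'n \<Rightarrow> real"
  where "rtr A = qRe (trace A)"

lemma qRe_sum: "qRe (sum f S) = (\<Sum>i\<in>S. qRe (f i))"
  by (induction S rule: infinite_finite_induct) simp_all

lemma rtr_eq_sum: "rtr A = (\<Sum>i\<in>UNIV. qRe (A $ i $ i))"
  by (simp add: rtr_def trace_def qRe_sum)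

lemma inner_eq_rtr: "A \<bullet> B = rtr (qadj A ** (B :: quat ^ 'n ^ 'n))"
  unfolding rtr_def by (rule inner_qmat)

lemma rtr_qadj [simp]: "rtr (qadj A) = rtr A"
  by (simp add: rtr_eq_sum qadj_def)

lemma rtr_add: "rtr (A + B) = rtr A + rtr B"
  and rtr_diff: "rtr (A - B) = rtr A - rtr B"
  and rtr_0 [simp]: "rtr 0 = 0"
  by (simp_all add: rtr_eq_sum sum.distrib sum_subtractf)

lemma rtr_mult_commute: "rtr (A ** B) = rtr (B ** (A :: quat ^ 'n ^ 'n))"
proof -
  have "rtr (A ** B) = (\<Sum>i\<in>UNIV. \<Sum>k\<in>UNIV. qRe (A $ i $ k * B $ k $ i))"
    by (simp add: rtr_eq_sum matrix_matrix_mult_def qRe_sum del: quat_mult_sel)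
  also have "\<dots> = (\<Sum>k\<in>UNIV. \<Sum>i\<in>UNIV. qRe (B $ k $ i * A $ i $ k))"
    by (subst sum.swap) (simp add: mult.commute)
  finally show ?thesis
    by (simp add: rtr_eq_sum matrix_matrix_mult_def qRe_sum del: quat_mult_sel)
qed

lemma rtr_qid [simp]: "rtr (qid I) = card I"
proof -
  have "rtr (qid I) = (\<Sum>i\<in>UNIV. if i \<in> I then 1 else 0)"
    unfolding rtr_eq_sum by (rule sum.cong) (auto simp: qid_def)
  then show ?thesis by (simp add: sum.If_cases)
qed

lemma inner_matrix_mult_left: "((A :: quat ^ 'n ^ 'n) ** B) \<bullet> C = B \<bullet> (qadj A ** (C :: quat ^ 'n ^ 'n))"
  by (simp add: inner_eq_rtr qadj_mult matrix_mul_assoc)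

lemma inner_matrix_mult_right: "((A :: quat ^ 'n ^ 'n) ** B) \<bullet> C = A \<bullet> ((C :: quat ^ 'n ^ 'n) ** qadj B)"
  unfolding inner_eq_rtr qadj_mult by (metis matrix_mul_assoc rtr_mult_commute)

lemma qid_mult_qid: "qid I ** qid J = qid (I \<inter> J)"
proof -
  have "(\<Sum>k\<in>UNIV. (if i = k \<and> i \<in> I then 1 else 0) * (if k = j \<and> k \<in> J then 1 else 0 :: quat))
      = (\<Sum>k\<in>UNIV. if k = i then (if i = j \<and> i \<in> I \<inter> J then 1 else 0) else 0)" for i j
    by (rule sum.cong) auto
  then show ?thesis
    by (simp add: qid_def matrix_matrix_mult_def vec_eq_iff)
qed

lemma qid_UNIV: "qid UNIV = mat 1"
  by (simp add: qid_def mat_def vec_eq_iff)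

lemma qid_Compl: "qid (- K) = mat 1 - qid K"
  by (simp add: qid_def mat_def vec_eq_iff)

lemma qid_mult: "qid I ** A = row_block I A"
proof -
  have "(\<Sum>k\<in>UNIV. (if i = k \<and> i \<in> I then 1 else 0) * A $ k $ j)
      = (\<Sum>k\<in>UNIV. if k = i then (if i \<in> I then A $ i $ j else 0) else 0)" for i j
    by (rule sum.cong) auto
  then show ?thesis by (simp add: qid_def row_block_def matrix_matrix_mult_def vec_eq_iff)
qed

lemma mult_qid: "A ** qid J = (\<chi> i j. if j \<in> J then A $ i $ j else 0)"
proof -
  have "(\<Sum>k\<in>UNIV. A $ i $ k * (if k = j \<and> k \<in> J then 1 else 0))
      = (\<Sum>k\<in>UNIV. if k = j then (if j \<in> J then A $ i $ j else 0) else 0)" for i j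
    by (rule sum.cong) auto
  then show ?thesis by (simp add: qid_def matrix_matrix_mult_def vec_eq_iff)
qed

lemma mem_qmats_iff: "A \<in> qmats I J \<longleftrightarrow> qid I ** A = A \<and> A ** qid J = A"
  by (auto simp: qmats_def qid_mult mult_qid row_block_def vec_eq_iff)

text \<open>
  Orthogonal projections represent subspaces throughout.
\<close>

definition hproj :: "quat ^ 'n ^ 'n \<Rightarrow> bool"
  where "hproj A \<longleftrightarrow> qadj A = A \<and> A ** A = A"

lemma hprojD:
  assumes "hproj A"
  shows "qadj A = A" "A ** A = A" "A ** (A ** Z) = A ** (Z :: quat ^ 'p ^ 'n)"
  using assms mult_eq_assoc unfolding hproj_def by auto

lemma hproj_qid [simp]: "hproj (qid I)"
  by (simp add: hproj_def qid_mult_qid)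

lemma hproj_mat_1 [simp]: "hproj (mat 1)"
  by (simp add: hproj_def)

lemma hproj_diff:
  assumes "hproj A" "hproj B" "A ** B = B"
  shows "hproj (A - B)" "B ** A = B"
proof -
  show "B ** A = B" using assms unfolding hproj_def by (metis qadj_mult)
  then show "hproj (A - B)" using assms by (simp add: hproj_def qadj_simps mult_simps)
qed

lemma hproj_mult:
  assumes "hproj A" "hproj B" "A ** B = B ** A"
  shows "hproj (A ** B)"
  using assms unfolding hproj_def by (metis matrix_mul_assoc qadj_mult)

lemma rtr_hproj: "hproj A \<Longrightarrow> rtr A = A \<bullet> A"
  by (simp add: inner_eq_rtr hproj_def)

lemma rtr_hproj_nonneg: "hproj A \<Longrightarrow> rtr A \<ge> 0"
  by (simp add: rtr_hproj)

lemma rtr_hproj_eq_0: "hproj A \<Longrightarrow> rtr A = 0 \<longleftrightarrow> A = 0"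
  by (simp add: rtr_hproj)

lemma hproj_Compl: "hproj A \<Longrightarrow> hproj (mat 1 - A)"
  by (rule hproj_diff) auto

section \<open>The inverse square root near the identity\<close>

text \<open>
  A matrix close to the identity anticommutes only with zero, since \<open>M C + C M\<close> is close to \<open>2 C\<close>.
  This is the source of uniqueness for square roots: if \<open>y\<^sup>2 = z\<^sup>2\<close>, then \<open>y - z\<close> anticommutes with the
  mean of \<open>y\<close> and \<open>z\<close>, and if \<open>C\<close> commutes with \<open>y\<^sup>2\<close>, then \<open>C y - y C\<close> anticommutes with \<open>y\<close>.
\<close>

lemma anticommute_near_1:
  obtains \<epsilon> :: real where "\<epsilon> > 0"
    "\<And>M C :: quat ^ 'n ^ 'n. norm (M - mat 1) < \<epsilon> \<Longrightarrow> M ** C + C ** M = 0 \<Longrightarrow> C = 0"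
proof -
  obtain k where k: "k > 0" "\<And>(A :: quat ^ 'n ^ 'n) (B :: quat ^ 'n ^ 'n). norm (A ** B) \<le> norm A * norm B * k"
    using bounded_bilinear.pos_bounded[OF bounded_bilinear_matrix_mult] by blast
  show thesis
  proof
    show "1 / (2 * k) > 0" using k by simp
    fix M C :: "quat ^ 'n ^ 'n"
    assume M: "norm (M - mat 1) < 1 / (2 * k)" and *: "M ** C + C ** M = 0"
    have "(M - mat 1) ** C + C ** (M - mat 1) = (M ** C + C ** M) - 2 *\<^sub>R C"
      by (simp add: mult_simps scaleR_2)
    then have "2 * norm C = norm ((M - mat 1) ** C + C ** (M - mat 1))"
      using * by simp
    also have "\<dots> \<le> norm (M - mat 1) * norm C * k + norm C * norm (M - mat 1) * k"
      using k(2)[of "M - mat 1" C] k(2)[of C "M - mat 1"]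
      by (intro order_trans[OF norm_triangle_ineq add_mono])
    also have "\<dots> = (2 * k * norm (M - mat 1)) * norm C" by simp
    also have "\<dots> \<le> 1 * norm C"
      using M k(1) by (intro mult_right_mono) (simp_all add: field_simps)
    finally show "C = 0" by simp
  qed
qed

definition inv_sqrt_on :: "(quat ^ 'n ^ 'n) set \<Rightarrow> (quat ^ 'n ^ 'n \<Rightarrow> quat ^ 'n ^ 'n) \<Rightarrow> bool"
  where "inv_sqrt_on V g \<longleftrightarrow> open V \<and> mat 1 \<in> V \<and> smooth_on V g \<and> g (mat 1) = mat 1 \<and>
    (\<forall>N\<in>V. g N ** (N ** g N) = mat 1 \<and> (qadj N = N \<longrightarrow> qadj (g N) = g N) \<and>
      (\<forall>C. C ** N = N ** C \<longrightarrow> C ** g N = g N ** C))"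

text \<open>
  The inverse square root of \<open>N\<close> solves \<open>y N y = 1\<close>.  The polynomial map \<open>(y, N) \<mapsto> (y N y, N)\<close> has the
  invertible derivative \<open>(\<eta>, \<nu>) \<mapsto> (2 \<eta> + \<nu>, \<nu>)\<close> at \<open>(1, 1)\<close>, so the solution exists and is smooth.
\<close>

lemma inv_sqrt_exists: "\<exists>V (g :: quat ^ 'n ^ 'n \<Rightarrow> quat ^ 'n ^ 'n). inv_sqrt_on V g"
proof -
  obtain \<epsilon> :: real where \<epsilon>: "\<epsilon> > 0"
    "\<And>M C :: quat ^ 'n ^ 'n. norm (M - mat 1) < \<epsilon> \<Longrightarrow> M ** C + C ** M = 0 \<Longrightarrow> C = 0"
    using anticommute_near_1 by blast
  define F where "F = (\<lambda>p :: (quat ^ 'n ^ 'n) \<times> (quat ^ 'n ^ 'n). (fst p ** (snd p ** fst p), snd p))"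
  \<comment> \<open>both \<open>y\<close> and its adjoint have to be close to the identity for the proof that \<open>y\<close> is hermitian\<close>
  define W where "W = {p :: (quat ^ 'n ^ 'n) \<times> (quat ^ 'n ^ 'n).
    norm (fst p - mat 1) < \<epsilon> \<and> norm (qadj (fst p) - mat 1) < \<epsilon>}"
  have "open W" unfolding W_def
    by (intro open_Collect_conj open_Collect_less continuous_intros
        bounded_linear.continuous_on[OF bounded_linear_qadj])
  have smF: "smooth_on W F" unfolding F_def by (intro smooth_intros)
  have 1: "(mat 1, mat 1) \<in> W" using \<epsilon>(1) by (simp add: W_def)
  have dF: "(F has_derivative (\<lambda>h. (fst h + snd h + fst h, snd h))) (at (mat 1, mat 1))"
    unfolding F_def
    by (auto intro!: derivative_eq_intros bounded_bilinear.FDERIV[OF bounded_bilinear_matrix_mult])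
  have injF: "inj (\<lambda>h :: (quat ^ 'n ^ 'n) \<times> (quat ^ 'n ^ 'n). (fst h + snd h + fst h, snd h))"
  proof (rule injI)
    fix h k :: "(quat ^ 'n ^ 'n) \<times> (quat ^ 'n ^ 'n)"
    assume *: "(fst h + snd h + fst h, snd h) = (fst k + snd k + fst k, snd k)"
    have "fst h + fst h = (fst h + snd h + fst h) - snd h" by simp
    also have "\<dots> = (fst k + snd k + fst k) - snd k"
      using arg_cong[OF *, of fst] arg_cong[OF *, of snd] by simp
    also have "\<dots> = fst k + fst k" by simp
    finally have "fst h + fst h = fst k + fst k" .
    then have "fst h = fst k" by (simp add: scaleR_2[symmetric])
    then show "h = k" using * by (simp add: prod_eq_iff)
  qed
  obtain U V where UV: "open U" "(mat 1, mat 1) \<in> U" "U \<subseteq> W" "open V" "diffeo U V F"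
    by (rule smooth_inverse_function[OF \<open>open W\<close> smF 1 dF injF])
  define G where "G = inv_into U F"
  define g where "g = (\<lambda>N. fst (G (mat 1, N)))"
  define V' where "V' = Pair (mat 1) -` V"
  have bij: "bij_betw F U V" and smG: "smooth_on V G"
    using UV(5) unfolding diffeo_def G_def by blast+
  have "open V'" unfolding V'_def by (rule open_vimage[OF UV(4)]) (intro continuous_intros)
  have "F (mat 1, mat 1) = (mat 1, mat 1)" by (simp add: F_def)
  then have 1: "(mat 1, mat 1) \<in> V" "G (mat 1, mat 1) = (mat 1, mat 1)"
    using bij UV(2) unfolding G_def bij_betw_def by (metis imageI inv_into_f_f)+
  have smg: "smooth_on V' g" unfolding g_def
    by (intro smooth_on_fst smooth_on_compose[OF _ smG] smooth_intros) (auto simp: V'_def)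
  have main: "g N ** (N ** g N) = mat 1 \<and> (qadj N = N \<longrightarrow> qadj (g N) = g N) \<and>
      (\<forall>C. C ** N = N ** C \<longrightarrow> C ** g N = g N ** C)" if N: "N \<in> V'" for N
  proof -
    define y where "y = g N"
    have "F (G (mat 1, N)) = (mat 1, N)" and GU: "G (mat 1, N) \<in> U"
      using N bij unfolding G_def V'_def
      by (auto simp: bij_betw_inv_into_right bij_betw_def inv_into_into)
    then have "fst (G (mat 1, N)) ** (snd (G (mat 1, N)) ** fst (G (mat 1, N))) = mat 1"
      "snd (G (mat 1, N)) = N"
      unfolding F_def prod.inject by blast+
    then have y: "y ** (N ** y) = mat 1" unfolding y_def g_def by metis
    have yW: "norm (y - mat 1) < \<epsilon>" "norm (qadj y - mat 1) < \<epsilon>"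
      using GU UV(3) by (auto simp: W_def y_def g_def)
    \<comment> \<open>\<open>y\<close> is a unit with inverse \<open>N y = y N\<close>, hence \<open>N\<close> is the inverse of \<open>y\<^sup>2\<close>.\<close>
    have sqN: "z ** z ** N = mat 1" "N ** (z ** z) = mat 1" if "z ** (N ** z) = mat 1" for z
    proof -
      have a: "N ** z ** z = mat 1" using matrix_left_inverse_imp_right[OF that] .
      then show b: "N ** (z ** z) = mat 1" by (simp add: matrix_mul_assoc)
      show "z ** z ** N = mat 1" by (rule matrix_left_inverse_imp_right[OF b])
    qed
    have "C ** y = y ** C" if C: "C ** N = N ** C" for C
    proof -
      have "C ** (y ** y) = (y ** y ** N) ** C ** (y ** y)" by (simp add: sqN[OF y])
      also have "\<dots> = y ** y ** (C ** N) ** (y ** y)" by (simp add: C matrix_mul_assoc)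
      also have "\<dots> = y ** y ** C ** (N ** (y ** y))" by (simp add: matrix_mul_assoc)
      finally have "C ** (y ** y) = y ** y ** C" by (simp add: sqN[OF y])
      then have "y ** (C ** y - y ** C) + (C ** y - y ** C) ** y = 0" by (simp add: mult_simps)
      then show ?thesis using \<epsilon>(2)[OF yW(1)] by (metis eq_iff_diff_eq_0)
    qed
    moreover have "qadj y = y" if h: "qadj N = N"
    proof -
      have "qadj y ** (N ** qadj y) = mat 1"
        using arg_cong[OF y, of qadj] h by (simp add: qadj_mult matrix_mul_assoc)
      then have "qadj y ** qadj y = y ** y"
        using sqN[of "qadj y"] sqN[OF y] by (metis matrix_mul_assoc matrix_mul_lid matrix_mul_rid)
      then have eq: "((1/2) *\<^sub>R (y + qadj y)) ** (y - qadj y) + (y - qadj y) ** ((1/2) *\<^sub>R (y + qadj y)) = 0"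
        by (simp add: mult_simps scaleR_right_diff_distrib scaleR_right_distrib)
      have "(1/2) *\<^sub>R (y + qadj y) - mat 1 = (1/2) *\<^sub>R ((y - mat 1) + (qadj y - mat 1))"
        by (simp add: algebra_simps scaleR_2[symmetric])
      then have "norm ((1/2) *\<^sub>R (y + qadj y) - mat 1) \<le> (norm (y - mat 1) + norm (qadj y - mat 1)) / 2"
        using norm_triangle_ineq[of "y - mat 1" "qadj y - mat 1"] by simp
      then have "norm ((1/2) *\<^sub>R (y + qadj y) - mat 1) < \<epsilon>" using yW by simp
      then show ?thesis using \<epsilon>(2)[OF _ eq] by (metis eq_iff_diff_eq_0)
    qed
    ultimately show ?thesis using y unfolding y_def by blast
  qed
  have "inv_sqrt_on V' g"
    unfolding inv_sqrt_on_def
    by (intro conjI[OF \<open>open V'\<close>] conjI[OF _ conjI[OF smg conjI[OF _ ballI[OF main]]]])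
      (use 1 in \<open>simp_all add: V'_def g_def\<close>)
  then show ?thesis by blast
qed

definition isqrt_dom :: "(quat ^ 'n ^ 'n) set"
  where "isqrt_dom = (SOME V. \<exists>g. inv_sqrt_on V g)"

definition isqrt :: "quat ^ 'n ^ 'n \<Rightarrow> quat ^ 'n ^ 'n"
  where "isqrt = (SOME g. inv_sqrt_on isqrt_dom g)"

lemma inv_sqrt_on_isqrt: "inv_sqrt_on (isqrt_dom :: (quat ^ 'n ^ 'n) set) isqrt"
proof -
  have "\<exists>g. inv_sqrt_on (isqrt_dom :: (quat ^ 'n ^ 'n) set) g"
    unfolding isqrt_dom_def by (rule someI_ex[OF inv_sqrt_exists])
  then show ?thesis unfolding isqrt_def by (rule someI_ex)
qed

lemmas isqrt_facts = inv_sqrt_on_isqrt[unfolded inv_sqrt_on_def]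

lemmas open_isqrt_dom = isqrt_facts[THEN conjunct1]
  and mat_1_isqrt_dom = isqrt_facts[THEN conjunct2, THEN conjunct1]
  and smooth_on_isqrt = isqrt_facts[THEN conjunct2, THEN conjunct2, THEN conjunct1]
  and isqrt_mat_1 = isqrt_facts[THEN conjunct2, THEN conjunct2, THEN conjunct2, THEN conjunct1]
  and isqrt_props = isqrt_facts[THEN conjunct2, THEN conjunct2, THEN conjunct2, THEN conjunct2, THEN bspec]

lemmas isqrt_mult = isqrt_props[THEN conjunct1]
  and qadj_isqrt = isqrt_props[THEN conjunct2, THEN conjunct1, THEN mp]
  and isqrt_commute = isqrt_props[THEN conjunct2, THEN conjunct2, THEN spec, THEN mp]

section \<open>Traces, dimensions and Grassmannians\<close>

text \<open>
  The rank of an orthogonal projection is its trace, for real Euclidean spaces.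
\<close>

lemma dim_range_eq_trace:
  fixes P :: "'a::euclidean_space \<Rightarrow> 'a"
  assumes lin: "linear P" and idem: "\<And>v. P (P v) = P v" and sa: "\<And>u v. P u \<bullet> v = u \<bullet> P v"
  shows "real (dim (range P)) = (\<Sum>b\<in>Basis. P b \<bullet> b)"
proof -
  have sub: "subspace (range P)" using linear_subspace_image[OF lin subspace_UNIV] .
  obtain W where W: "W \<subseteq> range P" "pairwise orthogonal W" "\<And>x. x \<in> W \<Longrightarrow> norm x = 1"
    "independent W" "card W = dim (range P)" "span W = range P"
    by (rule orthonormal_basis_subspace[OF sub]) blast
  have fin: "finite W" using independent_imp_finite[OF W(4)] .
  have PW: "P w = w" if "w \<in> W" for w using W(1) that idem by fastforce
  have expand: "P v = (\<Sum>w\<in>W. (v \<bullet> w) *\<^sub>R w)" for v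
  proof -
    have "P v - (\<Sum>w\<in>W. (v \<bullet> w) *\<^sub>R w) = 0"
    proof (rule ccontr)
      define d where "d = P v - (\<Sum>w\<in>W. (v \<bullet> w) *\<^sub>R w)"
      have "d \<in> span W" unfolding d_def W(6)
        using W(1) by (intro subspace_diff[OF sub] subspace_sum[OF sub] subspace_scale[OF sub]) auto
      moreover have "orthogonal d w" if w: "w \<in> W" for w
      proof -
        have "(\<Sum>w'\<in>W. (v \<bullet> w') * (w' \<bullet> w)) = (\<Sum>w'\<in>W. if w' = w then v \<bullet> w else 0)"
          using W(2,3) w
          by (intro sum.cong refl) (auto simp: pairwise_def orthogonal_def norm_eq_1)
        then show ?thesis
          using w fin sa[of v w] PW[OF w] by (simp add: d_def orthogonal_def inner_diff_left inner_sum_left)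
      qed
      ultimately have "orthogonal d d" by (metis orthogonal_to_span orthogonal_commute)
      then have "d = 0" by (simp add: orthogonal_def)
      moreover assume "P v - (\<Sum>w\<in>W. (v \<bullet> w) *\<^sub>R w) \<noteq> 0"
      ultimately show False by (simp add: d_def)
    qed
    then show ?thesis by simp
  qed
  have "(\<Sum>b\<in>Basis. P b \<bullet> b) = (\<Sum>b\<in>Basis. \<Sum>w\<in>W. (b \<bullet> w) * (w \<bullet> b))"
    by (simp add: expand inner_sum_left)
  also have "\<dots> = (\<Sum>w\<in>W. w \<bullet> w)"
    by (subst sum.swap, rule sum.cong[OF refl], subst (3) euclidean_inner) (simp add: inner_commute)
  also have "\<dots> = (\<Sum>w\<in>W. 1)" using W(3) by (intro sum.cong) (auto simp: norm_eq_1)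
  finally show ?thesis by (simp add: W(5)[symmetric])
qed

lemma sum_Basis_vec:
  "(\<Sum>b\<in>(Basis :: ('a::euclidean_space ^ 'n) set). f b) = (\<Sum>i\<in>UNIV. \<Sum>u\<in>Basis. f (axis i u))"
proof -
  have B: "(Basis :: ('a ^ 'n) set) = (\<lambda>(i, u). axis i u) ` (UNIV \<times> Basis)"
    unfolding Basis_vec_def by force
  have inj: "inj_on (\<lambda>(i, u). axis i u :: 'a ^ 'n) (UNIV \<times> Basis)"
    by (auto simp: inj_on_def axis_eq_axis)
  show ?thesis
    unfolding B sum.reindex[OF inj] by (simp add: sum.cartesian_product case_prod_unfold)
qed

lemma sum_quat_Basis_sandwich: "(\<Sum>c\<in>Basis. (a * c * b) \<bullet> c) = 4 * qRe a * qRe b"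
  unfolding Basis_quat_def by (simp add: inner_quat_def algebra_simps)

text \<open>
  On the matrix whose only nonzero entry is the quaternion unit \<open>c\<close> at position \<open>(i, j)\<close>, the diagonal coefficient of
  \<open>W \<mapsto> A W B\<close> is the real part of \<open>c\<^sup>* a c b\<close> for the diagonal entries \<open>a = A\<^sub>i\<^sub>i\<close> and \<open>b = B\<^sub>j\<^sub>j\<close>; the factor four
  is the sum of \<open>c\<^sup>* a c\<close> over the four units \<open>c\<close>, which is \<open>4 Re a\<close>.
\<close>

lemma trace_sandwich:
  fixes A B :: "quat ^ 'n ^ 'n"
  shows "(\<Sum>W\<in>Basis. (A ** W ** B) \<bullet> W) = 4 * rtr A * rtr B"
proof -
  have AW: "(A ** axis i (axis j c)) $ a $ b = (if b = j then A $ a $ i * c else 0)" for i j c a b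
  proof -
    have "(A ** axis i (axis j c)) $ a $ b = (\<Sum>k\<in>UNIV. A $ a $ k * axis i (axis j c) $ k $ b)"
      by (simp add: matrix_matrix_mult_def)
    also have "\<dots> = (\<Sum>k\<in>UNIV. if k = i then (if b = j then A $ a $ i * c else 0) else 0)"
      by (rule sum.cong) (auto simp: axis_def)
    finally show ?thesis by simp
  qed
  have "(A ** axis i (axis j c) ** B) $ i $ j = A $ i $ i * c * B $ j $ j" for i j c
  proof -
    have "(A ** axis i (axis j c) ** B) $ i $ j = (\<Sum>k\<in>UNIV. (A ** axis i (axis j c)) $ i $ k * B $ k $ j)"
      by (simp add: matrix_matrix_mult_def[of _ B])
    also have "\<dots> = (\<Sum>k\<in>UNIV. if k = j then A $ i $ i * c * B $ j $ j else 0)"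
      unfolding AW by (rule sum.cong) auto
    finally show ?thesis by simp
  qed
  then have "(\<Sum>W\<in>Basis. (A ** W ** B) \<bullet> W) = (\<Sum>i\<in>UNIV. \<Sum>j\<in>UNIV. 4 * qRe (A $ i $ i) * qRe (B $ j $ j))"
    by (simp add: sum_Basis_vec inner_axis sum_quat_Basis_sandwich)
  also have "\<dots> = 4 * rtr A * rtr B"
    by (simp add: rtr_eq_sum sum_distrib_left sum_distrib_right) (rule sum.swap)
  finally show ?thesis .
qed

lemma dim_sandwich:
  fixes A B :: "quat ^ 'n ^ 'n"
  assumes "hproj A" "hproj B"
  shows "real (dim {W. A ** (W ** B) = W}) = 4 * rtr A * rtr B"
proof -
  have idem: "A ** ((A ** (W ** B)) ** B) = A ** (W ** B)" for W
    using assms by (simp add: hprojD matrix_mul_assoc[symmetric])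
  have "range (\<lambda>W. A ** (W ** B)) = {W. A ** (W ** B) = W}"
    using idem by (auto intro: rangeI) (metis rangeI)
  moreover have "real (dim (range (\<lambda>W. A ** (W ** B)))) = (\<Sum>W\<in>Basis. (A ** (W ** B)) \<bullet> W)"
  proof (rule dim_range_eq_trace)
    show "linear (\<lambda>W. A ** (W ** B))" by (rule linearI) (simp_all add: mult_simps)
    show "(A ** (u ** B)) \<bullet> v = u \<bullet> (A ** (v ** B))" for u v
      unfolding inner_matrix_mult_left[of A "u ** B"] inner_matrix_mult_right[of u B]
      using assms by (simp add: hprojD matrix_mul_assoc)
  qed (rule idem)
  ultimately show ?thesis using trace_sandwich[of A B] by (simp add: matrix_mul_assoc)
qed

lemma dim_range_matrix:
  fixes A :: "quat ^ 'n ^ 'n"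
  assumes "hproj A"
  shows "real (dim (range (\<lambda>v. A *v v))) = 4 * rtr A"
proof -
  have "real (dim (range (\<lambda>v. A *v v))) = (\<Sum>b\<in>Basis. (A *v b) \<bullet> b)"
  proof (rule dim_range_eq_trace)
    show "linear (\<lambda>v. A *v v)"
      by (rule linearI)
        (simp_all add: matrix_vector_mult_def vec_eq_iff distrib_left sum.distrib scaleR_sum_right)
    show "A *v (A *v v) = A *v v" for v
      using assms by (simp add: matrix_vector_mul_assoc hprojD)
    show "(A *v u) \<bullet> v = u \<bullet> (A *v v)" for u v
      using qadj_adjoint[of A u v] assms by (simp add: hprojD)
  qed
  also have "\<dots> = (\<Sum>i\<in>UNIV. \<Sum>c\<in>Basis. (A $ i $ i * c * 1) \<bullet> c)"
    unfolding sum_Basis_vec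
  proof (intro sum.cong refl)
    fix i and c :: quat
    have "(A *v axis i c) $ i = (\<Sum>k\<in>UNIV. A $ i $ k * axis i c $ k)"
      by (simp add: matrix_vector_mult_def)
    also have "\<dots> = (\<Sum>k\<in>UNIV. if k = i then A $ i $ i * c else 0)"
      by (rule sum.cong) (auto simp: axis_def)
    finally show "(A *v axis i c) \<bullet> axis i c = (A $ i $ i * c * 1) \<bullet> c" by (simp add: inner_axis)
  qed
  finally show ?thesis
    unfolding sum_quat_Basis_sandwich by (simp add: rtr_eq_sum sum_distrib_left)
qed

lemma qcnj_mult_self: "qcnj x * x = of_real ((norm x)\<^sup>2)"
  by (simp add: norm_quat_def of_real_def quat_eq_iff inner_quat_def)

lemma qcnj_0 [simp]: "qcnj 0 = 0"
  by (simp add: quat_eq_iff)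

text \<open>
  A normalised nonzero column of \<open>G\<close>, moved to position \<open>j\<close>.
\<close>

lemma unit_column_in_range:
  fixes G :: "quat ^ 'n ^ 'n"
  assumes "hproj G" "G \<noteq> 0"
  obtains C :: "quat ^ 'n ^ 'n" where "C ** qid {j} = C" "qadj C ** C = qid {j}" "G ** C = C"
proof -
  obtain i where i: "column i G \<noteq> 0"
    using assms(2) by (auto simp: vec_eq_iff column_def)
  define w where "w = column i G"
  define C :: "quat ^ 'n ^ 'n" where "C = (\<chi> a b. if b = j then (1 / norm w) *\<^sub>R w $ a else 0)"
  have nw: "norm w > 0" using i by (simp add: w_def)
  have sumw: "(\<Sum>a\<in>UNIV. qcnj (w $ a) * w $ a) = of_real ((norm w)\<^sup>2)"
    unfolding qcnj_mult_self norm_vec_def L2_set_def by (simp add: sum_nonneg)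
  have Gw: "(\<Sum>k\<in>UNIV. G $ a $ k * w $ k) = w $ a" for a
    using hprojD(2)[OF assms(1)] unfolding w_def column_def matrix_matrix_mult_def
    by (simp add: vec_eq_iff)
  show thesis
  proof
    show "C ** qid {j} = C" unfolding mult_qid by (simp add: C_def vec_eq_iff)
    show "G ** C = C"
      by (simp add: C_def vec_eq_iff matrix_matrix_mult_def Gw scaleR_sum_right[symmetric])
    have "(\<Sum>a\<in>UNIV. qcnj ((1 / norm w) *\<^sub>R w $ a) * ((1 / norm w) *\<^sub>R w $ a)) = 1"
    proof -
      have "qcnj (r *\<^sub>R x) * (r *\<^sub>R x) = r\<^sup>2 *\<^sub>R (qcnj x * x)" for x and r :: real
        by (simp add: quat_eq_iff power2_eq_square algebra_simps)
      then have "(\<Sum>a\<in>UNIV. qcnj ((1 / norm w) *\<^sub>R w $ a) * ((1 / norm w) *\<^sub>R w $ a))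
          = (1 / norm w)\<^sup>2 *\<^sub>R of_real ((norm w)\<^sup>2)"
        unfolding sumw[symmetric] scaleR_sum_right by presburger
      also have "\<dots> = 1" using nw by (simp add: of_real_def power_divide)
      finally show ?thesis .
    qed
    then have "(qadj C ** C) $ a $ b = qid {j} $ a $ b" for a b
      by (cases "a = j"; cases "b = j")
        (simp_all add: C_def qadj_def qid_def matrix_matrix_mult_def del: mult_scaleR_left mult_scaleR_right)
    then show "qadj C ** C = qid {j}" by (simp add: vec_eq_iff)
  qed
qed

text \<open>
  Gram-Schmidt in the form of a maximality argument: as long as \<open>x x\<^sup>*\<close> is smaller than \<open>F\<close>, a unit vector
  in the range of the difference provides one more orthonormal column.  The set \<open>J\<close> consists of the positions
  of the columns used; taking \<open>K\<close> of the exact size \<open>rtr F\<close> forces \<open>J = K\<close>.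
\<close>

theorem hproj_partial_isometry:
  fixes F :: "quat ^ 'n ^ 'n" and K :: "'n set"
  assumes F: "hproj F" and K: "rtr F \<le> real (card K)"
  obtains J x where "J \<subseteq> K" "x ** qid J = x" "qadj x ** x = qid J" "x ** qadj x = F" "rtr F = card J"
proof -
  define good where "good = (\<lambda>J. J \<subseteq> K \<and> (\<exists>x. x ** qid J = x \<and> qadj x ** x = qid J \<and> F ** x = x))"
  have "qid {} = (0 :: quat ^ 'n ^ 'n)" by (simp add: qid_def vec_eq_iff)
  then have "good {}" unfolding good_def by (auto intro!: exI[of _ 0] simp: qadj_simps)
  moreover have "\<forall>J. good J \<longrightarrow> card J < Suc (card K)"
    unfolding good_def less_Suc_eq_le using card_mono[OF finite[of K]] by blast
  ultimately obtain J where J: "good J" and max: "\<And>J'. good J' \<Longrightarrow> card J' \<le> card J"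
    using ex_has_greatest_nat[of good "{}" card "Suc (card K)"] by blast
  obtain x where x: "x ** qid J = x" "qadj x ** x = qid J" "F ** x = x" and JK: "J \<subseteq> K"
    using J unfolding good_def by blast
  have Fx: "F ** (x ** qadj x) = x ** qadj x" using x(3) by (simp add: matrix_mul_assoc)
  have xx: "hproj (x ** qadj x)"
    using x(1,2) unfolding hproj_def
    by (simp add: qadj_simps) (metis matrix_mul_assoc)
  define G where "G = F - x ** qadj x"
  have G: "hproj G" unfolding G_def by (rule hproj_diff(1)[OF F xx Fx])
  have rtrx: "rtr (x ** qadj x) = card J" by (simp add: rtr_mult_commute[of x] x(2))
  have "G = 0"
  proof (rule ccontr)
    assume "G \<noteq> 0"
    then have "rtr G > 0" using rtr_hproj_eq_0[OF G] rtr_hproj_nonneg[OF G] by simp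
    then have "card J < card K" using K rtrx by (simp add: G_def rtr_diff)
    then obtain j where j: "j \<in> K" "j \<notin> J" using JK by (metis less_irrefl subsetI subset_antisym)
    obtain C where C: "C ** qid {j} = C" "qadj C ** C = qid {j}" "G ** C = C"
      using unit_column_in_range[OF G \<open>G \<noteq> 0\<close>] by blast
    have "qadj x ** F = qadj x" using x(3) F by (metis hprojD(1) qadj_mult)
    then have "qadj x ** G = 0"
      using x(1,2) by (simp add: G_def mult_simps mult_eq_assoc[OF x(2)])
        (metis qadj_mult qadj_qid)
    then have xC: "qadj x ** C = 0" using C(3) by (metis matrix_mul_assoc times0_left)
    then have Cx: "qadj C ** x = 0" by (metis qadj_mult qadj_qadj qadj_simps(6))
    have FC: "F ** C = C"
      using C(3) xC unfolding G_def by (simp add: mult_simps)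
    have "good (insert j J)"
      unfolding good_def
    proof (intro conjI exI[of _ "x + C"])
      show "insert j J \<subseteq> K" using j JK by simp
      have "x ** qid (insert j J) = x"
        using j(2) by (subst (1 2) x(1)[symmetric]) (simp add: matrix_mul_assoc[symmetric] qid_mult_qid Int_insert_right Int_absorb)
      moreover have "C ** qid (insert j J) = C"
        by (subst (1 2) C(1)[symmetric]) (simp add: matrix_mul_assoc[symmetric] qid_mult_qid)
      ultimately show "(x + C) ** qid (insert j J) = x + C" by (simp add: mult_simps)
      have "qid J + qid {j} = qid (insert j J)"
        using j(2) by (auto simp: qid_def vec_eq_iff)
      then show "qadj (x + C) ** (x + C) = qid (insert j J)"
        by (simp add: qadj_simps mult_simps xC Cx x(2) C(2))
      show "F ** (x + C) = x + C" by (simp add: mult_simps x(3) FC)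
    qed
    then have "card (insert j J) \<le> card J" by (rule max)
    then show False using j(2) by simp
  qed
  then have "x ** qadj x = F" by (simp add: G_def)
  then show thesis using that JK x(1,2) rtrx by auto
qed

lemma rtr_hproj_le_CARD:
  fixes A :: "quat ^ 'n ^ 'n"
  assumes "hproj A"
  shows "rtr A \<le> real CARD('n)"
  using rtr_hproj_nonneg[OF hproj_Compl[OF assms]] rtr_qid[of "UNIV :: 'n set"]
  by (simp add: rtr_diff qid_UNIV)

text \<open>
  The rank of a projection is an integer, so it is locally constant.  This is what separates the
  critical levels and the components of the Grassmannians.
\<close>

lemma rtr_hproj_nat:
  assumes "hproj A"
  obtains l :: nat where "rtr A = real l"
  using hproj_partial_isometry[OF assms, of UNIV] rtr_hproj_le_CARD[OF assms] by metis

lemma rtr_hproj_eqI: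
  assumes "hproj A" "\<bar>rtr A - real l\<bar> < 1"
  shows "rtr A = real l"
proof -
  obtain m where m: "rtr A = real m" using rtr_hproj_nat[OF assms(1)] .
  then have "m = l" using assms(2) by (simp add: abs_less_iff)
  then show ?thesis using m by simp
qed

text \<open>
  Multiplying a quaternionic basis by the four units gives a real basis; so the size of a quaternionic
  basis is determined by the subspace.
\<close>

lemma right_basis_dim:
  fixes B :: "(quat ^ 'n) set"
  assumes "right_basis B V"
  shows "dim V = 4 * card B"
proof -
  have fin: "finite B" and V: "{\<Sum>b\<in>B. rscale b (c b) | c. True} = V"
    and ind: "\<And>c b. (\<Sum>b\<in>B. rscale b (c b)) = 0 \<Longrightarrow> b \<in> B \<Longrightarrow> c b = 0"
    using assms unfolding right_basis_def by blast+
  have rsum: "rscale b (\<Sum>q\<in>Q. f q *\<^sub>R q) = (\<Sum>q\<in>Q. f q *\<^sub>R rscale b q)" if "finite Q" for b :: "quat ^ 'n" and f Q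
    using that
    by (induction Q) (simp_all add: rscale_def vec_eq_iff distrib_left)
  define h where "h = (\<lambda>(b :: quat ^ 'n, q). rscale b q)"
  have inj: "inj_on h (B \<times> Basis)"
  proof (rule inj_onI, clarify)
    fix b b' q q' assume b: "b \<in> B" "b' \<in> B" "q \<in> (Basis :: quat set)" "q' \<in> (Basis :: quat set)"
      and eq: "h (b, q) = h (b', q')"
    define c where "c = (\<lambda>d. (if d = b then q else 0) - (if d = b' then q' else 0))"
    have "(\<Sum>d\<in>B. rscale d (c d)) = (\<Sum>d\<in>B. if d = b then rscale b q else 0) - (\<Sum>d\<in>B. if d = b' then rscale b' q' else 0)"
      unfolding sum_subtractf[symmetric]
      by (rule sum.cong) (auto simp: c_def rscale_def vec_eq_iff right_diff_distrib)
    also have "\<dots> = 0" using b eq fin by (simp add: h_def)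
    finally have "c b = 0" using ind b by blast
    then show "b = b' \<and> q = q'" using b by (auto simp: c_def split: if_splits)
  qed
  have key: "(\<Sum>p\<in>B \<times> Basis. f p *\<^sub>R h p) = (\<Sum>b\<in>B. rscale b (\<Sum>q\<in>Basis. f (b, q) *\<^sub>R q))" for f
    by (simp add: rsum h_def sum.cartesian_product case_prod_unfold)
  define T where "T = h ` (B \<times> Basis)"
  have finT: "finite T" using fin by (simp add: T_def)
  have "independent T"
    unfolding independent_explicit
  proof (intro conjI finT allI impI ballI)
    fix c v assume "(\<Sum>v\<in>T. c v *\<^sub>R v) = 0" and v: "v \<in> T"
    then have "(\<Sum>b\<in>B. rscale b (\<Sum>q\<in>Basis. c (h (b, q)) *\<^sub>R q)) = 0"
      unfolding T_def sum.reindex[OF inj] using key[of "\<lambda>p. c (h p)"] by simp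
    then have z: "(\<Sum>q\<in>Basis. c (h (b, q)) *\<^sub>R q) = 0" if "b \<in> B" for b
      using ind[of "\<lambda>b. \<Sum>q\<in>Basis. c (h (b, q)) *\<^sub>R q"] that by simp
    obtain b q where bq: "b \<in> B" "q \<in> Basis" "v = h (b, q)" using v by (auto simp: T_def)
    have "(\<Sum>q\<in>Basis. c (h (b, q)) *\<^sub>R q) \<bullet> q = c (h (b, q))"
      using bq(2) by (simp add: inner_sum_left_Basis)
    then show "c v = 0" using z[OF bq(1)] bq(3) by simp
  qed
  moreover have "span T = V"
  proof -
    have "span T = range (\<lambda>c. \<Sum>v\<in>T. c v *\<^sub>R v)" using span_finite[OF finT] .
    also have "\<dots> = V"
    proof (intro equalityI subsetI)
      fix v assume "v \<in> range (\<lambda>c. \<Sum>v\<in>T. c v *\<^sub>R v)"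
      then obtain c where "v = (\<Sum>v\<in>T. c v *\<^sub>R v)" by blast
      also have "\<dots> = (\<Sum>b\<in>B. rscale b (\<Sum>q\<in>Basis. c (h (b, q)) *\<^sub>R q))"
        unfolding T_def sum.reindex[OF inj] using key[of "\<lambda>p. c (h p)"] by simp
      finally have "v \<in> {\<Sum>b\<in>B. rscale b (c b) | c. True}"
        by (intro CollectI exI[of _ "\<lambda>b. \<Sum>q\<in>Basis. c (h (b, q)) *\<^sub>R q"] conjI TrueI)
      then show "v \<in> V" unfolding V .
    next
      fix v assume "v \<in> V"
      then obtain c where c: "v = (\<Sum>b\<in>B. rscale b (c b))" using V by blast
      define d where "d = (\<lambda>w. let p = inv_into (B \<times> Basis) h w in c (fst p) \<bullet> snd p)"
      have d: "d (h p) = c (fst p) \<bullet> snd p" if "p \<in> B \<times> Basis" for p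
        using that inj by (simp add: d_def Let_def)
      have "(\<Sum>v\<in>T. d v *\<^sub>R v) = (\<Sum>p\<in>B \<times> Basis. (c (fst p) \<bullet> snd p) *\<^sub>R h p)"
        unfolding T_def sum.reindex[OF inj] by (rule sum.cong) (simp_all add: d del: mem_Sigma_iff)
      also have "\<dots> = v" unfolding key c by (simp add: euclidean_representation)
      finally show "v \<in> range (\<lambda>c. \<Sum>v\<in>T. c v *\<^sub>R v)"
        by (intro range_eqI[where f = "\<lambda>c. \<Sum>v\<in>T. c v *\<^sub>R v" and x = d]) simp
    qed
    finally show ?thesis .
  qed
  moreover have "card T = 4 * card B"
    unfolding T_def card_image[OF inj] by (simp add: card_cartesian_product Basis_quat_def)
  ultimately show ?thesis by (metis dim_span_eq_card_independent)
qed

text \<open>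
  The projections of rank \<open>l\<close> whose range lies in the range of \<open>i\<close>: the Grassmannian in its
  projection embedding, see \<open>Gr_manifold_eq_projections\<close>.
\<close>

definition projections :: "quat ^ 'n ^ 'n \<Rightarrow> nat \<Rightarrow> (quat ^ 'n ^ 'n) set"
  where "projections i l = {A. hproj A \<and> i ** A = A \<and> rtr A = real l}"

lemma orth_proj_props:
  assumes "right_subspace V"
  shows "hproj (orth_proj V)" "range (\<lambda>v. orth_proj V *v v) = V"
  using theI'[OF orth_proj_ex1[OF assms]] unfolding orth_proj_def[symmetric] hproj_def by blast+

lemma orth_proj_eqI:
  assumes "right_subspace V" "hproj A" "range (\<lambda>v. A *v v) = V"
  shows "orth_proj V = A"
  using the1_equality[OF orth_proj_ex1[OF assms(1)]] assms(2,3) unfolding orth_proj_def hproj_def by blast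

lemma mem_qvecs_iff: "v \<in> qvecs I \<longleftrightarrow> qid I *v v = v"
proof -
  have "(qid I *v v) $ i = (\<Sum>k\<in>UNIV. (if i = k \<and> i \<in> I then 1 else 0) * v $ k)" for i
    by (simp add: matrix_vector_mult_def qid_def)
  also have "\<dots> i = (\<Sum>k\<in>UNIV. if k = i then (if i \<in> I then v $ i else 0) else 0)" for i
    by (rule sum.cong) auto
  finally have "(qid I *v v) $ i = (if i \<in> I then v $ i else 0)" for i
    by simp
  then show ?thesis by (auto simp: qvecs_def vec_eq_iff)
qed

lemma rscale_matrix_vector: "A *v rscale v a = rscale (A *v v) a"
  by (simp add: matrix_vector_mult_def rscale_def vec_eq_iff sum_distrib_right mult.assoc)

lemma right_subspace_range: "right_subspace (range (\<lambda>v. (A :: quat ^ 'n ^ 'n) *v v))"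
proof -
  have "A *v 0 = 0" by (simp add: matrix_vector_mult_def vec_eq_iff)
  moreover have "A *v u + A *v v = A *v (u + v)" for u v
    by (simp add: matrix_vector_mult_def vec_eq_iff distrib_left sum.distrib)
  ultimately show ?thesis
    unfolding right_subspace_def by (auto simp: rscale_matrix_vector[symmetric] intro: range_eqI[of 0 _ 0])
qed

lemma right_basis_columns:
  fixes x :: "quat ^ 'n ^ 'n"
  assumes x: "x ** qid J = x" "qadj x ** x = qid J"
  shows "right_basis ((\<lambda>j. column j x) ` J) (range (\<lambda>v. (x ** qadj x) *v v))"
    and "card ((\<lambda>j. column j x) ` J) = card J"
proof -
  let ?B = "(\<lambda>j. column j x) ` J"
  have entry: "(qadj x ** x) $ a $ b = (\<Sum>k\<in>UNIV. qcnj (x $ k $ a) * column b x $ k)" for a b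
    by (simp add: matrix_matrix_mult_def qadj_def column_def)
  have inj: "inj_on (\<lambda>j. column j x) J"
  proof (rule inj_onI)
    fix a b assume ab: "a \<in> J" "b \<in> J" "column a x = column b x"
    then have "qid J $ a $ a = (qid J $ a $ b :: quat)"
      unfolding x(2)[symmetric] entry by simp
    then show "a = b" using ab by (auto simp: qid_def split: if_splits)
  qed
  show "card ?B = card J" by (rule card_image[OF inj])
  have lin: "(\<Sum>j\<in>J. rscale (column j x) (w j)) = x *v (\<chi> j. if j \<in> J then w j else 0)" for w
    unfolding vec_eq_iff
    by (auto simp: matrix_vector_mult_def rscale_def column_def if_distrib[of "\<lambda>y. _ * y"] sum.If_cases cong: if_cong)
  have sumB: "(\<Sum>b\<in>?B. rscale b (c b)) = x *v (\<chi> j. if j \<in> J then c (column j x) else 0)" for c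
    unfolding sum.reindex[OF inj] by (simp add: lin[symmetric])
  have Ax: "(x ** qadj x) ** x = x"
    using x by (simp add: matrix_mul_assoc[symmetric])
  have "{\<Sum>b\<in>?B. rscale b (c b) | c. True} = range (\<lambda>v. (x ** qadj x) *v v)"
  proof (intro equalityI subsetI)
    fix v assume "v \<in> {\<Sum>b\<in>?B. rscale b (c b) | c. True}"
    then obtain w where "v = x *v w" using sumB by auto
    then have "v = (x ** qadj x) *v (x *v w)" by (simp add: matrix_vector_mul_assoc Ax)
    then show "v \<in> range (\<lambda>v. (x ** qadj x) *v v)" by blast
  next
    fix v assume "v \<in> range (\<lambda>v. (x ** qadj x) *v v)"
    then obtain u where "v = x *v (qadj x *v u)" by (auto simp: matrix_vector_mul_assoc)
    then have v: "v = x *v (qid J *v (qadj x *v u))"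
      by (metis x(1) matrix_vector_mul_assoc)
    define w where "w = qid J *v (qadj x *v u)"
    have "w \<in> qvecs J"
      unfolding w_def mem_qvecs_iff by (simp add: matrix_vector_mul_assoc matrix_mul_assoc qid_mult_qid)
    then have "w = (\<chi> j. if j \<in> J then w $ j else 0)" by (auto simp: qvecs_def vec_eq_iff)
    also have "\<dots> = (\<chi> j. if j \<in> J then w $ (inv_into J (\<lambda>j. column j x) (column j x)) else 0)"
      using inv_into_f_f[OF inj] by (simp add: vec_eq_iff)
    finally have "v = (\<Sum>b\<in>?B. rscale b (w $ inv_into J (\<lambda>j. column j x) b))"
      unfolding sumB using v w_def by simp
    then show "v \<in> {\<Sum>b\<in>?B. rscale b (c b) | c. True}"
      by (intro CollectI exI[of _ "\<lambda>b. w $ inv_into J (\<lambda>j. column j x) b"]) simp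
  qed
  moreover have "c b = 0" if s: "(\<Sum>b\<in>?B. rscale b (c b)) = 0" and b: "b \<in> ?B" for c b
  proof -
    define w where "w = (\<chi> j. if j \<in> J then c (column j x) else 0)"
    have "w \<in> qvecs J" by (simp add: qvecs_def w_def)
    then have "w = qid J *v w" by (simp add: mem_qvecs_iff)
    also have "\<dots> = qadj x *v (x *v w)" by (simp add: matrix_vector_mul_assoc x(2))
    also have "x *v w = 0" using s sumB unfolding w_def by simp
    finally have w0: "w = 0" by (simp add: matrix_vector_mult_def vec_eq_iff)
    obtain j where "j \<in> J" "b = column j x" using b by blast
    then have "c b = w $ j" by (simp add: w_def)
    then show ?thesis using w0 by simp
  qed
  ultimately show "right_basis ?B (range (\<lambda>v. (x ** qadj x) *v v))"
    unfolding right_basis_def by simp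
qed

text \<open>
  The rank of a subspace is counted by basis vectors in the Grassmannian and by the trace of the
  projection here; both are a quarter of the real dimension.
\<close>

theorem Gr_manifold_eq_projections: "Gr_manifold I l = projections (qid I) l"
proof (intro equalityI subsetI)
  fix A :: "quat ^ 'a ^ 'a" assume "A \<in> Gr_manifold I l"
  then obtain V B where V: "right_subspace V" "V \<subseteq> qvecs I" "right_basis B V" "card B = l" "A = orth_proj V"
    unfolding Gr_manifold_def Gr_def by blast
  have A: "hproj A" "range (\<lambda>v. A *v v) = V" using orth_proj_props[OF V(1)] V(5) by auto
  have "(qid I ** A) *v v = A *v v" for v
    using A(2) V(2) mem_qvecs_iff[of "A *v v" I] by (metis matrix_vector_mul_assoc rangeI subsetD)
  then have "qid I ** A = A" by (simp add: matrix_eq)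
  moreover have "rtr A = real l"
    using dim_range_matrix[OF A(1)] right_basis_dim[OF V(3)] V(4) A(2) by simp
  ultimately show "A \<in> projections (qid I) l" using A(1) by (simp add: projections_def)
next
  fix A :: "quat ^ 'a ^ 'a" assume "A \<in> projections (qid I) l"
  then have A: "hproj A" "qid I ** A = A" "rtr A = real l" by (auto simp: projections_def)
  obtain J and x :: "quat ^ 'a ^ 'a"
    where x: "x ** qid J = x" "qadj x ** x = qid J" "x ** qadj x = A" "rtr A = card J"
    using hproj_partial_isometry[OF A(1) rtr_hproj_le_CARD[OF A(1)]] by blast
  define V where "V = range (\<lambda>v. A *v v)"
  have V: "right_subspace V" unfolding V_def by (rule right_subspace_range)
  have "V \<subseteq> qvecs I"
    unfolding V_def using A(2) by (auto simp: mem_qvecs_iff matrix_vector_mul_assoc)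
  moreover have "right_basis ((\<lambda>j. column j x) ` J) V" "card ((\<lambda>j. column j x) ` J) = l"
    using right_basis_columns[OF x(1,2)] x(3,4) A(3) by (simp_all add: V_def)
  ultimately have "V \<in> Gr I l" unfolding Gr_def using V by blast
  moreover have "orth_proj V = A" using orth_proj_eqI[OF V A(1)] by (simp add: V_def)
  ultimately show "A \<in> Gr_manifold I l" unfolding Gr_manifold_def by blast
qed

section \<open>Frames, projections and the group Sp\<close>

lemmas vderiv_matrix_mult = bounded_bilinear.has_vector_derivative[OF bounded_bilinear_matrix_mult]
lemmas vderiv_qadj = bounded_linear.has_vector_derivative[OF bounded_linear_qadj]

lemma curve_constant_derivative:
  fixes f :: "real \<Rightarrow> 'a::euclidean_space"
  assumes "(f has_vector_derivative w) (at t)" "open D" "t \<in> D" "\<And>s. s \<in> D \<Longrightarrow> f s = c"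
  shows "w = 0"
proof -
  have "((\<lambda>s. c) has_vector_derivative 0) (at t)" by simp
  then have "(f has_vector_derivative 0) (at t)"
    by (rule has_vector_derivative_transform_within_open[OF _ assms(2,3)]) (simp add: assms(4))
  then show ?thesis using assms(1) vector_derivative_unique_at by blast
qed

lemma tangent_spaceE:
  assumes "v \<in> tangent_space S x"
  obtains D \<gamma> where "open D" "0 \<in> D" "smooth_on D \<gamma>" "\<And>t. t \<in> D \<Longrightarrow> \<gamma> t \<in> S" "\<gamma> 0 = x"
    "(\<gamma> has_vector_derivative v) (at (0 :: real))"
  using assms unfolding tangent_space_def by (auto simp: image_subset_iff)

lemma tangent_space_retractI:
  assumes "smooth_retraction W S r" "x \<in> S" "((\<lambda>t. r (x + t *\<^sub>R v)) has_vector_derivative v) (at 0)"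
  shows "v \<in> tangent_space S x"
proof -
  have "((\<lambda>t. r (x + t *\<^sub>R v)) has_vector_derivative frechet_derivative r (at x) v) (at 0)"
    by (rule has_derivative_imp_curve)
      (use smooth_retraction_derivative_idem(1)[OF assms(1,2)] in \<open>auto intro!: derivative_eq_intros\<close>)
  then show ?thesis
    using assms(3) vector_derivative_unique_at tangent_space_retract(1)[OF assms(1,2)] by blast
qed

text \<open>
  Every curve to which the inverse square root is applied below is stationary at the identity.
\<close>

lemma isqrt_curve:
  assumes "(N has_vector_derivative 0) (at t)" "N t = mat 1"
  shows "((\<lambda>t. isqrt (N t)) has_vector_derivative 0) (at t)"
proof -
  have d: "(isqrt has_derivative frechet_derivative isqrt (at (mat 1))) (at (N t))"
    using smooth_on_has_derivative[OF open_isqrt_dom smooth_on_isqrt mat_1_isqrt_dom] assms(2) by simp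
  then show ?thesis
    using has_derivative_imp_curve[where f = isqrt, OF d assms(1)] linear_0[OF has_derivative_linear[OF d]] by simp
qed

text \<open>
  The polar decomposition of \<open>y\<close>, on the subspace given by \<open>e\<close>.  The summand \<open>1 - e\<close> only makes the Gram
  matrix invertible; since \<open>e\<close> commutes with \<open>N\<close>, the two blocks do not interact.
\<close>

lemma orthonormalise:
  fixes y e N :: "quat ^ 'n ^ 'n"
  assumes e: "hproj e" and ye: "y ** e = y"
    and N: "N = qadj y ** y + (mat 1 - e)" "N \<in> isqrt_dom"
  shows "e ** isqrt N = isqrt N ** e" "(y ** isqrt N) ** e = y ** isqrt N"
    and "qadj (y ** isqrt N) ** (y ** isqrt N) = e"
proof -
  define g where "g = isqrt N"
  have ey: "e ** qadj y = qadj y" using ye e by (metis hprojD(1) qadj_mult)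
  have Ne: "N ** e = qadj y ** y" "e ** N = qadj y ** y"
    using e by (simp_all add: N(1) mult_simps ye hprojD mult_eq_assoc[OF ey])
  have hN: "qadj N = N" using e by (simp add: N(1) qadj_simps hprojD)
  have hg: "qadj g = g" unfolding g_def by (rule qadj_isqrt[OF N(2) hN])
  have eg: "e ** g = g ** e" unfolding g_def by (rule isqrt_commute[OF N(2)]) (simp add: Ne)
  show "e ** isqrt N = isqrt N ** e" using eg by (simp add: g_def)
  show "(y ** isqrt N) ** e = y ** isqrt N"
    using eg ye unfolding g_def by (metis matrix_mul_assoc)
  have "qadj (y ** g) ** (y ** g) = g ** ((N ** e) ** g)"
    by (simp add: qadj_simps hg Ne matrix_mul_assoc)
  also have "\<dots> = (g ** (N ** g)) ** e" by (simp add: matrix_mul_assoc[symmetric] eg)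
  also have "\<dots> = e" by (simp add: g_def isqrt_mult[OF N(2)])
  finally show "qadj (y ** isqrt N) ** (y ** isqrt N) = e" by (simp add: g_def)
qed

text \<open>
  The isometries from the range of \<open>e\<close> into the range of \<open>a\<close>.  For \<open>a = 1\<close> these form the Stiefel manifold and
  for \<open>a = e\<close> the symplectic group, so both are treated at once.
\<close>

definition frames :: "quat ^ 'n ^ 'n \<Rightarrow> quat ^ 'n ^ 'n \<Rightarrow> (quat ^ 'n ^ 'n) set"
  where "frames a e = {x. a ** x = x \<and> x ** e = x \<and> qadj x ** x = e}"

definition gram :: "quat ^ 'n ^ 'n \<Rightarrow> quat ^ 'n ^ 'n \<Rightarrow> quat ^ 'n ^ 'n"
  where "gram e y = qadj y ** y + (mat 1 - e)"

lemma gram_frames: "x \<in> frames a e \<Longrightarrow> gram e x = mat 1"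
  by (simp add: gram_def frames_def)

lemma smooth_on_gram [smooth_intros]: "smooth_on S f \<Longrightarrow> smooth_on S (\<lambda>x. gram e (f x))"
  unfolding gram_def by (intro smooth_intros)

lemma open_smooth_vimage:
  "smooth_on UNIV f \<Longrightarrow> open V \<Longrightarrow> open {x. f x \<in> V}"
  using open_vimage[of V f] smooth_on_imp_continuous_on[of UNIV f] by (simp add: vimage_def)

lemma frames_retraction:
  fixes a e :: "quat ^ 'n ^ 'n"
  assumes "hproj a" "hproj e"
  shows "smooth_retraction {x. gram e (a ** (x ** e)) \<in> isqrt_dom} (frames a e)
    (\<lambda>x. (a ** (x ** e)) ** isqrt (gram e (a ** (x ** e))))"
    (is "smooth_retraction ?W _ ?r")
proof -
  have "open ?W"
    by (intro open_smooth_vimage open_isqrt_dom smooth_intros)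
  moreover have "smooth_on ?W ?r"
    by (intro smooth_on_matrix_mult smooth_on_compose[OF _ smooth_on_isqrt] smooth_intros) auto
  moreover have fix_frame: "a ** (x ** e) = x" if "x \<in> frames a e" for x
    using that by (simp add: frames_def)
  then have "frames a e \<subseteq> ?W" "\<forall>x\<in>frames a e. ?r x = x"
    by (auto simp: gram_frames mat_1_isqrt_dom isqrt_mat_1)
  moreover have "?r x \<in> frames a e" if "x \<in> ?W" for x
  proof -
    have "(a ** (x ** e)) ** e = a ** (x ** e)"
      using assms(2) by (simp add: matrix_mul_assoc[symmetric] hprojD)
    moreover have "a ** ?r x = ?r x"
      using assms(1) by (simp add: matrix_mul_assoc[symmetric] hprojD)
    ultimately show ?thesis
      using orthonormalise(2,3)[OF assms(2) _ gram_def[of e]] that by (simp add: frames_def)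
  qed
  ultimately show ?thesis unfolding smooth_retraction_def by blast
qed

text \<open>
  The linearisation of \<open>x\<^sup>* x = e\<close>.  It says that the Gram matrix of \<open>x + t v\<close> is stationary at \<open>t = 0\<close>, so the retraction
  changes \<open>x + t v\<close> only to second order.
\<close>

lemma tangent_space_frames:
  fixes a e :: "quat ^ 'n ^ 'n"
  assumes a: "hproj a" and e: "hproj e" and x: "x \<in> frames a e"
  shows "tangent_space (frames a e) x = {v. a ** v = v \<and> v ** e = v \<and> qadj x ** v + qadj v ** x = 0}"
proof (intro equalityI subsetI)
  fix v assume "v \<in> tangent_space (frames a e) x"
  then obtain D \<gamma> where \<gamma>: "open D" "0 \<in> D" "\<And>t. t \<in> D \<Longrightarrow> \<gamma> t \<in> frames a e" "\<gamma> 0 = x"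
    "(\<gamma> has_vector_derivative v) (at (0 :: real))" by (rule tangent_spaceE) blast
  have 1: "((\<lambda>t. a ** \<gamma> t - \<gamma> t) has_vector_derivative (a ** v + 0 ** \<gamma> 0) - v) (at 0)"
    "((\<lambda>t. \<gamma> t ** e - \<gamma> t) has_vector_derivative (\<gamma> 0 ** 0 + v ** e) - v) (at 0)"
    "((\<lambda>t. qadj (\<gamma> t) ** \<gamma> t) has_vector_derivative (qadj (\<gamma> 0) ** v + qadj v ** \<gamma> 0)) (at 0)"
    by (intro has_vector_derivative_diff vderiv_matrix_mult vderiv_qadj has_vector_derivative_const \<gamma>(5))+
  have "(a ** v + 0 ** \<gamma> 0) - v = 0"
    by (rule curve_constant_derivative[OF 1(1) \<gamma>(1,2), of 0]) (use \<gamma>(3) in \<open>simp add: frames_def\<close>)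
  moreover have "(\<gamma> 0 ** 0 + v ** e) - v = 0"
    by (rule curve_constant_derivative[OF 1(2) \<gamma>(1,2), of 0]) (use \<gamma>(3) in \<open>simp add: frames_def\<close>)
  moreover have "qadj (\<gamma> 0) ** v + qadj v ** \<gamma> 0 = 0"
    by (rule curve_constant_derivative[OF 1(3) \<gamma>(1,2), of e]) (use \<gamma>(3) in \<open>simp add: frames_def\<close>)
  ultimately show "v \<in> {v. a ** v = v \<and> v ** e = v \<and> qadj x ** v + qadj v ** x = 0}"
    using \<gamma>(4) by simp
next
  fix v assume "v \<in> {v. a ** v = v \<and> v ** e = v \<and> qadj x ** v + qadj v ** x = 0}"
  then have v: "a ** v = v" "v ** e = v" "qadj x ** v + qadj v ** x = 0" by auto
  define Y where "Y = (\<lambda>t :: real. x + t *\<^sub>R v)"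
  have Y: "a ** (Y t ** e) = Y t" for t
    using v x by (simp add: Y_def mult_simps frames_def)
  have dY: "(Y has_vector_derivative v) (at 0)"
    unfolding Y_def by (auto intro!: derivative_eq_intros)
  have Y0: "Y 0 = x" by (simp add: Y_def)
  have "((\<lambda>t. gram e (Y t)) has_vector_derivative (qadj (Y 0) ** v + qadj v ** Y 0) + 0) (at 0)"
    unfolding gram_def
    by (intro has_vector_derivative_add vderiv_matrix_mult vderiv_qadj dY has_vector_derivative_const)
  then have "((\<lambda>t. gram e (Y t)) has_vector_derivative 0) (at 0)" using v(3) by (simp add: Y0)
  then have "((\<lambda>t. isqrt (gram e (Y t))) has_vector_derivative 0) (at 0)"
    by (rule isqrt_curve) (simp add: Y0 gram_frames[OF x])
  then have "((\<lambda>t. Y t ** isqrt (gram e (Y t))) has_vector_derivative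
      Y 0 ** 0 + v ** isqrt (gram e (Y 0))) (at 0)"
    by (rule vderiv_matrix_mult[OF dY])
  then have "((\<lambda>t. Y t ** isqrt (gram e (Y t))) has_vector_derivative v) (at 0)"
    by (simp add: Y0 gram_frames[OF x] isqrt_mat_1)
  then show "v \<in> tangent_space (frames a e) x"
    by (intro tangent_space_retractI[OF frames_retraction[OF a e] x]) (simp add: Y[unfolded Y_def] Y_def)
qed

definition skew :: "quat ^ 'n ^ 'n \<Rightarrow> (quat ^ 'n ^ 'n) set"
  where "skew e = {b. e ** b = b \<and> b ** e = b \<and> qadj b = - b}"

lemma subspace_skew: "subspace (skew e)"
  unfolding subspace_def skew_def by (simp add: mult_simps qadj_simps)

text \<open>
  An isometry of a finite-dimensional space into itself is surjective.
\<close>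

lemma frames_self_adjoint:
  assumes e: "hproj e" and x: "x \<in> frames e e"
  shows "x ** qadj x = e"
proof -
  have x': "e ** x = x" "x ** e = x" "qadj x ** x = e" using x by (auto simp: frames_def)
  have ex: "qadj x ** e = qadj x" "e ** qadj x = qadj x" using x' e by (metis hprojD(1) qadj_mult)+
  \<comment> \<open>extending \<open>x\<close> by the identity on the complement of \<open>e\<close> turns it into a unitary matrix\<close>
  have "(qadj x + (mat 1 - e)) ** (x + (mat 1 - e)) = mat 1"
    using e by (simp add: mult_simps x' ex hprojD)
  then have "(x + (mat 1 - e)) ** (qadj x + (mat 1 - e)) = mat 1"
    by (rule matrix_left_inverse_imp_right)
  then show ?thesis using e by (simp add: mult_simps x' ex hprojD)
qed

text \<open>
  All tangent spaces are left translates of the space of skew matrices.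
\<close>

lemma submanifold_frames_self:
  assumes e: "hproj e"
  shows "submanifold (dim (skew e)) (frames e e)"
proof (rule submanifold_retract[OF frames_retraction[OF e e]])
  fix x assume x: "x \<in> frames e e"
  have x': "e ** x = x" "x ** e = x" "qadj x ** x = e" using x by (auto simp: frames_def)
  note xx = frames_self_adjoint[OF e x]
  have "tangent_space (frames e e) x = (\<lambda>b. x ** b) ` skew e"
  proof (intro equalityI subsetI)
    fix v assume "v \<in> tangent_space (frames e e) x"
    then have v: "e ** v = v" "v ** e = v" "qadj x ** v + qadj v ** x = 0"
      using tangent_space_frames[OF e e x] by auto
    have "v = x ** (qadj x ** v)" by (simp add: matrix_mul_assoc xx v(1))
    moreover have "qadj x ** v \<in> skew e"
    proof -
      have "e ** qadj x = qadj x" using x' e by (metis hprojD(1) qadj_mult)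
      then show ?thesis
        using v by (simp add: skew_def matrix_mul_assoc qadj_simps eq_neg_iff_add_eq_0 add.commute)
          (simp add: matrix_mul_assoc[symmetric])
    qed
    ultimately show "v \<in> (\<lambda>b. x ** b) ` skew e" by blast
  next
    fix v assume "v \<in> (\<lambda>b. x ** b) ` skew e"
    then obtain b where b: "v = x ** b" "e ** b = b" "b ** e = b" "qadj b = - b" by (auto simp: skew_def)
    then show "v \<in> tangent_space (frames e e) x"
      unfolding tangent_space_frames[OF e e x]
      by (simp add: mult_simps qadj_simps x' mult_eq_assoc[OF x'(1)] mult_eq_assoc[OF x'(3)])
  qed
  moreover have "dim ((\<lambda>b. x ** b) ` skew e) = dim (skew e)"
  proof (rule dim_image_eq)
    show "linear (\<lambda>b. x ** b)" by (rule linearI) (simp_all add: mult_simps)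
    have "inj_on (\<lambda>b. x ** b) (skew e)"
    proof (rule inj_onI)
      fix b c assume "b \<in> skew e" "c \<in> skew e" "x ** b = x ** c"
      then have "e ** b = e ** c" "e ** b = b" "e ** c = c"
        using x'(3) by (auto simp: skew_def) (metis matrix_mul_assoc)
      then show "b = c" by simp
    qed
    then show "inj_on (\<lambda>b. x ** b) (span (skew e))"
      using subspace_skew span_eq_iff by metis
  qed
  ultimately show "dim (tangent_space (frames e e) x) = dim (skew e)" by simp
qed

text \<open>
  For hermitian \<open>M\<close> close to a projection, \<open>Z = 2 M - 1\<close> is close to an involution, and \<open>Z (Z\<^sup>2)\<^bsup>-1/2\<^esup>\<close> is the
  sign of \<open>Z\<close>.  Symmetrising \<open>M\<close> and cutting down by \<open>i\<close> makes this a retraction from all matrices.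
\<close>

definition round_proj :: "quat ^ 'n ^ 'n \<Rightarrow> quat ^ 'n ^ 'n \<Rightarrow> quat ^ 'n ^ 'n"
  where "round_proj i M = (let Z = i ** ((M + qadj M) ** i) - mat 1
    in (1 / 2) *\<^sub>R (i + i ** (Z ** isqrt (Z ** Z))))"

definition round_dom :: "quat ^ 'n ^ 'n \<Rightarrow> (quat ^ 'n ^ 'n) set"
  where "round_dom i = {M. (i ** ((M + qadj M) ** i) - mat 1) ** (i ** ((M + qadj M) ** i) - mat 1) \<in> isqrt_dom}"

lemma open_round_dom: "open (round_dom i)"
  unfolding round_dom_def by (intro open_smooth_vimage open_isqrt_dom smooth_intros)

lemma smooth_on_round_proj: "smooth_on (round_dom i) (round_proj i)"
  unfolding round_proj_def Let_def
  by (intro smooth_intros smooth_on_compose[OF _ smooth_on_isqrt]) (auto simp: round_dom_def)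

lemma hproj_round_proj:
  assumes i: "hproj i" and M: "M \<in> round_dom i"
  shows "hproj (round_proj i M)" "i ** round_proj i M = round_proj i M"
proof -
  define Z where "Z = i ** ((M + qadj M) ** i) - mat 1"
  define g where "g = isqrt (Z ** Z)"
  define J where "J = Z ** g"
  have dom: "Z ** Z \<in> isqrt_dom" using M by (simp add: round_dom_def Z_def)
  have hZ: "qadj Z = Z"
    using i by (simp add: Z_def qadj_simps mult_simps hprojD add.commute)
  have iZ: "i ** Z = Z ** i" using i by (simp add: Z_def mult_simps hprojD)
  have Zg: "Z ** g = g ** Z" unfolding g_def by (rule isqrt_commute[OF dom]) (simp add: matrix_mul_assoc)
  have "i ** (Z ** Z) = (Z ** Z) ** i" using iZ by (metis matrix_mul_assoc)
  then have ig: "i ** g = g ** i" unfolding g_def by (rule isqrt_commute[OF dom])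
  have hg: "qadj g = g" unfolding g_def by (rule qadj_isqrt[OF dom]) (simp add: qadj_mult hZ)
  have hJ: "qadj J = J" by (simp add: J_def qadj_mult hg hZ Zg)
  have "J ** J = (g ** Z) ** (Z ** g)" by (simp add: J_def Zg)
  also have "\<dots> = g ** ((Z ** Z) ** g)" by (simp add: matrix_mul_assoc)
  also have "\<dots> = mat 1" unfolding g_def by (rule isqrt_mult[OF dom])
  finally have JJ: "J ** J = mat 1" .
  have iJ: "J ** i = i ** J" unfolding J_def using iZ ig by (metis matrix_mul_assoc)
  have R: "round_proj i M = (1 / 2) *\<^sub>R (i + i ** J)"
    by (simp add: round_proj_def Let_def Z_def J_def g_def)
  define U where "U = i ** J"
  have "U ** U = i ** (J ** i) ** J" by (simp add: U_def matrix_mul_assoc)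
  also have "\<dots> = i ** i ** (J ** J)" by (simp add: iJ matrix_mul_assoc)
  finally have UU: "U ** U = i" using i by (simp add: JJ hprojD)
  have iU: "i ** U = U" "U ** i = U" "qadj U = U"
    using i by (simp_all add: U_def matrix_mul_assoc[symmetric] iJ hprojD qadj_mult hJ)
  have "(i + U) ** (i + U) = 2 *\<^sub>R (i + U)"
    using i by (simp add: mult_simps UU iU hprojD scaleR_2 add.commute add.left_commute)
  then show "hproj (round_proj i M)"
    using i unfolding R U_def[symmetric] hproj_def
    by (simp add: qadj_simps iU bounded_bilinear.scaleR_left[OF bounded_bilinear_matrix_mult]
        bounded_bilinear.scaleR_right[OF bounded_bilinear_matrix_mult])
  show "i ** round_proj i M = round_proj i M"
    using i by (simp add: R mult_simps hprojD)
qed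

lemma round_proj_fix:
  assumes i: "hproj i" and A: "hproj A" "i ** A = A"
  shows "A \<in> round_dom i" "round_proj i A = A"
proof -
  have Ai: "A ** i = A" using hproj_diff(2)[OF i A] .
  have Z: "i ** ((A + qadj A) ** i) - mat 1 = 2 *\<^sub>R A - mat 1"
    using A by (simp add: hprojD mult_simps Ai scaleR_2)
  have ZZ: "(2 *\<^sub>R A - mat 1) ** (2 *\<^sub>R A - mat 1) = mat 1"
    using A by (simp add: hprojD mult_simps scaleR_2)
  show "A \<in> round_dom i" by (simp add: round_dom_def Z ZZ mat_1_isqrt_dom)
  show "round_proj i A = A"
    unfolding round_proj_def Let_def Z ZZ isqrt_mat_1 using A by (simp add: mult_simps)
qed

lemma bounded_linear_rtr: "bounded_linear (rtr :: quat ^ 'n ^ 'n \<Rightarrow> real)"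
proof -
  have eq: "rtr = (\<lambda>A :: quat ^ 'n ^ 'n. mat 1 \<bullet> A)" by (simp add: fun_eq_iff inner_eq_rtr)
  show ?thesis unfolding eq by (rule bounded_linear_inner_right)
qed

text \<open>
  The condition \<open>A v + v A = v\<close> says that \<open>Z = 2 A - 1\<close> anticommutes with \<open>v\<close>, so that \<open>Z\<^sup>2\<close> is stationary.
\<close>

lemma round_proj_curve:
  assumes i: "hproj i" and A: "hproj A" "i ** A = A"
    and v: "qadj v = v" "i ** v = v" "A ** v + v ** A = v"
    and \<gamma>: "(\<gamma> has_vector_derivative v) (at 0)" "\<gamma> 0 = A"
  shows "((\<lambda>t. round_proj i (\<gamma> t)) has_vector_derivative v) (at (0 :: real))"
proof -
  have Ai: "A ** i = A" using hproj_diff(2)[OF i A] .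
  have vi: "v ** i = v" using v(1,2) i by (metis hprojD(1) qadj_mult)
  define Z where "Z = (\<lambda>t. i ** ((\<gamma> t + qadj (\<gamma> t)) ** i) - mat 1)"
  have "(Z has_vector_derivative (i ** ((\<gamma> 0 + qadj (\<gamma> 0)) ** 0 + (v + qadj v) ** i) + 0 ** ((\<gamma> 0 + qadj (\<gamma> 0)) ** i)) - 0) (at 0)"
    unfolding Z_def
    by (intro has_vector_derivative_diff has_vector_derivative_add vderiv_matrix_mult vderiv_qadj \<gamma>(1) has_vector_derivative_const)
  then have dZ: "(Z has_vector_derivative 2 *\<^sub>R v) (at 0)"
    by (simp add: v vi mult_simps scaleR_2)
  have Z0: "Z 0 = 2 *\<^sub>R A - mat 1"
    using A by (simp add: Z_def \<gamma>(2) hprojD mult_simps Ai scaleR_2)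
  have ZZ0: "Z 0 ** Z 0 = mat 1"
    using A by (simp add: Z0 hprojD mult_simps scaleR_2)
  have "Z 0 ** (2 *\<^sub>R v) + (2 *\<^sub>R v) ** Z 0 = 2 *\<^sub>R ((A ** v + v ** A - v) + (A ** v + v ** A - v))"
    unfolding Z0 scaleR_2 by (simp add: mult_simps algebra_simps)
  then have "((\<lambda>t. Z t ** Z t) has_vector_derivative 0) (at 0)"
    using vderiv_matrix_mult[OF dZ dZ] v(3) by simp
  then have "((\<lambda>t. isqrt (Z t ** Z t)) has_vector_derivative 0) (at 0)"
    by (rule isqrt_curve) (rule ZZ0)
  then have "((\<lambda>t. i + i ** (Z t ** isqrt (Z t ** Z t))) has_vector_derivative
      0 + (i ** (Z 0 ** 0 + (2 *\<^sub>R v) ** isqrt (Z 0 ** Z 0)) + 0 ** (Z 0 ** isqrt (Z 0 ** Z 0)))) (at 0)"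
    by (intro has_vector_derivative_add vderiv_matrix_mult dZ has_vector_derivative_const)
  then have "((\<lambda>t. i + i ** (Z t ** isqrt (Z t ** Z t))) has_vector_derivative 2 *\<^sub>R v) (at 0)"
    by (simp add: ZZ0 isqrt_mat_1 mult_simps v)
  then have "((\<lambda>t. (1 / 2) *\<^sub>R (i + i ** (Z t ** isqrt (Z t ** Z t)))) has_vector_derivative (1 / 2) *\<^sub>R (2 *\<^sub>R v)) (at 0)"
    by (rule bounded_linear.has_vector_derivative[OF bounded_linear_scaleR_right])
  then show ?thesis by (simp add: round_proj_def Let_def Z_def)
qed

lemma projections_retraction:
  assumes i: "hproj i"
  obtains W where "smooth_retraction W (projections i l) (round_proj i)"
proof -
  \<comment> \<open>ranks are integers, so a trace at distance less than 1 from \<open>l\<close> is equal to \<open>l\<close>\<close>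
  define W where "W = round_dom i \<inter> (\<lambda>M. rtr (round_proj i M)) -` {real l - 1 <..< real l + 1}"
  have sm: "smooth_on (round_dom i) (\<lambda>M. rtr (round_proj i M))"
    by (rule smooth_on_linear_compose[OF bounded_linear_rtr smooth_on_round_proj])
  have "open W" unfolding W_def
    by (rule continuous_open_preimage[OF smooth_on_imp_continuous_on[OF sm] open_round_dom]) simp
  moreover have "smooth_on W (round_proj i)"
    by (rule smooth_on_subset[OF smooth_on_round_proj]) (auto simp: W_def)
  moreover have "projections i l \<subseteq> W" "\<forall>A\<in>projections i l. round_proj i A = A"
    using round_proj_fix[OF i] by (auto simp: projections_def W_def)
  moreover have "round_proj i M \<in> projections i l" if "M \<in> W" for M
  proof -
    have M: "M \<in> round_dom i" "\<bar>rtr (round_proj i M) - real l\<bar> < 1" using that by (auto simp: W_def)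
    show ?thesis
      using hproj_round_proj[OF i M(1)] rtr_hproj_eqI[OF _ M(2)] by (simp add: projections_def)
  qed
  ultimately have "smooth_retraction W (projections i l) (round_proj i)"
    unfolding smooth_retraction_def by blast
  then show thesis by (rule that)
qed

lemma tangent_space_projections:
  assumes i: "hproj i" and A: "A \<in> projections i l"
  shows "tangent_space (projections i l) A = {v. qadj v = v \<and> i ** v = v \<and> A ** v + v ** A = v}"
proof (intro equalityI subsetI)
  fix v assume "v \<in> tangent_space (projections i l) A"
  then obtain D \<gamma> where \<gamma>: "open D" "0 \<in> D" "\<And>t. t \<in> D \<Longrightarrow> \<gamma> t \<in> projections i l" "\<gamma> 0 = A"
    "(\<gamma> has_vector_derivative v) (at (0 :: real))" by (rule tangent_spaceE) blast
  have 1: "((\<lambda>t. i ** \<gamma> t - \<gamma> t) has_vector_derivative (i ** v + 0 ** \<gamma> 0) - v) (at 0)"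
    "((\<lambda>t. qadj (\<gamma> t) - \<gamma> t) has_vector_derivative qadj v - v) (at 0)"
    "((\<lambda>t. \<gamma> t ** \<gamma> t - \<gamma> t) has_vector_derivative (\<gamma> 0 ** v + v ** \<gamma> 0) - v) (at 0)"
    by (intro has_vector_derivative_diff vderiv_matrix_mult vderiv_qadj has_vector_derivative_const \<gamma>(5))+
  have "(i ** v + 0 ** \<gamma> 0) - v = 0"
    by (rule curve_constant_derivative[OF 1(1) \<gamma>(1,2), of 0]) (use \<gamma>(3) in \<open>simp add: projections_def\<close>)
  moreover have "qadj v - v = 0"
    by (rule curve_constant_derivative[OF 1(2) \<gamma>(1,2), of 0]) (use \<gamma>(3) in \<open>simp add: projections_def hproj_def\<close>)
  moreover have "(\<gamma> 0 ** v + v ** \<gamma> 0) - v = 0"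
    by (rule curve_constant_derivative[OF 1(3) \<gamma>(1,2), of 0]) (use \<gamma>(3) in \<open>simp add: projections_def hproj_def\<close>)
  ultimately show "v \<in> {v. qadj v = v \<and> i ** v = v \<and> A ** v + v ** A = v}"
    using \<gamma>(4) by simp
next
  fix v assume "v \<in> {v. qadj v = v \<and> i ** v = v \<and> A ** v + v ** A = v}"
  then have v: "qadj v = v" "i ** v = v" "A ** v + v ** A = v" by auto
  obtain W where W: "smooth_retraction W (projections i l) (round_proj i)"
    using projections_retraction[OF i] .
  have A': "hproj A" "i ** A = A" using A by (auto simp: projections_def)
  show "v \<in> tangent_space (projections i l) A"
    by (rule tangent_space_retractI[OF W A], rule round_proj_curve[OF i A' v])
      (auto intro!: derivative_eq_intros)
qed

text \<open>
  A tangent vector at \<open>A\<close> is hermitian and off-diagonal with respect to \<open>A\<close>, hence determined by its block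
  \<open>(i - A) v A\<close>.
\<close>

lemma dim_tangent_space_projections:
  assumes i: "hproj i" and A: "A \<in> projections i l"
  shows "real (dim (tangent_space (projections i l) A)) = 4 * (rtr i - real l) * real l"
proof -
  have A': "hproj A" "i ** A = A" "rtr A = real l" using A by (auto simp: projections_def)
  have Ai: "A ** i = A" using hproj_diff(2)[OF i A'(1,2)] .
  define B where "B = {w. (i - A) ** (w ** A) = w}"
  have B: "A ** w = 0 \<and> w ** A = w \<and> i ** w = w" if "w \<in> B" for w
  proof -
    have w: "w = (i - A) ** (w ** A)" using that by (simp add: B_def)
    have "A ** (i - A) = 0" "i ** (i - A) = i - A" "A ** A = A"
      using i A' by (simp_all add: mult_simps hprojD Ai)
    then show ?thesis
      using w by (metis matrix_mul_assoc times0_left)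
  qed
  have "tangent_space (projections i l) A = (\<lambda>w. w + qadj w) ` B"
    unfolding tangent_space_projections[OF i A]
  proof (intro equalityI subsetI)
    fix v assume "v \<in> {v. qadj v = v \<and> i ** v = v \<and> A ** v + v ** A = v}"
    then have v: "qadj v = v" "i ** v = v" "A ** v + v ** A = v" by auto
    have "A ** (v ** A) + A ** (v ** A) = A ** (v ** A)"
      using arg_cong[OF v(3), of "\<lambda>u. A ** (u ** A)"] A'(1) by (simp add: mult_simps hprojD)
    then have AvA: "A ** (v ** A) = 0" by simp
    have "v = v ** A + qadj (v ** A)" using v A'(1) by (simp add: qadj_mult hprojD add.commute)
    moreover have "v ** A \<in> B"
      using A'(1) v(2) by (simp add: B_def mult_simps hprojD AvA mult_eq_assoc[OF v(2)])
    ultimately show "v \<in> (\<lambda>w. w + qadj w) ` B" by blast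
  next
    fix v assume "v \<in> (\<lambda>w. w + qadj w) ` B"
    then obtain w where w: "v = w + qadj w" "A ** w = 0" "w ** A = w" "i ** w = w" using B by blast
    have w': "qadj w ** A = 0" "A ** qadj w = qadj w"
      using w A'(1) by (metis hprojD(1) qadj_mult qadj_simps(6))+
    then have "i ** qadj w = qadj w" by (metis A'(2) matrix_mul_assoc)
    then show "v \<in> {v. qadj v = v \<and> i ** v = v \<and> A ** v + v ** A = v}"
      using w w' by (simp add: qadj_simps mult_simps add.commute)
  qed
  moreover have "dim ((\<lambda>w. w + qadj w) ` B) = dim B"
  proof (rule dim_image_eq)
    show "linear (\<lambda>w :: quat ^ 'a ^ 'a. w + qadj w)" by (rule linearI) (simp_all add: qadj_simps scaleR_add_right)
    have sub: "subspace B"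
      unfolding B_def subspace_def by (simp add: mult_simps) (simp add: algebra_simps)
    have "inj_on (\<lambda>w. w + qadj w) B"
    proof (rule inj_onI)
      fix w u assume wu: "w \<in> B" "u \<in> B" "w + qadj w = u + qadj u"
      have "(w + qadj w) ** A = w" if "w \<in> B" for w
      proof -
        have "qadj w ** A = 0" using B[OF that] A'(1) by (metis hprojD(1) qadj_mult qadj_simps(6))
        then show ?thesis using B[OF that] by (simp add: mult_simps)
      qed
      then show "w = u" using wu by metis
    qed
    then show "inj_on (\<lambda>w. w + qadj w) (span B)" using sub span_eq_iff by metis
  qed
  ultimately show ?thesis
    using dim_sandwich[OF hproj_diff(1)[OF i A'(1,2)] A'(1)] A'(3) by (simp add: B_def rtr_diff)
qed

lemma Sp_carrier: "carrier (Sp K) = frames (qid K) (qid K)"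
  by (auto simp: Sp_def frames_def mem_qmats_iff)

lemma Sp_ops: "x \<otimes>\<^bsub>Sp K\<^esub> y = x ** y" "\<one>\<^bsub>Sp K\<^esub> = qid K"
  by (simp_all add: Sp_def)

lemma frames_mult:
  assumes "x \<in> frames a e" "y \<in> frames e b"
  shows "x ** y \<in> frames a b"
proof -
  have x: "a ** x = x" "qadj x ** x = e" and y: "e ** y = y" "y ** b = y" "qadj y ** y = b"
    using assms by (auto simp: frames_def)
  show ?thesis
    by (simp add: frames_def qadj_mult matrix_mul_assoc[symmetric] y mult_eq_assoc[OF x(1)]
        mult_eq_assoc[OF x(2)])
qed

lemma frames_qadj:
  assumes "hproj e" "x \<in> frames e e"
  shows "qadj x \<in> frames e e"
  using assms frames_self_adjoint[OF assms] by (simp add: frames_def) (metis hprojD(1) qadj_mult)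

lemma group_Sp: "group (Sp K)"
proof (rule groupI)
  show "\<exists>y\<in>carrier (Sp K). y \<otimes>\<^bsub>Sp K\<^esub> x = \<one>\<^bsub>Sp K\<^esub>" if "x \<in> carrier (Sp K)" for x
    using that frames_qadj[OF hproj_qid, of x K] unfolding Sp_carrier Sp_ops
    by (intro bexI[of _ "qadj x"]) (auto simp: frames_def)
qed (auto simp: Sp_carrier Sp_ops matrix_mul_assoc frames_mult, auto simp: frames_def qid_mult_qid)

lemma lie_group_Sp: "lie_group (Sp K)"
  unfolding lie_group_def
proof (intro conjI exI)
  show "group (Sp K)" by (rule group_Sp)
  show "submanifold (dim (skew (qid K))) (carrier (Sp K))"
    unfolding Sp_carrier by (rule submanifold_frames_self) simp
  have "smooth_on (carrier (Sp K) \<times> carrier (Sp K)) (\<lambda>p. fst p ** snd p)"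
    by (intro smooth_intros)
  then show "smooth_on (carrier (Sp K) \<times> carrier (Sp K)) (\<lambda>(a, b). a \<otimes>\<^bsub>Sp K\<^esub> b)"
    by (simp add: Sp_ops case_prod_unfold)
  show "smooth_on (carrier (Sp K)) (\<lambda>a. inv\<^bsub>Sp K\<^esub> a)"
  proof (rule smooth_on_cong)
    show "smooth_on (carrier (Sp K)) qadj" by (intro smooth_on_linear bounded_linear_qadj)
    show "qadj a = inv\<^bsub>Sp K\<^esub> a" if "a \<in> carrier (Sp K)" for a
      using that frames_qadj[OF hproj_qid, of a K]
      by (intro group.inv_equality[OF group_Sp, symmetric]) (auto simp: Sp_carrier Sp_ops frames_def)
  qed
qed

section \<open>The critical set of the height function\<close>

text \<open>
  The height function of the Stiefel manifold, for an arbitrary orthogonal projection in place of the coordinate one.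
\<close>

definition proj_height :: "quat ^ 'n ^ 'n \<Rightarrow> quat ^ 'n ^ 'n \<Rightarrow> real"
  where "proj_height e x = (e ** x) \<bullet> (e ** x)"

lemma frames_mat_1_iff: "x \<in> frames (mat 1) e \<longleftrightarrow> x ** e = x \<and> qadj x ** x = e"
  by (simp add: frames_def)

lemma tangent_space_stiefel:
  assumes "hproj e" "x \<in> frames (mat 1) e"
  shows "v \<in> tangent_space (frames (mat 1) e) x \<longleftrightarrow> v ** e = v \<and> qadj (qadj x ** v) = - (qadj x ** v)"
  unfolding tangent_space_frames[OF hproj_mat_1 assms]
  by (auto simp: qadj_mult eq_neg_iff_add_eq_0 add.commute)

lemma hermitian_inner_skew:
  fixes S b :: "quat ^ 'n ^ 'n"
  assumes "qadj S = S" "qadj b = - b"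
  shows "S \<bullet> b = 0"
proof -
  have "S \<bullet> b = rtr (S ** b)" by (simp add: inner_eq_rtr assms)
  also have "\<dots> = rtr (qadj (S ** b))" by simp
  also have "\<dots> = rtr (0 - b ** S)" by (simp add: qadj_mult assms mult_simps)
  also have "\<dots> = - rtr (b ** S)" by (simp only: rtr_diff rtr_0)
  also have "rtr (b ** S) = S \<bullet> b" by (simp add: inner_eq_rtr assms rtr_mult_commute)
  finally show ?thesis by simp
qed

lemma proj_height_curve:
  assumes e: "hproj e" and \<gamma>: "(\<gamma> has_vector_derivative v) (at t)"
  shows "((\<lambda>t. proj_height e (\<gamma> t)) has_real_derivative 2 * ((e ** \<gamma> t) \<bullet> v)) (at t)"
proof -
  have d: "((\<lambda>t. e ** \<gamma> t) has_vector_derivative (e ** v + 0 ** \<gamma> t)) (at t)"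
    by (intro vderiv_matrix_mult \<gamma> has_vector_derivative_const)
  have "(e ** \<gamma> t) \<bullet> (e ** v) = (e ** \<gamma> t) \<bullet> v"
    using e by (metis hprojD(1,3) inner_commute inner_matrix_mult_left)
  then show ?thesis
    using bounded_bilinear.has_vector_derivative[OF bounded_bilinear_inner d d]
    unfolding has_real_derivative_iff_has_vector_derivative proj_height_def
    by (simp add: inner_commute)
qed

lemma smooth_curve_has_vector_derivative:
  fixes \<gamma> :: "real \<Rightarrow> 'a::euclidean_space"
  assumes "open D" "smooth_on D \<gamma>" "t \<in> D"
  shows "(\<gamma> has_vector_derivative frechet_derivative \<gamma> (at t) 1) (at t)"
proof -
  have d: "(\<gamma> has_derivative frechet_derivative \<gamma> (at t)) (at t)"
    by (rule smooth_on_has_derivative[OF assms])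
  have "frechet_derivative \<gamma> (at t) h = h *\<^sub>R frechet_derivative \<gamma> (at t) 1" for h
    using linear_scale[OF has_derivative_linear[OF d], of h 1] by simp
  then have "frechet_derivative \<gamma> (at t) = (\<lambda>h. h *\<^sub>R frechet_derivative \<gamma> (at t) 1)" by (rule ext)
  then show ?thesis unfolding has_vector_derivative_def by (rule has_derivative_eq_rhs[OF d])
qed

text \<open>
  The vector \<open>e x - x S\<close> is tangent at \<open>x\<close> and is the gradient of the height, up to a factor.
\<close>

theorem critical_points_stiefel:
  assumes e: "hproj e"
  shows "critical_points (frames (mat 1) e) (proj_height e) =
    {x \<in> frames (mat 1) e. e ** x = x ** (qadj x ** (e ** x))}"
proof (intro equalityI subsetI)
  fix x assume "x \<in> critical_points (frames (mat 1) e) (proj_height e)"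
  then have x: "x \<in> frames (mat 1) e" and
    crit: "\<And>D \<gamma>. open D \<Longrightarrow> 0 \<in> D \<Longrightarrow> smooth_on D \<gamma> \<Longrightarrow> \<gamma> ` D \<subseteq> frames (mat 1) e \<Longrightarrow> \<gamma> 0 = x \<Longrightarrow>
      ((\<lambda>t. proj_height e (\<gamma> t)) has_real_derivative 0) (at 0)"
    unfolding critical_points_def by blast+
  have x': "x ** e = x" "qadj x ** x = e" using x by (simp_all add: frames_mat_1_iff)
  have ex: "e ** qadj x = qadj x" using x' e by (metis hprojD(1) qadj_mult)
  define S where "S = qadj x ** (e ** x)"
  define v where "v = e ** x - x ** S"
  have xv: "qadj x ** v = 0"
    by (simp add: v_def S_def mult_simps mult_eq_assoc[OF x'(2)] mult_eq_assoc[OF ex])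
  have "v ** e = v" by (simp add: v_def S_def mult_simps x')
  then have "v \<in> tangent_space (frames (mat 1) e) x"
    by (simp add: tangent_space_stiefel[OF e x] xv qadj_simps)
  then obtain D \<gamma> where \<gamma>: "open D" "0 \<in> D" "smooth_on D \<gamma>" "\<And>t. t \<in> D \<Longrightarrow> \<gamma> t \<in> frames (mat 1) e" "\<gamma> 0 = x"
    "(\<gamma> has_vector_derivative v) (at (0 :: real))" by (rule tangent_spaceE) blast
  have "((\<lambda>t. proj_height e (\<gamma> t)) has_real_derivative 0) (at 0)"
    by (rule crit[OF \<gamma>(1-3) _ \<gamma>(5)]) (use \<gamma>(4) in blast)
  then have "2 * ((e ** x) \<bullet> v) = 0"
    using proj_height_curve[OF e \<gamma>(6)] \<gamma>(5) DERIV_unique by metis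
  moreover have "(x ** S) \<bullet> v = 0" by (simp add: inner_matrix_mult_left xv)
  ultimately have "v \<bullet> v = 0" by (simp add: v_def inner_diff_left)
  then show "x \<in> {x \<in> frames (mat 1) e. e ** x = x ** (qadj x ** (e ** x))}"
    using x by (simp add: v_def S_def)
next
  fix x assume "x \<in> {x \<in> frames (mat 1) e. e ** x = x ** (qadj x ** (e ** x))}"
  then have x: "x \<in> frames (mat 1) e" and c: "e ** x = x ** (qadj x ** (e ** x))" by auto
  define S where "S = qadj x ** (e ** x)"
  have S: "qadj S = S" using e by (simp add: S_def qadj_simps hprojD matrix_mul_assoc)
  have "((\<lambda>t. proj_height e (\<gamma> t)) has_real_derivative 0) (at 0)"
    if \<gamma>: "open D" "0 \<in> D" "smooth_on D \<gamma>" "\<gamma> ` D \<subseteq> frames (mat 1) e" "\<gamma> 0 = x" for D \<gamma>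
  proof -
    define v where "v = frechet_derivative \<gamma> (at 0) 1"
    have d: "(\<gamma> has_vector_derivative v) (at 0)"
      unfolding v_def by (rule smooth_curve_has_vector_derivative[OF \<gamma>(1,3,2)])
    then have "v \<in> tangent_space (frames (mat 1) e) x"
      unfolding tangent_space_def using \<gamma> by blast
    then have "S \<bullet> (qadj x ** v) = 0"
      using S by (simp add: tangent_space_stiefel[OF e x] hermitian_inner_skew)
    then have "(e ** x) \<bullet> v = 0"
      by (subst c) (simp add: S_def[symmetric] inner_matrix_mult_left)
    then show ?thesis using proj_height_curve[OF e d] \<gamma>(5) by simp
  qed
  then show "x \<in> critical_points (frames (mat 1) e) (proj_height e)"
    unfolding critical_points_def using x by blast
qed

text \<open>
  A critical frame together with its projection \<open>S\<close>, whose trace is the critical value.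
\<close>

locale critical_frame =
  fixes e x S :: "quat ^ 'n ^ 'n"
  assumes e: "hproj e" and x: "x \<in> frames (mat 1) e"
    and S_def: "S = qadj x ** (e ** x)" and crit: "e ** x = x ** S"
begin

lemma xe: "x ** e = x" and xx: "qadj x ** x = e"
  using x by (simp_all add: frames_mat_1_iff)

lemma ex: "e ** qadj x = qadj x"
  using xe e by (metis hprojD(1) qadj_mult)

lemma hS: "qadj S = S"
  using e by (simp add: S_def qadj_simps hprojD matrix_mul_assoc)

lemma xS: "qadj x ** e = S ** qadj x"
  using crit e hS by (metis hprojD(1) qadj_mult qadj_qadj)

lemma eS: "e ** S = S" "S ** e = S"
  by (simp_all add: S_def matrix_mul_assoc ex) (simp add: matrix_mul_assoc[symmetric] xe)

lemma SS: "S ** S = S"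
proof -
  have "S ** S = qadj x ** (e ** (x ** S))" by (simp add: S_def matrix_mul_assoc)
  also have "\<dots> = S" using e by (simp add: crit[symmetric] hprojD) (simp add: S_def)
  finally show ?thesis .
qed

lemma ee: "e ** e = e" and he: "qadj e = e"
  using e by (simp_all add: hprojD)

lemmas rules = xe xx ex xS eS SS ee he hS crit

lemmas assoc_rules = xe[THEN mult_eq_assoc] xx[THEN mult_eq_assoc]
  ex[THEN mult_eq_assoc] xS[THEN mult_eq_assoc] eS[THEN mult_eq_assoc]
  SS[THEN mult_eq_assoc] ee[THEN mult_eq_assoc] crit[THEN mult_eq_assoc]

lemmas frame_simps = rules assoc_rules mult_simps

lemma hproj_S: "hproj S" by (simp add: hproj_def hS SS)

lemma hproj_Q: "hproj (x ** qadj x)" by (simp add: hproj_def qadj_simps frame_simps)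

lemma eQ: "e ** (x ** qadj x) = x ** (S ** qadj x)" "(x ** qadj x) ** e = x ** (S ** qadj x)"
  by (simp_all add: frame_simps)

lemma proj_height_eq: "proj_height e x = rtr S"
  by (simp add: proj_height_def inner_eq_rtr qadj_simps frame_simps)

lemma rtr_eQ: "rtr (x ** (S ** qadj x)) = rtr S"
proof -
  have "rtr (x ** (S ** qadj x)) = rtr ((S ** qadj x) ** x)" by (rule rtr_mult_commute)
  then show ?thesis by (simp add: frame_simps)
qed

lemma rtr_Q: "rtr (x ** qadj x) = rtr e"
  by (simp add: rtr_mult_commute[of x] xx)

text \<open>
  The orthogonal complement of the range of \<open>x\<close> splits under \<open>e\<close>; these are the projections onto its parts
  inside and outside the range of \<open>e\<close>.
\<close>

definition compl_in where "compl_in = e ** (mat 1 - x ** qadj x)"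
definition compl_out where "compl_out = (mat 1 - e) ** (mat 1 - x ** qadj x)"

lemma compl_eqs: "compl_in = e - x ** (S ** qadj x)" "compl_out = mat 1 - e - x ** qadj x + x ** (S ** qadj x)"
  by (simp_all add: compl_in_def compl_out_def frame_simps)

lemma hproj_compl: "hproj compl_in" "hproj compl_out"
  unfolding compl_in_def compl_out_def
  by (rule hproj_mult[OF e hproj_Compl[OF hproj_Q]], simp add: frame_simps)
    (rule hproj_mult[OF hproj_Compl[OF e] hproj_Compl[OF hproj_Q]], simp add: frame_simps)

lemma rtr_compl: "rtr compl_in = rtr e - rtr S" "rtr compl_out = rtr (mat 1 :: quat ^ 'n ^ 'n) - 2 * rtr e + rtr S"
  by (simp_all add: compl_eqs rtr_diff rtr_add rtr_eQ rtr_Q)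

text \<open>
  Both bounds express that a projection, \<open>compl_in\<close> or \<open>compl_out\<close>, has nonnegative rank.
\<close>

lemma height_bounds: "rtr S \<le> rtr e" "2 * rtr e - rtr (mat 1 :: quat ^ 'n ^ 'n) \<le> rtr S"
  using rtr_hproj_nonneg[OF hproj_compl(1)] rtr_hproj_nonneg[OF hproj_compl(2)] by (simp_all add: rtr_compl)

text \<open>
  The component of a tangent vector orthogonal to the directions \<open>x a\<close>, in which the range of \<open>x\<close> stays fixed.
\<close>

definition normal where "normal v = v - x ** (qadj x ** v)"

text \<open>
  The tangent space of the Stiefel manifold, see \<open>tangent_X\<close>.
\<close>

definition tangent where "tangent = {v. v ** e = v \<and> qadj (qadj x ** v) = - (qadj x ** v)}"

lemma tangent_X: "tangent_space (frames (mat 1) e) x = tangent"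
  using tangent_space_stiefel[OF e x] by (auto simp: tangent_def)

lemma tangent_D:
  assumes "v \<in> tangent"
  defines "a \<equiv> qadj x ** v"
  shows "v ** e = v" "qadj a = - a" "e ** a = a" "a ** e = a" "qadj v ** x = - a"
    "v = x ** a + normal v" "qadj x ** normal v = 0" "normal v ** e = normal v"
    "(x ** (S ** a - a ** S)) \<bullet> u = (S ** a - a ** S) \<bullet> (qadj x ** u)"
    "qadj (S ** a - a ** S) = S ** a - a ** S"
    "e ** v - v ** S = x ** (S ** a - a ** S) + (e ** normal v - normal v ** S)"
proof -
  show v: "v ** e = v" "qadj a = - a" using assms by (auto simp: tangent_def)
  show "e ** a = a" by (simp add: a_def frame_simps)
  show "a ** e = a" using v by (simp add: a_def frame_simps)
  show "qadj v ** x = - a" using v(2) by (simp add: a_def qadj_simps)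
  show "v = x ** a + normal v" by (simp add: normal_def a_def)
  show "qadj x ** normal v = 0" by (simp add: normal_def frame_simps)
  show "normal v ** e = normal v" using v(1) by (simp add: normal_def frame_simps)
  show "(x ** (S ** a - a ** S)) \<bullet> u = (S ** a - a ** S) \<bullet> (qadj x ** u)"
    by (rule inner_matrix_mult_left)
  show "qadj (S ** a - a ** S) = S ** a - a ** S"
    using v(2) by (simp add: qadj_simps hS mult_simps)
  show "e ** v - v ** S = x ** (S ** a - a ** S) + (e ** normal v - normal v ** S)"
    by (simp add: normal_def a_def[symmetric] frame_simps)
qed

lemma hessian_form:
  assumes "u \<in> tangent" "v \<in> tangent"
  shows "(e ** u - u ** S) \<bullet> v = (e ** normal u - normal u ** S) \<bullet> v"
proof -
  have "(x ** (S ** (qadj x ** u) - (qadj x ** u) ** S)) \<bullet> v = 0"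
    using hermitian_inner_skew[OF tangent_D(10)[OF assms(1)] tangent_D(2)[OF assms(2)]] tangent_D(9)[OF assms(1), of v] by simp
  then show ?thesis using tangent_D(11)[OF assms(1)] by (simp add: inner_add_left)
qed

text \<open>
  Along a two-parameter family \<open>\<sigma>\<close> the first derivative is \<open>2 \<langle>e \<sigma>, \<sigma>\<^sub>t\<rangle>\<close>.  As \<open>S\<close> is hermitian and \<open>\<sigma>\<^sup>* \<sigma>\<^sub>t\<close> is skew,
  this equals \<open>2 \<langle>e \<sigma> - \<sigma> S, \<sigma>\<^sub>t\<rangle>\<close> for the fixed matrix \<open>S\<close>, and the first factor is zero at the critical point.
\<close>

theorem hessian_eq:
  assumes u: "u \<in> tangent" and v: "v \<in> tangent"
  shows "hessian (frames (mat 1) e) (proj_height e) x u v = 2 * ((e ** u - u ** S) \<bullet> v)"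
  unfolding hessian_def
proof (rule the_equality)
  let ?X = "frames (mat 1) e"
  let ?c = "2 * ((e ** u - u ** S) \<bullet> v)"
  show all: "\<forall>W (\<sigma> :: real \<times> real \<Rightarrow> quat ^ 'n ^ 'n).
    open W \<and> (0, 0) \<in> W \<and> smooth_on W \<sigma> \<and> \<sigma> ` W \<subseteq> ?X \<and> \<sigma> (0, 0) = x \<and>
    ((\<lambda>s. \<sigma> (s, 0)) has_vector_derivative u) (at 0) \<and>
    ((\<lambda>t. \<sigma> (0, t)) has_vector_derivative v) (at 0) \<longrightarrow>
    deriv (\<lambda>s. deriv (\<lambda>t. proj_height e (\<sigma> (s, t))) 0) 0 = ?c"
  proof (intro allI impI, elim conjE)
    fix W and \<sigma> :: "real \<times> real \<Rightarrow> quat ^ 'n ^ 'n"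
    assume W: "open W" "(0, 0) \<in> W" and sm: "smooth_on W \<sigma>" and im: "\<sigma> ` W \<subseteq> ?X"
      and \<sigma>0: "\<sigma> (0, 0) = x"
      and du: "((\<lambda>s. \<sigma> (s, 0)) has_vector_derivative u) (at 0)"
      and dv: "((\<lambda>t. \<sigma> (0, t)) has_vector_derivative v) (at 0)"
    define \<tau> where "\<tau> = (\<lambda>s. frechet_derivative \<sigma> (at (s, 0)) (0, 1))"
    define m where "m = (\<lambda>s. \<sigma> (s, 0))"
    define D where "D = {s. (s, 0) \<in> W}"
    have "open D" unfolding D_def
      using open_vimage[OF W(1), of "\<lambda>s. (s, 0)"] by (simp add: vimage_def continuous_intros)
    have D0: "0 \<in> D" using W(2) by (simp add: D_def)
    have d\<tau>: "((\<lambda>t. \<sigma> (s, t)) has_vector_derivative \<tau> s) (at 0)" if "s \<in> D" for s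
      unfolding \<tau>_def
      by (rule has_derivative_imp_curve[where \<gamma> = "\<lambda>t. (s, t)"])
        (use smooth_on_has_derivative[OF W(1) sm] that in
          \<open>auto simp: D_def intro!: has_vector_derivative_Pair derivative_eq_intros\<close>)
    have \<tau>tangent: "qadj (qadj (m s) ** \<tau> s) = - (qadj (m s) ** \<tau> s)" if "s \<in> D" for s
    proof -
      define D' where "D' = {t. (s, t) \<in> W}"
      have "open D'" unfolding D'_def
        using open_vimage[OF W(1), of "\<lambda>t. (s, t)"] by (simp add: vimage_def continuous_intros)
      moreover have "0 \<in> D'" using that by (simp add: D_def D'_def)
      moreover have "smooth_on D' (\<lambda>t. \<sigma> (s, t))"
        by (rule smooth_on_compose[OF _ sm]) (auto simp: D'_def intro!: smooth_intros)
      moreover have "(\<lambda>t. \<sigma> (s, t)) ` D' \<subseteq> ?X" using im by (auto simp: D'_def)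
      ultimately have "\<tau> s \<in> tangent_space ?X (m s)"
        unfolding tangent_space_def m_def using d\<tau>[OF that] by blast
      moreover have "m s \<in> ?X" using that im by (auto simp: m_def D_def)
      ultimately show ?thesis using tangent_space_stiefel[OF e] by blast
    qed
    define \<phi> where "\<phi> = (\<lambda>s. 2 * ((e ** m s - m s ** S) \<bullet> \<tau> s))"
    have inner: "deriv (\<lambda>t. proj_height e (\<sigma> (s, t))) 0 = \<phi> s" if s: "s \<in> D" for s
    proof -
      have "deriv (\<lambda>t. proj_height e (\<sigma> (s, t))) 0 = 2 * ((e ** m s) \<bullet> \<tau> s)"
        unfolding m_def by (rule DERIV_imp_deriv[OF proj_height_curve[OF e d\<tau>[OF s]]])
      moreover have "(m s ** S) \<bullet> \<tau> s = 0"
        using hermitian_inner_skew[OF hS \<tau>tangent[OF s]] by (simp add: inner_matrix_mult_left)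
      ultimately show ?thesis by (simp add: \<phi>_def inner_diff_left)
    qed
    have \<tau>0: "\<tau> 0 = v" using d\<tau>[OF D0] dv vector_derivative_unique_at by blast
    have "smooth_on D \<tau>" unfolding \<tau>_def
      by (rule smooth_on_compose[OF _ smooth_on_frechet_derivative[OF W(1) sm]])
        (auto simp: D_def intro!: smooth_intros)
    then obtain \<tau>' where d2: "(\<tau> has_vector_derivative \<tau>') (at 0)"
      using smooth_curve_has_vector_derivative[OF \<open>open D\<close> _ D0] by blast
    have dm: "(m has_vector_derivative u) (at 0)" using du by (simp add: m_def)
    have "((\<lambda>s. e ** m s - m s ** S) has_vector_derivative (e ** u + 0 ** m 0) - (m 0 ** 0 + u ** S)) (at 0)"
      by (intro has_vector_derivative_diff vderiv_matrix_mult dm has_vector_derivative_const)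
    then have d1: "((\<lambda>s. e ** m s - m s ** S) has_vector_derivative (e ** u - u ** S)) (at 0)" by simp
    \<comment> \<open>The factor \<open>e m - m S\<close> vanishes at a critical point, so the second derivatives of \<open>\<sigma>\<close> drop out.\<close>
    have "((\<lambda>s. (e ** m s - m s ** S) \<bullet> \<tau> s) has_vector_derivative (e ** u - u ** S) \<bullet> v) (at 0)"
      using bounded_bilinear.has_vector_derivative[OF bounded_bilinear_inner d1 d2]
      by (simp add: m_def \<sigma>0 \<tau>0 crit)
    then have "(\<phi> has_vector_derivative ?c) (at 0)"
      unfolding \<phi>_def by (rule bounded_linear.has_vector_derivative[OF bounded_linear_mult_right])
    then have "(\<phi> has_real_derivative ?c) (at 0)"
      by (simp add: has_real_derivative_iff_has_vector_derivative)
    then have "((\<lambda>s. deriv (\<lambda>t. proj_height e (\<sigma> (s, t))) 0) has_real_derivative ?c) (at 0)"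
      by (rule has_field_derivative_transform_within_open[OF _ \<open>open D\<close> D0]) (simp add: inner)
    then show "deriv (\<lambda>s. deriv (\<lambda>t. proj_height e (\<sigma> (s, t))) 0) 0 = ?c" by (rule DERIV_imp_deriv)
  qed
  show "c = ?c" if "\<forall>W (\<sigma> :: real \<times> real \<Rightarrow> quat ^ 'n ^ 'n).
    open W \<and> (0, 0) \<in> W \<and> smooth_on W \<sigma> \<and> \<sigma> ` W \<subseteq> ?X \<and> \<sigma> (0, 0) = x \<and>
    ((\<lambda>s. \<sigma> (s, 0)) has_vector_derivative u) (at 0) \<and>
    ((\<lambda>t. \<sigma> (0, t)) has_vector_derivative v) (at 0) \<longrightarrow>
    deriv (\<lambda>s. deriv (\<lambda>t. proj_height e (\<sigma> (s, t))) 0) 0 = c" for c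
  proof -
    \<comment> \<open>some family with the prescribed velocities exists, so that the value is unique\<close>
    obtain W r where retr: "smooth_retraction W ?X r"
      using frames_retraction[OF hproj_mat_1 e] by blast
    have W: "open W" "smooth_on W r" "x \<in> W" "r x = x" "r ` W \<subseteq> ?X"
      using retr x unfolding smooth_retraction_def by blast+
    define \<sigma> where "\<sigma> = (\<lambda>p :: real \<times> real. r (x + fst p *\<^sub>R u + snd p *\<^sub>R v))"
    define W' where "W' = {p :: real \<times> real. x + fst p *\<^sub>R u + snd p *\<^sub>R v \<in> W}"
    have dr: "((\<lambda>t. r (x + t *\<^sub>R w)) has_vector_derivative w) (at 0)" if "w \<in> tangent" for w
    proof -
      have "frechet_derivative r (at x) w = w"
        using that tangent_space_retract(1)[OF retr x] tangent_X by blast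
      moreover have "((\<lambda>t. r (x + t *\<^sub>R w)) has_vector_derivative frechet_derivative r (at x) w) (at 0)"
        by (rule has_derivative_imp_curve)
          (use smooth_on_has_derivative[OF W(1-3)] in \<open>auto intro!: derivative_eq_intros\<close>)
      ultimately show ?thesis by simp
    qed
    have "open W'" unfolding W'_def
      by (rule open_smooth_vimage[OF _ W(1)]) (intro smooth_intros)
    moreover have "(0, 0) \<in> W'" using W(3) by (simp add: W'_def)
    moreover have "smooth_on W' \<sigma>" unfolding \<sigma>_def
      by (rule smooth_on_compose[OF _ W(2)]) (auto simp: W'_def intro!: smooth_intros)
    moreover have "\<sigma> ` W' \<subseteq> ?X" using W(5) by (auto simp: W'_def \<sigma>_def)
    moreover have "\<sigma> (0, 0) = x" by (simp add: \<sigma>_def W(4))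
    moreover have "((\<lambda>s. \<sigma> (s, 0)) has_vector_derivative u) (at 0)"
      "((\<lambda>t. \<sigma> (0, t)) has_vector_derivative v) (at 0)"
      using dr[OF u] dr[OF v] by (simp_all add: \<sigma>_def)
    ultimately show ?thesis using that all by metis
  qed
qed

text \<open>
  Testing against the tangent vector \<open>e w - w S\<close>, for the normal component \<open>w\<close> of \<open>u\<close>, shows that it is zero on the kernel.
\<close>

theorem hessian_kernel_eq:
  "hessian_kernel (frames (mat 1) e) (proj_height e) x = {u \<in> tangent. e ** normal u = normal u ** S}"
proof -
  have "(\<forall>v\<in>tangent. (e ** u - u ** S) \<bullet> v = 0) \<longleftrightarrow> e ** normal u = normal u ** S" if u: "u \<in> tangent" for u
  proof
    assume *: "\<forall>v\<in>tangent. (e ** u - u ** S) \<bullet> v = 0"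
    define z where "z = e ** normal u - normal u ** S"
    have "qadj x ** z = 0"
      using tangent_D(7)[OF u] by (simp add: z_def frame_simps mult_eq_assoc[OF tangent_D(7)[OF u]])
    moreover have "z ** e = z"
      using tangent_D(8)[OF u] by (simp add: z_def frame_simps)
    ultimately have "z \<in> tangent" by (simp add: tangent_def qadj_simps(6))
    then have "z \<bullet> z = 0" using * hessian_form[OF u \<open>z \<in> tangent\<close>] by (simp add: z_def)
    then show "e ** normal u = normal u ** S" by (simp add: z_def)
  qed (simp add: hessian_form[OF u])
  moreover have "(\<forall>v\<in>tangent. hessian (frames (mat 1) e) (proj_height e) x u v = 0) \<longleftrightarrow>
      (\<forall>v\<in>tangent. (e ** u - u ** S) \<bullet> v = 0)" if "u \<in> tangent" for u
    using hessian_eq[OF that] by simp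
  ultimately show ?thesis
    unfolding hessian_kernel_def tangent_X by (intro Collect_cong conj_cong refl) simp
qed

text \<open>
  The Hessian is negative definite on the space \<open>N\<close> of all \<open>w\<close> with \<open>compl_out w S = w\<close>, and nonnegative on the
  tangent vectors annihilated by \<open>v \<mapsto> compl_out v S\<close>.  This map therefore embeds any negative definite space
  into \<open>N\<close>.
\<close>

theorem morse_index_eq:
  "real (morse_index (frames (mat 1) e) (proj_height e) x) = 4 * rtr compl_out * rtr S"
proof -
  let ?L = "\<lambda>w. compl_out ** (w ** S)"
  define N where "N = {w. ?L w = w}"
  have lin: "linear ?L" by (rule linearI) (simp_all add: mult_simps)
  have idem: "?L (?L w) = ?L w" for w
    using hproj_compl(2) by (simp add: matrix_mul_assoc[symmetric] hprojD frame_simps)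
  have compl_out: "e ** compl_out = 0" "qadj x ** compl_out = 0"
    by (simp_all add: compl_eqs frame_simps)
  define neg where "neg = (\<lambda>V. subspace V \<and> V \<subseteq> tangent \<and>
    (\<forall>v\<in>V. v \<noteq> 0 \<longrightarrow> hessian (frames (mat 1) e) (proj_height e) x v v < 0))"
  have N: "neg N"
    unfolding neg_def
  proof (intro conjI ballI impI)
    have "N = {w. ?L w - w = 0}" by (auto simp: N_def)
    then show "subspace N"
      by (simp add: subspace_def N_def mult_simps)
    have wN: "e ** w = 0 \<and> qadj x ** w = 0 \<and> w ** S = w" if "w \<in> N" for w
    proof -
      have w: "w = compl_out ** (w ** S)" using that by (simp add: N_def)
      show ?thesis
        using w compl_out by (metis SS matrix_mul_assoc times0_left)
    qed
    show N_tangent: "N \<subseteq> tangent"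
    proof
      fix w assume "w \<in> N"
      note w = wN[OF this]
      then have "w ** e = w" by (metis eS(2) matrix_mul_assoc)
      then show "w \<in> tangent" using w by (simp add: tangent_def qadj_simps(6))
    qed
    fix w assume w: "w \<in> N" "w \<noteq> 0"
    have "w \<in> tangent" using N_tangent w by blast
    then show "hessian (frames (mat 1) e) (proj_height e) x w w < 0"
      using wN[OF w(1)] w(2) by (simp add: hessian_eq)
  qed
  have le: "dim V \<le> dim N" if V: "neg V" for V
  proof -
    have V': "subspace V" "V \<subseteq> tangent" using V by (auto simp: neg_def)
    have pos: "(e ** v - v ** S) \<bullet> v \<ge> 0" if v: "v \<in> tangent" "?L v = 0" for v
    proof -
      define w where "w = normal v"
      have we: "w ** e = w" "qadj x ** w = 0" using tangent_D(7,8)[OF v(1)] by (simp_all add: w_def)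
      have "compl_out ** v = (mat 1 - e) ** w"
        unfolding compl_out_def w_def normal_def by (simp add: frame_simps)
      then have "w ** S = e ** (w ** S)"
        using v(2) by (simp add: matrix_mul_assoc) (simp add: matrix_mul_assoc[symmetric] mult_simps)
      then have eq: "e ** w - w ** S = e ** (w ** (e - S))"
        by (simp add: mult_simps we)
      have "(e ** w - w ** S) \<bullet> (x ** (qadj x ** v)) = 0"
        by (simp add: inner_matrix_mult_left[symmetric] inner_commute[of _ "x ** _"])
          (simp add: inner_matrix_mult_left frame_simps we inner_diff_right mult_eq_assoc[OF we(2)])
      then have "(e ** v - v ** S) \<bullet> v = (e ** w - w ** S) \<bullet> w"
        using hessian_form[OF v(1) v(1)] tangent_D(6)[OF v(1)]
        by (simp add: w_def) (metis add.left_neutral inner_add_right)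
      also have "\<dots> = (e ** (w ** (e - S))) \<bullet> (e ** (w ** (e - S)))"
      proof -
        define R where "R = e - S"
        define Y where "Y = e ** (w ** R)"
        have R: "hproj R" unfolding R_def by (rule hproj_diff(1)[OF e hproj_S eS(1)])
        have Y: "e ** Y = Y" "Y ** R = Y"
          using e R by (simp_all add: Y_def matrix_mul_assoc[symmetric] hprojD)
        have "Y \<bullet> w = (Y ** R) \<bullet> w" by (simp add: Y)
        also have "\<dots> = Y \<bullet> (w ** R)" unfolding inner_matrix_mult_right using R by (simp add: hprojD)
        also have "\<dots> = (e ** Y) \<bullet> (w ** R)" by (simp add: Y)
        also have "\<dots> = Y \<bullet> Y" unfolding inner_matrix_mult_left using e by (simp add: hprojD Y_def)
        finally show ?thesis unfolding eq Y_def R_def .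
      qed
      finally show ?thesis by simp
    qed
    have "inj_on ?L V"
    proof (rule inj_onI, rule ccontr)
      fix u v assume uv: "u \<in> V" "v \<in> V" "?L u = ?L v" "u \<noteq> v"
      have "u - v \<in> V" using V'(1) uv by (simp add: subspace_diff)
      moreover have "?L (u - v) = 0" using uv(3) by (simp add: linear_diff[OF lin])
      ultimately have "hessian (frames (mat 1) e) (proj_height e) x (u - v) (u - v) \<ge> 0"
        using pos[of "u - v"] V'(2) hessian_eq[of "u - v" "u - v"] by auto
      then show False using V \<open>u - v \<in> V\<close> uv(4) unfolding neg_def by force
    qed
    then have "inj_on ?L (span V)" using V'(1) span_eq_iff by metis
    then have "dim V = dim (?L ` V)" using dim_image_eq[OF lin] by metis
    also have "\<dots> \<le> dim N" by (rule dim_subset) (auto simp: N_def idem)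
    finally show ?thesis .
  qed
  have "morse_index (frames (mat 1) e) (proj_height e) x = Max {dim V | V. neg V}"
    unfolding morse_index_def tangent_X neg_def ..
  also have "\<dots> = dim N"
  proof (rule Max_eqI)
    show "finite {dim V | V. neg V}"
      by (rule finite_subset[of _ "{..dim N}"]) (use le in auto)
  qed (use le N in auto)
  finally show ?thesis
    using dim_sandwich[OF hproj_compl(2) hproj_S] by (simp add: N_def)
qed

end

section \<open>The critical submanifolds\<close>

text \<open>
  The critical submanifold of value \<open>q\<close>, see \<open>critical_level_set_eq\<close>.
\<close>

definition crit_level :: "quat ^ 'n ^ 'n \<Rightarrow> nat \<Rightarrow> (quat ^ 'n ^ 'n) set"
  where "crit_level e q = {x \<in> frames (mat 1) e.
    e ** x = x ** (qadj x ** (e ** x)) \<and> rtr (qadj x ** (e ** x)) = real q}"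

lemma crit_level_critical_frame:
  "hproj e \<Longrightarrow> x \<in> crit_level e q \<Longrightarrow> critical_frame e x (qadj x ** (e ** x))"
  unfolding crit_level_def by unfold_locales auto

lemma crit_levelI:
  assumes "x \<in> frames (mat 1) e" "e ** x = x ** S" "e ** S = S" "rtr S = real q"
  shows "x \<in> crit_level e q"
proof -
  have "qadj x ** (e ** x) = S"
    using assms by (simp add: frames_mat_1_iff matrix_mul_assoc)
  then show ?thesis using assms by (simp add: crit_level_def)
qed

text \<open>
  To retract onto a critical level, round \<open>x\<^sup>* e x\<close> to a projection \<open>S\<close>, discard the part of \<open>x\<close> that violates
  \<open>e x = x S\<close>, and make the result orthonormal.
\<close>

definition level_proj :: "quat ^ 'n ^ 'n \<Rightarrow> quat ^ 'n ^ 'n \<Rightarrow> quat ^ 'n ^ 'n"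
  where "level_proj e x = round_proj e (qadj (x ** e) ** (e ** (x ** e)))"

definition level_split :: "quat ^ 'n ^ 'n \<Rightarrow> quat ^ 'n ^ 'n \<Rightarrow> quat ^ 'n ^ 'n"
  where "level_split e x = e ** ((x ** e) ** level_proj e x)
    + (mat 1 - e) ** ((x ** e) ** (e - level_proj e x))"

definition level_retract :: "quat ^ 'n ^ 'n \<Rightarrow> quat ^ 'n ^ 'n \<Rightarrow> quat ^ 'n ^ 'n"
  where "level_retract e x = level_split e x ** isqrt (gram e (level_split e x))"

lemma level_retract_fix:
  assumes e: "hproj e" and x: "x \<in> crit_level e q"
  defines "S \<equiv> qadj x ** (e ** x)"
  shows "qadj (x ** e) ** (e ** (x ** e)) \<in> round_dom e" "level_proj e x = S"
    "level_split e x = x" "gram e x = mat 1" "level_retract e x = x"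
proof -
  interpret critical_frame e x S unfolding S_def by (rule crit_level_critical_frame[OF e x])
  have 1: "qadj (x ** e) ** (e ** (x ** e)) = S" by (simp add: frame_simps)
  show "qadj (x ** e) ** (e ** (x ** e)) \<in> round_dom e" "level_proj e x = S"
    unfolding level_proj_def 1 using round_proj_fix[OF e hproj_S eS(1)] by auto
  then show 2: "level_split e x = x" by (simp add: level_split_def frame_simps)
  show 3: "gram e x = mat 1" by (rule gram_frames[OF critical_frame.x]) unfold_locales
  show "level_retract e x = x" by (simp add: level_retract_def 2 3 isqrt_mat_1)
qed

text \<open>
  After the splitting step, \<open>S\<close> commutes with the Gram matrix and hence with its inverse square root, so
  orthonormalising preserves \<open>e x = x S\<close>.
\<close>

lemma level_retraction:
  fixes e :: "quat ^ 'n ^ 'n"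
  assumes e: "hproj e"
  obtains W where "smooth_retraction W (crit_level e q) (level_retract e)"
proof -
  define O1 where "O1 = {x :: quat ^ 'n ^ 'n. qadj (x ** e) ** (e ** (x ** e)) \<in> round_dom e}"
  have "open O1" unfolding O1_def
    by (intro open_smooth_vimage open_round_dom smooth_intros)
  have smS: "smooth_on O1 (level_proj e)"
    unfolding level_proj_def
    by (rule smooth_on_compose[OF _ smooth_on_round_proj]) (auto simp: O1_def intro!: smooth_intros)
  then have smX: "smooth_on O1 (level_split e)"
    unfolding level_split_def by (intro smooth_intros)
  define \<psi> where "\<psi> = (\<lambda>x. (gram e (level_split e x), rtr (level_proj e x)))"
  have sm\<psi>: "smooth_on O1 \<psi>"
    unfolding \<psi>_def by (intro smooth_on_Pair smooth_on_gram smX smooth_on_linear_compose[OF bounded_linear_rtr] smS)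
  define W where "W = O1 \<inter> \<psi> -` (isqrt_dom \<times> {real q - 1 <..< real q + 1})"
  have "open W" unfolding W_def
    by (intro continuous_open_preimage[OF smooth_on_imp_continuous_on[OF sm\<psi>] \<open>open O1\<close>]
        open_Times open_isqrt_dom) simp
  moreover have "smooth_on W (level_retract e)"
    unfolding level_retract_def
    by (intro smooth_on_matrix_mult smooth_on_compose[OF _ smooth_on_isqrt] smooth_on_gram smooth_on_subset[OF smX])
      (auto simp: W_def \<psi>_def)
  moreover have "crit_level e q \<subseteq> W"
    using level_retract_fix[OF e] mat_1_isqrt_dom
    by (auto simp: W_def O1_def \<psi>_def crit_level_def)
  moreover have "\<forall>x\<in>crit_level e q. level_retract e x = x"
    using level_retract_fix(5)[OF e] by blast
  moreover have "level_retract e x \<in> crit_level e q" if "x \<in> W" for x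
  proof -
    define S where "S = level_proj e x"
    define y where "y = level_split e x"
    define N where "N = gram e y"
    define g where "g = isqrt N"
    have N: "N \<in> isqrt_dom" and q: "\<bar>rtr S - real q\<bar> < 1" and
      dom: "qadj (x ** e) ** (e ** (x ** e)) \<in> round_dom e"
      using that by (auto simp: W_def \<psi>_def O1_def N_def y_def S_def)
    have S: "hproj S" "e ** S = S"
      unfolding S_def level_proj_def using hproj_round_proj[OF e dom] by auto
    have Se: "S ** e = S" by (rule hproj_diff(2)[OF e S])
    have y: "y = e ** ((x ** e) ** S) + (mat 1 - e) ** ((x ** e) ** (e - S))"
      by (simp add: y_def S_def level_split_def)
    note r = hprojD[OF e] hprojD[OF S(1)] S(2) Se mult_eq_assoc[OF S(2)] mult_eq_assoc[OF Se] mult_simps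
    have ye: "y ** e = y" unfolding y by (simp add: r)
    have yS: "y ** S = e ** y" "e ** y = e ** (x ** S)" unfolding y by (simp_all add: r)
    have "S ** N = N ** S"
    proof -
      have Sy: "S ** qadj y = qadj y ** e" using yS(1) e S(1) by (metis hprojD(1) qadj_mult)
      have "S ** (qadj y ** y) = qadj y ** (e ** y)" by (simp add: matrix_mul_assoc Sy)
      also have "\<dots> = (qadj y ** y) ** S" by (simp add: yS(1)[symmetric] matrix_mul_assoc)
      finally show ?thesis unfolding N_def gram_def by (simp add: r)
    qed
    then have Sg: "S ** g = g ** S" unfolding g_def by (rule isqrt_commute[OF N])
    have ret: "level_retract e x = y ** g" by (simp add: level_retract_def y_def g_def N_def)
    have fr: "y ** g \<in> frames (mat 1) e"
      unfolding frames_mat_1_iff g_def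
      using orthonormalise(2,3)[OF e ye N_def[unfolded gram_def] N] by blast
    have "e ** (y ** g) = (y ** S) ** g" by (simp add: matrix_mul_assoc yS(1))
    also have "\<dots> = (y ** g) ** S" by (simp add: matrix_mul_assoc[symmetric] Sg)
    finally have "e ** (y ** g) = (y ** g) ** S" .
    then show ?thesis
      unfolding ret by (rule crit_levelI[OF fr _ S(2) rtr_hproj_eqI[OF S(1) q]])
  qed
  ultimately have "smooth_retraction W (crit_level e q) (level_retract e)"
    unfolding smooth_retraction_def by blast
  then show thesis by (rule that)
qed

text \<open>
  The tangent vectors of a critical level are the solutions of the linearised equation.  For such a
  vector \<open>v\<close> every step of the retraction moves \<open>x + t v\<close> only to second order.
\<close>

theorem tangent_space_crit_level:
  assumes e: "hproj e" and xq: "x \<in> crit_level e q"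
  defines "S \<equiv> qadj x ** (e ** x)"
  shows "tangent_space (crit_level e q) x = {v \<in> tangent_space (frames (mat 1) e) x.
    e ** critical_frame.normal x v = critical_frame.normal x v ** S}"
proof -
  interpret critical_frame e x S unfolding S_def by (rule crit_level_critical_frame[OF e xq])
  show ?thesis unfolding tangent_X
  proof (intro equalityI subsetI)
    fix v assume "v \<in> tangent_space (crit_level e q) x"
    then obtain D \<gamma> where \<gamma>: "open D" "0 \<in> D" "smooth_on D \<gamma>" "\<And>t. t \<in> D \<Longrightarrow> \<gamma> t \<in> crit_level e q"
      "\<gamma> 0 = x" "(\<gamma> has_vector_derivative v) (at (0 :: real))" by (rule tangent_spaceE) blast
    have "\<gamma> ` D \<subseteq> frames (mat 1) e" using \<gamma>(4) by (auto simp: crit_level_def)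
    then have "v \<in> tangent_space (frames (mat 1) e) x"
      unfolding tangent_space_def using \<gamma> by blast
    then have v: "v \<in> tangent" by (simp add: tangent_X)
    define a where "a = qadj x ** v"
    note a = tangent_D[OF v, folded a_def]
    have "((\<lambda>t. e ** \<gamma> t - \<gamma> t ** (qadj (\<gamma> t) ** (e ** \<gamma> t))) has_vector_derivative
        (e ** v + 0 ** \<gamma> 0) - (\<gamma> 0 ** (qadj (\<gamma> 0) ** (e ** v + 0 ** \<gamma> 0) + qadj v ** (e ** \<gamma> 0))
          + v ** (qadj (\<gamma> 0) ** (e ** \<gamma> 0)))) (at 0)"
      by (intro has_vector_derivative_diff vderiv_matrix_mult vderiv_qadj has_vector_derivative_const \<gamma>(6))
    then have "(e ** v + 0 ** \<gamma> 0) - (\<gamma> 0 ** (qadj (\<gamma> 0) ** (e ** v + 0 ** \<gamma> 0) + qadj v ** (e ** \<gamma> 0))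
          + v ** (qadj (\<gamma> 0) ** (e ** \<gamma> 0))) = 0"
      by (rule curve_constant_derivative[OF _ \<gamma>(1,2), where c = 0]) (use \<gamma>(4) in \<open>simp add: crit_level_def\<close>)
    then have ev: "e ** v = x ** (qadj x ** (e ** v) + qadj v ** (e ** x)) + v ** S"
      by (simp add: \<gamma>(5) S_def)
    have 1: "qadj x ** (e ** v) = S ** a" by (simp add: a_def matrix_mul_assoc xS)
    have 2: "qadj v ** (e ** x) = - (a ** S)"
      by (simp add: crit matrix_mul_assoc a(5)) (simp add: mult_simps)
    have "e ** normal v = normal v ** S"
      using ev unfolding 1 2 normal_def a_def[symmetric]
      by (simp add: mult_simps crit[THEN mult_eq_assoc])
    then show "v \<in> {v \<in> tangent. e ** normal v = normal v ** S}" using v by simp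
  next
    fix v assume "v \<in> {v \<in> tangent. e ** normal v = normal v ** S}"
    then have v: "v \<in> tangent" and n: "e ** normal v = normal v ** S" by auto
    define a where "a = qadj x ** v"
    note a = tangent_D[OF v, folded a_def]
    define s where "s = S ** a - a ** S"
    have ev: "e ** v = x ** s + v ** S"
      using a(11) n by (simp add: s_def eq_diff_eq[symmetric] diff_eq_eq)
    have s: "qadj s = s" "e ** s = s" "S ** s + s ** S = s"
      using a(10) by (simp_all add: s_def frame_simps a(3) mult_eq_assoc[OF a(3)])
    have s2: "qadj x ** (e ** v) + qadj v ** (e ** x) = s"
    proof -
      have "qadj x ** (e ** v) = S ** a" by (simp add: a_def matrix_mul_assoc xS)
      moreover have "qadj v ** (e ** x) = - (a ** S)"
        by (simp add: crit matrix_mul_assoc a(5)) (simp add: mult_simps)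
      ultimately show ?thesis by (simp add: s_def)
    qed
    have gram0: "qadj x ** v + qadj v ** x = 0" by (simp add: a_def[symmetric] a(5))
    obtain W where retr: "smooth_retraction W (crit_level e q) (level_retract e)"
      using level_retraction[OF e] .
    define Y where "Y = (\<lambda>t :: real. x + t *\<^sub>R v)"
    have dY: "(Y has_vector_derivative v) (at 0)"
      unfolding Y_def by (auto intro!: derivative_eq_intros)
    have Y0: "Y 0 = x" by (simp add: Y_def)
    have Ye: "Y t ** e = Y t" for t by (simp add: Y_def mult_simps xe a(1))
    have "((\<lambda>t. qadj (Y t) ** (e ** Y t)) has_vector_derivative
        (qadj (Y 0) ** (e ** v + 0 ** Y 0) + qadj v ** (e ** Y 0))) (at 0)"
      by (intro vderiv_matrix_mult vderiv_qadj dY has_vector_derivative_const)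
    then have "((\<lambda>t. qadj (Y t) ** (e ** Y t)) has_vector_derivative s) (at 0)"
      by (simp add: Y0 s2)
    then have "((\<lambda>t. round_proj e (qadj (Y t) ** (e ** Y t))) has_vector_derivative s) (at 0)"
      by (rule round_proj_curve[OF e hproj_S eS(1) s]) (simp add: Y0 S_def)
    then have dS: "((\<lambda>t. level_proj e (Y t)) has_vector_derivative s) (at 0)"
      by (simp add: level_proj_def Ye)
    have S0: "level_proj e (Y 0) = S" unfolding Y0 S_def by (rule level_retract_fix(2)[OF e xq])
    have X0: "level_split e (Y 0) = x" unfolding Y0 by (rule level_retract_fix(3)[OF e xq])
    have "((\<lambda>t. e ** (Y t ** level_proj e (Y t)) + (mat 1 - e) ** (Y t ** (e - level_proj e (Y t))))
        has_vector_derivative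
        (e ** (Y 0 ** s + v ** level_proj e (Y 0)) + 0 ** (Y 0 ** level_proj e (Y 0)))
        + ((mat 1 - e) ** (Y 0 ** (0 - s) + v ** (e - level_proj e (Y 0)))
            + 0 ** (Y 0 ** (e - level_proj e (Y 0))))) (at 0)"
      by (intro has_vector_derivative_add has_vector_derivative_diff vderiv_matrix_mult dY dS has_vector_derivative_const)
    moreover have "(e ** (Y 0 ** s + v ** level_proj e (Y 0)) + 0 ** (Y 0 ** level_proj e (Y 0)))
        + ((mat 1 - e) ** (Y 0 ** (0 - s) + v ** (e - level_proj e (Y 0)))
            + 0 ** (Y 0 ** (e - level_proj e (Y 0)))) = v"
    proof -
      have "e ** (x ** s + v ** S) + (mat 1 - e) ** (v ** (e - S) - x ** s)
          = v + 2 *\<^sub>R (x ** (S ** s + s ** S) - x ** s)"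
        by (simp add: frame_simps a(1) ev mult_eq_assoc[OF ev] scaleR_2 algebra_simps)
      then show ?thesis by (simp add: S0[unfolded Y0] Y0 s(3) mult_simps)
    qed
    ultimately have dX: "((\<lambda>t. level_split e (Y t)) has_vector_derivative v) (at 0)"
      by (simp add: level_split_def Ye)
    have "((\<lambda>t. gram e (level_split e (Y t))) has_vector_derivative
        (qadj (level_split e (Y 0)) ** v + qadj v ** level_split e (Y 0)) + 0) (at 0)"
      unfolding gram_def
      by (intro has_vector_derivative_add vderiv_matrix_mult vderiv_qadj dX has_vector_derivative_const)
    then have "((\<lambda>t. gram e (level_split e (Y t))) has_vector_derivative 0) (at 0)"
      by (simp add: X0 gram0)
    then have "((\<lambda>t. isqrt (gram e (level_split e (Y t)))) has_vector_derivative 0) (at 0)"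
      by (rule isqrt_curve) (simp add: X0 level_retract_fix(4)[OF e xq])
    then have "((\<lambda>t. level_retract e (Y t)) has_vector_derivative
        level_split e (Y 0) ** 0 + v ** isqrt (gram e (level_split e (Y 0)))) (at 0)"
      unfolding level_retract_def by (rule vderiv_matrix_mult[OF dX])
    then have "((\<lambda>t. level_retract e (Y t)) has_vector_derivative v) (at 0)"
      by (simp add: X0 level_retract_fix(4)[OF e xq] isqrt_mat_1)
    then show "v \<in> tangent_space (crit_level e q) x"
      unfolding Y_def by (rule tangent_space_retractI[OF retr xq])
  qed
qed

text \<open>
  The tangent space is the direct sum of the \<open>x a\<close> with \<open>a\<close> skew and of the normal vectors \<open>w\<close> with \<open>e w = w S\<close>.
  The latter form the range of the orthogonal projection \<open>w \<mapsto> compl_in w S + compl_out w (e - S)\<close>.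
\<close>

lemma dim_tangent_space_crit_level:
  assumes e: "hproj e" and xq: "x \<in> crit_level e q"
  shows "real (dim (tangent_space (crit_level e q) x)) = real (dim (skew e)) +
    4 * (rtr e - real q) * real q + 4 * (rtr (mat 1 - e) - (rtr e - real q)) * (rtr e - real q)"
proof -
  define S where "S = qadj x ** (e ** x)"
  interpret critical_frame e x S unfolding S_def by (rule crit_level_critical_frame[OF e xq])
  have q: "rtr S = real q" using xq by (simp add: crit_level_def S_def)
  define N where "N = {w. w ** e = w \<and> qadj x ** w = 0 \<and> e ** w = w ** S}"
  define L where "L = (\<lambda>p :: (quat ^ 'a ^ 'a) \<times> (quat ^ 'a ^ 'a). x ** fst p + snd p)"
  have subN: "subspace N"
    unfolding subspace_def N_def by (simp add: mult_simps)
  have tangent: "tangent_space (crit_level e q) x = L ` (skew e \<times> N)"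
    unfolding tangent_space_crit_level[OF e xq, folded S_def] tangent_X
  proof (intro equalityI subsetI)
    fix v assume "v \<in> {v \<in> tangent. e ** normal v = normal v ** S}"
    then have v: "v \<in> tangent" and n: "e ** normal v = normal v ** S" by auto
    have "qadj x ** v \<in> skew e" using tangent_D(2-4)[OF v] by (simp add: skew_def)
    moreover have "normal v \<in> N" using tangent_D(7,8)[OF v] n by (simp add: N_def)
    moreover have "v = L (qadj x ** v, normal v)" using tangent_D(6)[OF v] by (simp add: L_def)
    ultimately show "v \<in> L ` (skew e \<times> N)" by blast
  next
    fix v assume "v \<in> L ` (skew e \<times> N)"
    then obtain a w where aw: "v = x ** a + w" "a \<in> skew e" "w \<in> N" by (auto simp: L_def)
    have a: "e ** a = a" "a ** e = a" "qadj a = - a" using aw(2) by (auto simp: skew_def)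
    have w: "w ** e = w" "qadj x ** w = 0" "e ** w = w ** S" using aw(3) by (auto simp: N_def)
    have xv: "qadj x ** v = a" by (simp add: aw(1) frame_simps a w)
    have "v \<in> tangent" unfolding tangent_def mem_Collect_eq xv by (simp add: aw(1) frame_simps a w)
    moreover have "normal v = w" by (simp add: normal_def xv) (simp add: aw(1))
    ultimately show "v \<in> {v \<in> tangent. e ** normal v = normal v ** S}" using w(3) by simp
  qed
  have "linear L" unfolding L_def by (rule linearI) (simp_all add: mult_simps scaleR_add_right)
  moreover have "inj_on L (skew e \<times> N)"
  proof (rule inj_onI)
    fix p p' assume p: "p \<in> skew e \<times> N" "p' \<in> skew e \<times> N" "L p = L p'"
    have "qadj x ** L p = fst p" if "p \<in> skew e \<times> N" for p
    proof -
      have "e ** fst p = fst p" "qadj x ** snd p = 0" using that by (auto simp: skew_def N_def)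
      then show ?thesis by (simp add: L_def frame_simps)
    qed
    then have "fst p = fst p'" using p by metis
    then show "p = p'" using p(3) by (simp add: L_def prod_eq_iff)
  qed
  moreover have "span (skew e \<times> N) = skew e \<times> N"
    using subspace_Times[OF subspace_skew subN] span_eq_iff by blast
  ultimately have "dim (L ` (skew e \<times> N)) = dim (skew e \<times> N)"
    by (metis dim_image_eq)
  also have "\<dots> = dim (skew e) + dim N" by (rule dim_Times[OF subspace_skew subN])
  finally have 1: "dim (tangent_space (crit_level e q) x) = dim (skew e) + dim N" unfolding tangent .
  define P where "P = (\<lambda>w. compl_in ** (w ** S) + compl_out ** (w ** (e - S)))"
  have R: "hproj (e - S)" by (rule hproj_diff(1)[OF e hproj_S eS(1)])
  have A: "qadj x ** compl_in = 0" "qadj x ** compl_out = 0" "e ** compl_in = compl_in" "e ** compl_out = 0" "compl_in ** compl_in = compl_in" "compl_out ** compl_out = compl_out"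
    using hproj_compl[THEN hprojD(2)] by (simp_all add: compl_eqs frame_simps)
  have PN: "P u \<in> N" for u
    by (simp add: N_def P_def mult_simps A mult_eq_assoc[OF A(1)] mult_eq_assoc[OF A(2)]
        mult_eq_assoc[OF A(3)] mult_eq_assoc[OF A(4)] eS SS ee)
  have NP: "P w = w" if "w \<in> N" for w
  proof -
    have w: "w ** e = w" "qadj x ** w = 0" "e ** w = w ** S" using that by (auto simp: N_def)
    show ?thesis unfolding P_def compl_eqs
      by (simp add: frame_simps w mult_eq_assoc[OF w(2)] mult_eq_assoc[OF w(3)])
  qed
  have "range P = N" using PN NP by (auto intro: rangeI) (metis rangeI)
  moreover have "real (dim (range P)) = (\<Sum>W\<in>Basis. P W \<bullet> W)"
  proof (rule dim_range_eq_trace)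
    show "linear P" unfolding P_def by (rule linearI) (simp_all add: mult_simps scaleR_add_right scaleR_diff_right)
    show "P (P v) = P v" for v using NP[OF PN] .
    have sa: "(A ** (u ** B)) \<bullet> v = u \<bullet> (A ** (v ** B))" if "hproj A" "hproj B" for A B u v :: "quat ^ 'a ^ 'a"
      unfolding inner_matrix_mult_left[of A "u ** B"] inner_matrix_mult_right[of u B]
      using that by (simp add: hprojD matrix_mul_assoc)
    show "P u \<bullet> v = u \<bullet> P v" for u v
      unfolding P_def inner_add_left inner_add_right
      by (simp only: sa[OF hproj_compl(1) hproj_S] sa[OF hproj_compl(2) R])
  qed
  moreover have "(\<Sum>W\<in>Basis. P W \<bullet> W) = 4 * rtr compl_in * rtr S + 4 * rtr compl_out * rtr (e - S)"
    unfolding P_def inner_add_left sum.distrib matrix_mul_assoc trace_sandwich ..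
  ultimately show ?thesis
    by (simp add: 1 rtr_compl q rtr_diff)
qed

lemma submanifold_crit_level:
  assumes e: "hproj e"
  shows "\<exists>d. submanifold d (crit_level e q)"
proof -
  obtain W where retr: "smooth_retraction W (crit_level e q) (level_retract e)"
    using level_retraction[OF e] .
  show ?thesis
  proof (cases "crit_level e q = {}")
    case True
    then show ?thesis by (simp add: submanifold_def)
  next
    case False
    then obtain x0 where x0: "x0 \<in> crit_level e q" by blast
    have "dim (tangent_space (crit_level e q) x) = dim (tangent_space (crit_level e q) x0)"
      if "x \<in> crit_level e q" for x
      using dim_tangent_space_crit_level[OF e that] dim_tangent_space_crit_level[OF e x0] by simp
    then show ?thesis using submanifold_retract[OF retr] by blast
  qed
qed

lemma submanifold_projections_Times:
  assumes i: "hproj i" and j: "hproj j"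
  shows "\<exists>d. submanifold d (projections i l \<times> projections j m)"
proof -
  let ?B = "projections i l \<times> projections j m"
  obtain W W' where "smooth_retraction W (projections i l) (round_proj i)"
    "smooth_retraction W' (projections j m) (round_proj j)"
    using projections_retraction[OF i] projections_retraction[OF j] by metis
  note retr = smooth_retraction_Times[OF this]
  have dims: "real (dim (tangent_space ?B p)) = 4 * (rtr i - real l) * real l + 4 * (rtr j - real m) * real m"
    if pB: "p \<in> ?B" for p
  proof -
    obtain a b where p: "p = (a, b)" "a \<in> projections i l" "b \<in> projections j m" using pB by blast
    obtain W W' where W: "smooth_retraction W (projections i l) (round_proj i)"
      "smooth_retraction W' (projections j m) (round_proj j)"
      using projections_retraction[OF i] projections_retraction[OF j] by metis
    show ?thesis
      unfolding p(1) tangent_space_Times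
        dim_Times[OF tangent_space_retract(3)[OF W(1) p(2)] tangent_space_retract(3)[OF W(2) p(3)]]
      by (simp add: dim_tangent_space_projections[OF i p(2)] dim_tangent_space_projections[OF j p(3)])
  qed
  show ?thesis
  proof (cases "?B = {}")
    case True
    show ?thesis unfolding True by (simp add: submanifold_def)
  next
    case False
    then obtain p0 where p0: "p0 \<in> ?B" by blast
    have "dim (tangent_space ?B p) = dim (tangent_space ?B p0)" if "p \<in> ?B" for p
      using dims[OF that] dims[OF p0] by simp
    then show ?thesis using submanifold_retract[OF retr] by blast
  qed
qed

section \<open>The principal bundle\<close>

text \<open>
  The range of a critical frame is the direct sum of its parts outside and inside the range of \<open>e\<close>.
\<close>

definition base_map :: "quat ^ 'n ^ 'n \<Rightarrow> quat ^ 'n ^ 'n \<Rightarrow> (quat ^ 'n ^ 'n) \<times> (quat ^ 'n ^ 'n)"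
  where "base_map e x = ((mat 1 - e) ** (x ** qadj x), e ** (x ** qadj x))"

lemma base_map_sum: "fst (base_map e x) + snd (base_map e x) = x ** qadj x"
  by (simp add: base_map_def mult_simps)

lemma base_map_crit_level:
  assumes e: "hproj e" and xq: "x \<in> crit_level e q" and pq: "rtr e = real p + real q"
  shows "base_map e x \<in> projections (mat 1 - e) p \<times> projections e q"
proof -
  define S where "S = qadj x ** (e ** x)"
  interpret critical_frame e x S unfolding S_def by (rule crit_level_critical_frame[OF e xq])
  have q: "rtr S = real q" using xq by (simp add: crit_level_def S_def)
  have h: "hproj (e ** (x ** qadj x))" "hproj ((mat 1 - e) ** (x ** qadj x))"
    by (rule hproj_mult[OF e hproj_Q], simp add: frame_simps)
      (rule hproj_mult[OF hproj_Compl[OF e] hproj_Q], simp add: frame_simps)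
  have "rtr (e ** (x ** qadj x)) = real q" unfolding eQ(1) by (simp add: rtr_eQ q)
  moreover from this have "rtr ((mat 1 - e) ** (x ** qadj x)) = real p"
    using pq rtr_Q by (simp add: mult_simps(2-5) rtr_diff)
  ultimately show ?thesis
    using h by (simp add: base_map_def projections_def mult_simps ee mult_eq_assoc[OF ee])
qed

lemma projection_pair:
  assumes e: "hproj e" and R: "R \<in> projections (mat 1 - e) p" and Q: "Q \<in> projections e q"
  shows "hproj (R + Q)" "e ** (R + Q) = Q" "(R + Q) ** e = Q" "rtr (R + Q) = real p + real q"
proof -
  have R': "hproj R" "(mat 1 - e) ** R = R" "rtr R = real p" and Q': "hproj Q" "e ** Q = Q" "rtr Q = real q"
    using R Q by (auto simp: projections_def)
  have eR: "e ** R = 0" using R'(2) by (simp add: mult_simps)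
  have Re: "R ** e = 0" using eR R'(1) e by (metis hprojD(1) qadj_mult qadj_simps(6))
  have Qe: "Q ** e = Q" using hproj_diff(2)[OF e Q'(1,2)] .
  have RQ: "R ** Q = 0" using Re Q'(2) by (metis matrix_mul_assoc times0_left)
  have QR: "Q ** R = 0" using eR Qe by (metis matrix_mul_assoc times0_right)
  show "hproj (R + Q)" using R'(1) Q'(1) by (simp add: hproj_def qadj_simps mult_simps RQ QR)
  show "e ** (R + Q) = Q" "(R + Q) ** e = Q" by (simp_all add: mult_simps eR Re Q' Qe)
  show "rtr (R + Q) = real p + real q" by (simp add: rtr_add R' Q')
qed

text \<open>
  Membership in a critical level, and the image in the base, depend only on the range of the frame.
\<close>

lemma crit_level_of_range:
  assumes e: "hproj e" and R: "R \<in> projections (mat 1 - e) p" and Q: "Q \<in> projections e q"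
    and x: "x \<in> frames (mat 1) e" and xx: "x ** qadj x = R + Q"
  shows "x \<in> crit_level e q" "base_map e x = (R, Q)"
proof -
  note F = projection_pair[OF e R Q]
  have x': "x ** e = x" "qadj x ** x = e" using x by (simp_all add: frames_mat_1_iff)
  have "(R + Q) ** x = x" using x' by (simp add: xx[symmetric] matrix_mul_assoc[symmetric])
  then have "e ** x = Q ** x" by (metis F(2) matrix_mul_assoc)
  moreover have "x ** (qadj x ** (e ** x)) = Q ** x"
    by (simp add: matrix_mul_assoc xx F(3))
  moreover have "rtr (qadj x ** (e ** x)) = real q"
  proof -
    have "rtr (qadj x ** (e ** x)) = rtr ((e ** x) ** qadj x)" by (rule rtr_mult_commute)
    also have "\<dots> = rtr Q" by (simp add: matrix_mul_assoc[symmetric] xx F(2))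
    finally show ?thesis using Q by (simp add: projections_def)
  qed
  ultimately show "x \<in> crit_level e q" using x by (simp add: crit_level_def)
  show "base_map e x = (R, Q)"
    unfolding base_map_def xx mult_simps(4) F(2) by simp
qed

text \<open>
  The projection \<open>R + Q\<close> has rank \<open>k\<close>, so it is the range projection of a frame.
\<close>

lemma base_map_surj:
  fixes K :: "'n::finite set"
  assumes R: "R \<in> projections (mat 1 - qid K) p" and Q: "Q \<in> projections (qid K) q" and pq: "card K = p + q"
  obtains x where "x \<in> crit_level (qid K) q" "base_map (qid K) x = (R, Q)"
proof -
  note F = projection_pair[OF hproj_qid R Q]
  have "rtr (R + Q) \<le> real (card K)" using F(4) pq by simp
  then obtain J x where x: "J \<subseteq> K" "x ** qid J = x" "qadj x ** x = qid J" "x ** qadj x = R + Q"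
    "rtr (R + Q) = card J"
    using hproj_partial_isometry[OF F(1)] by blast
  have "J = K" using x(1,5) F(4) pq by (intro card_subset_eq) auto
  then have "x \<in> frames (mat 1) (qid K)" using x by (simp add: frames_mat_1_iff)
  then show thesis using that crit_level_of_range[OF hproj_qid R Q _ x(4)] by blast
qed

text \<open>
  For a frame \<open>x0\<close> over the base point, \<open>(R + Q) x0\<close> projects \<open>x0\<close> to the nearby range \<open>R + Q\<close>; where its Gram
  matrix is close to the identity, orthonormalising gives a frame with this range.
\<close>

definition section_dom :: "quat ^ 'n ^ 'n \<Rightarrow> quat ^ 'n ^ 'n \<Rightarrow> ((quat ^ 'n ^ 'n) \<times> (quat ^ 'n ^ 'n)) set"
  where "section_dom e x0 = {b. gram e ((fst b + snd b) ** x0) \<in> isqrt_dom}"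

definition local_section :: "quat ^ 'n ^ 'n \<Rightarrow> quat ^ 'n ^ 'n \<Rightarrow> (quat ^ 'n ^ 'n) \<times> (quat ^ 'n ^ 'n) \<Rightarrow> quat ^ 'n ^ 'n"
  where "local_section e x0 b = ((fst b + snd b) ** x0) ** isqrt (gram e ((fst b + snd b) ** x0))"

lemma open_section_dom: "open (section_dom e x0)"
  unfolding section_dom_def by (intro open_smooth_vimage open_isqrt_dom smooth_intros)

lemma smooth_on_local_section: "smooth_on (section_dom e x0) (local_section e x0)"
  unfolding local_section_def
  by (intro smooth_on_matrix_mult smooth_on_compose[OF _ smooth_on_isqrt] smooth_intros)
    (auto simp: section_dom_def)

text \<open>
  The range of \<open>s\<close> is contained in that of \<open>R + Q\<close> and has the same rank, so the two projections are equal.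
\<close>

lemma local_section:
  assumes e: "hproj e" and R: "R \<in> projections (mat 1 - e) p" and Q: "Q \<in> projections e q"
    and pq: "rtr e = real p + real q" and x0: "x0 ** e = x0" and dom: "(R, Q) \<in> section_dom e x0"
  defines "s \<equiv> local_section e x0 (R, Q)"
  shows "s \<in> frames (mat 1) e" "s ** qadj s = R + Q" "s \<in> crit_level e q" "base_map e s = (R, Q)"
proof -
  note F = projection_pair[OF e R Q]
  define y where "y = (R + Q) ** x0"
  have N: "gram e y \<in> isqrt_dom" using dom by (simp add: section_dom_def y_def)
  have s: "s = y ** isqrt (gram e y)" by (simp add: s_def local_section_def y_def)
  have ye: "y ** e = y" using x0 by (simp add: y_def matrix_mul_assoc[symmetric])
  show fr: "s \<in> frames (mat 1) e"
    unfolding frames_mat_1_iff s using orthonormalise(2,3)[OF e ye gram_def N] by blast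
  then have s': "s ** e = s" "qadj s ** s = e" by (simp_all add: frames_mat_1_iff)
  have Fs: "(R + Q) ** s = s"
    unfolding s y_def using hprojD(2)[OF F(1)] by (metis matrix_mul_assoc)
  have ss: "hproj (s ** qadj s)"
    using s' by (simp add: hproj_def qadj_simps matrix_mul_assoc[symmetric] mult_eq_assoc[OF s'(2)])
      (metis matrix_mul_assoc)
  have "(R + Q) ** (s ** qadj s) = s ** qadj s" by (simp add: matrix_mul_assoc Fs)
  then have d: "hproj (R + Q - s ** qadj s)" by (rule hproj_diff(1)[OF F(1) ss])
  have "rtr (s ** qadj s) = rtr e" by (simp add: rtr_mult_commute[of s] s')
  then have "rtr (R + Q - s ** qadj s) = 0" using F(4) pq by (simp add: rtr_diff)
  then show sR: "s ** qadj s = R + Q" using rtr_hproj_eq_0[OF d] by simp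
  show "s \<in> crit_level e q" "base_map e s = (R, Q)"
    using crit_level_of_range[OF e R Q fr sR] by auto
qed

text \<open>
  The action by \<open>Sp(K)\<close> on the right does not change the range projection \<open>x x\<^sup>*\<close>.
\<close>

lemma crit_level_action:
  assumes e: "hproj e" and x: "x \<in> crit_level e q" and a: "a \<in> frames e e"
  shows "x ** a \<in> crit_level e q" "(x ** a) ** qadj (x ** a) = x ** qadj x"
proof -
  have x': "x \<in> frames (mat 1) e" "x ** e = x" and c: "e ** x = x ** (qadj x ** (e ** x))" "rtr (qadj x ** (e ** x)) = real q"
    using x by (auto simp: crit_level_def frames_mat_1_iff)
  have aa: "a ** qadj a = e" by (rule frames_self_adjoint[OF e a])
  show xx: "(x ** a) ** qadj (x ** a) = x ** qadj x"
    by (simp add: qadj_mult matrix_mul_assoc[symmetric] mult_eq_assoc[OF aa] mult_eq_assoc[OF x'(2)])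
  have "x ** a \<in> frames (mat 1) e" using frames_mult[OF x'(1) a] .
  moreover have "e ** (x ** a) = (x ** a) ** (qadj (x ** a) ** (e ** (x ** a)))"
    using c(1) xx by (metis matrix_mul_assoc)
  moreover have "rtr (qadj (x ** a) ** (e ** (x ** a))) = real q"
  proof -
    have "rtr (qadj (x ** a) ** (e ** (x ** a))) = rtr ((e ** (x ** a)) ** qadj (x ** a))"
      by (rule rtr_mult_commute)
    also have "\<dots> = rtr ((e ** x) ** qadj x)" using xx by (metis matrix_mul_assoc)
    also have "\<dots> = rtr (qadj x ** (e ** x))" by (rule rtr_mult_commute)
    finally show ?thesis using c(2) by simp
  qed
  ultimately show "x ** a \<in> crit_level e q" by (simp add: crit_level_def)
qed

text \<open>
  A local section \<open>s\<close> trivialises the bundle: a frame \<open>x\<close> over \<open>b\<close> is \<open>s b\<close> times \<open>\<tau> x = (s b)\<^sup>* x\<close>, because \<open>s b\<close> and \<open>x\<close>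
  have the same range.
\<close>

theorem principal_bundle_crit_level:
  fixes K :: "'n::finite set"
  assumes pq: "card K = p + q"
  shows "principal_bundle (Sp K) (crit_level (qid K) q)
    (projections (mat 1 - qid K) p \<times> projections (qid K) q) (base_map (qid K)) (\<lambda>x a. x ** a)"
proof -
  define e where "e = (qid K :: quat ^ 'n ^ 'n)"
  define E where "E = crit_level e q"
  define B where "B = projections (mat 1 - e) p \<times> projections e q"
  have e: "hproj e" by (simp add: e_def)
  have re: "rtr e = real p + real q" using pq by (simp add: e_def)
  have G: "carrier (Sp K) = frames e e" by (simp add: Sp_carrier e_def)
  have smb: "smooth_on S (base_map e)" for S
    unfolding base_map_def by (intro smooth_intros)
  have Eframe: "x \<in> frames (mat 1) e" "x ** e = x" "qadj x ** x = e" if "x \<in> E" for x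
    using that by (auto simp: E_def crit_level_def frames_mat_1_iff)
  have act: "x ** a \<in> E" "base_map e (x ** a) = base_map e x" if "x \<in> E" "a \<in> frames e e" for x a
    using crit_level_action[OF e that[unfolded E_def]] by (simp_all add: E_def base_map_def)
  have triv: "\<exists>U \<tau>. openin (top_of_set B) U \<and> b0 \<in> U \<and>
      diffeo (E \<inter> base_map e -` U) (U \<times> carrier (Sp K)) (\<lambda>x. (base_map e x, \<tau> x)) \<and>
      (\<forall>x\<in>E \<inter> base_map e -` U. \<forall>a\<in>carrier (Sp K). \<tau> (x ** a) = \<tau> x \<otimes>\<^bsub>Sp K\<^esub> a)"
    if b0: "b0 \<in> B" for b0
  proof -
    obtain x0 where x0: "x0 \<in> E" "base_map e x0 = b0"
      using base_map_surj[of "fst b0" K p "snd b0" q] b0 pq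
      unfolding B_def E_def e_def by (metis mem_Times_iff prod.collapse)
    note x0' = Eframe[OF x0(1)]
    define U where "U = B \<inter> section_dom e x0"
    define sec where "sec = local_section e x0"
    define \<tau> where "\<tau> = (\<lambda>x. qadj (sec (base_map e x)) ** x)"
    have "fst b0 + snd b0 = x0 ** qadj x0" using base_map_sum[of e x0] x0(2) by simp
    then have "(fst b0 + snd b0) ** x0 = x0"
      by (simp add: matrix_mul_assoc[symmetric] x0'(2,3))
    then have "b0 \<in> section_dom e x0"
      by (simp add: section_dom_def gram_frames[OF x0'(1)] mat_1_isqrt_dom)
    then have b0U: "b0 \<in> U" using b0 by (simp add: U_def)
    have opU: "openin (top_of_set B) U"
      unfolding U_def using open_section_dom by blast
    have sec: "sec b \<in> E" "base_map e (sec b) = b" "sec b ** qadj (sec b) = fst b + snd b" if "b \<in> U" for b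
    proof -
      have b: "fst b \<in> projections (mat 1 - e) p" "snd b \<in> projections e q" "(fst b, snd b) \<in> section_dom e x0"
        using that by (auto simp: U_def B_def mem_Times_iff)
      show "sec b \<in> E" "base_map e (sec b) = b" "sec b ** qadj (sec b) = fst b + snd b"
        using local_section[OF e b(1,2) re x0'(2) b(3)] by (simp_all add: sec_def E_def)
    qed
    have sm_sec: "smooth_on U sec"
      unfolding sec_def by (rule smooth_on_subset[OF smooth_on_local_section]) (auto simp: U_def)
    have \<tau>: "\<tau> x \<in> frames e e" "sec (base_map e x) ** \<tau> x = x" if "x \<in> E \<inter> base_map e -` U" for x
    proof -
      have x: "x \<in> E" "base_map e x \<in> U" using that by auto
      define s where "s = sec (base_map e x)"
      have s: "s ** e = s" "qadj s ** s = e" "s ** qadj s = x ** qadj x"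
        using Eframe(2,3)[OF sec(1)[OF x(2)]] sec(3)[OF x(2)] base_map_sum[of e x] by (simp_all add: s_def)
      note x' = Eframe(2,3)[OF x(1)]
      have t: "\<tau> x = qadj s ** x" by (simp add: \<tau>_def s_def)
      have es: "e ** qadj s = qadj s" using s(1) e by (metis hprojD(1) qadj_mult)
      have "s ** (qadj s ** x) = x" by (simp add: matrix_mul_assoc s(3)) (simp add: matrix_mul_assoc[symmetric] x')
      then show sx: "sec (base_map e x) ** \<tau> x = x" by (simp add: t s_def)
      have "qadj (qadj s ** x) ** (qadj s ** x) = qadj x ** (s ** (qadj s ** x))"
        by (simp add: qadj_mult matrix_mul_assoc)
      also have "\<dots> = e" using sx by (simp add: t s_def x')
      finally show "\<tau> x \<in> frames e e"
        unfolding t frames_def using es x' by (simp add: matrix_mul_assoc) (simp add: matrix_mul_assoc[symmetric])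
    qed
    have "diffeo (E \<inter> base_map e -` U) (U \<times> frames e e) (\<lambda>x. (base_map e x, \<tau> x))"
    proof (rule diffeoI[where g = "\<lambda>p. sec (fst p) ** snd p"])
      show "(\<lambda>x. (base_map e x, \<tau> x)) ` (E \<inter> base_map e -` U) \<subseteq> U \<times> frames e e"
        using \<tau>(1) by auto
      show "(\<lambda>p. sec (fst p) ** snd p) ` (U \<times> frames e e) \<subseteq> E \<inter> base_map e -` U"
        using act sec by (auto simp: image_subset_iff)
      show "sec (fst (base_map e x, \<tau> x)) ** snd (base_map e x, \<tau> x) = x" if "x \<in> E \<inter> base_map e -` U" for x
        using \<tau>(2)[OF that] by simp
      show "(base_map e (sec (fst p) ** snd p), \<tau> (sec (fst p) ** snd p)) = p" if "p \<in> U \<times> frames e e" for p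
      proof -
        have p: "fst p \<in> U" "snd p \<in> frames e e" using that by auto
        have b: "base_map e (sec (fst p) ** snd p) = fst p"
          using act(2)[OF sec(1)[OF p(1)] p(2)] sec(2)[OF p(1)] by simp
        have "qadj (sec (fst p)) ** (sec (fst p) ** snd p) = snd p"
          using Eframe(3)[OF sec(1)[OF p(1)]] p(2) by (simp add: matrix_mul_assoc) (simp add: frames_def)
        then show ?thesis using b by (simp add: \<tau>_def)
      qed
      have "smooth_on (E \<inter> base_map e -` U) (\<lambda>x. sec (base_map e x))"
        by (rule smooth_on_compose[OF smb sm_sec]) auto
      then show "smooth_on (E \<inter> base_map e -` U) (\<lambda>x. (base_map e x, \<tau> x))"
        unfolding \<tau>_def by (intro smooth_intros smb)
      have "smooth_on (U \<times> frames e e) (\<lambda>p. sec (fst p))"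
        by (rule smooth_on_compose[OF _ sm_sec]) (auto intro!: smooth_intros)
      then show "smooth_on (U \<times> frames e e) (\<lambda>p. sec (fst p) ** snd p)"
        by (intro smooth_intros)
    qed
    moreover have "\<tau> (x ** a) = \<tau> x \<otimes>\<^bsub>Sp K\<^esub> a" if "x \<in> E \<inter> base_map e -` U" "a \<in> frames e e" for x a
      using act(2)[of x a] that by (simp add: \<tau>_def Sp_ops matrix_mul_assoc)
    ultimately show ?thesis
      unfolding G using opU b0U by blast
  qed
  have "smooth_right_action (Sp K) E (\<lambda>x a. x ** a)"
    unfolding smooth_right_action_def G
  proof (intro conjI ballI)
    have "smooth_on (E \<times> frames e e) (\<lambda>p. fst p ** snd p)" by (intro smooth_intros)
    then show "smooth_on (E \<times> frames e e) (\<lambda>(x, a). x ** a)" by (simp add: case_prod_unfold)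
  qed (use act Eframe in \<open>simp_all add: Sp_ops matrix_mul_assoc e_def[symmetric]\<close>)
  moreover have "base_map e ` E \<subseteq> B"
    unfolding E_def B_def using base_map_crit_level[OF e _ re] by blast
  ultimately have "principal_bundle (Sp K) E B (base_map e) (\<lambda>x a. x ** a)"
    unfolding principal_bundle_def
    using lie_group_Sp submanifold_crit_level[OF e, of q] submanifold_projections_Times[OF hproj_Compl[OF e] e, of p q]
      smb act(2) triv
    by (simp add: E_def[symmetric] B_def[symmetric] G)
  then show ?thesis by (simp add: E_def B_def e_def)
qed

section \<open>The height function on the Stiefel manifold\<close>

lemma stiefel_eq: "stiefel K = frames (mat 1) (qid K)"
  by (auto simp: stiefel_def frames_mat_1_iff mem_qmats_iff qid_UNIV)

lemma height_eq: "height K = proj_height (qid K)"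
  by (simp add: fun_eq_iff height_def Let_def proj_height_def qid_mult[symmetric] inner_qmat)

lemma critical_pointE:
  fixes K :: "'n::finite set"
  assumes "x \<in> critical_points (frames (mat 1) (qid K)) (proj_height (qid K))"
  obtains q where "x \<in> crit_level (qid K) q" "q \<le> card K" "2 * card K \<le> CARD('n) + q"
    "proj_height (qid K) x = real q"
proof -
  define S where "S = qadj x ** (qid K ** x)"
  have xc: "x \<in> frames (mat 1) (qid K)" "qid K ** x = x ** S"
    using assms unfolding critical_points_stiefel[OF hproj_qid] by (auto simp: S_def)
  interpret critical_frame "qid K" x S by unfold_locales (fact hproj_qid xc S_def)+
  obtain q where q: "rtr S = real q" using rtr_hproj_nat[OF hproj_S] .
  have "rtr (mat 1 :: quat ^ 'n ^ 'n) = CARD('n)" using rtr_qid[of "UNIV :: 'n set"] by (simp add: qid_UNIV)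
  then have "q \<le> card K" "2 * card K \<le> CARD('n) + q" using height_bounds by (simp_all add: q)
  moreover have "x \<in> crit_level (qid K) q" using xc q unfolding crit_level_def S_def by simp
  ultimately show thesis using that proj_height_eq q by simp
qed

lemma crit_level_subset_critical:
  assumes "hproj e" "x \<in> crit_level e q"
  shows "x \<in> critical_points (frames (mat 1) e) (proj_height e)" "proj_height e x = real q"
proof -
  interpret critical_frame e x "qadj x ** (e ** x)" by (rule crit_level_critical_frame[OF assms])
  show "x \<in> critical_points (frames (mat 1) e) (proj_height e)"
    using assms(2) unfolding critical_points_stiefel[OF assms(1)] by (simp add: crit_level_def)
  show "proj_height e x = real q" using assms(2) by (simp add: proj_height_eq crit_level_def)
qed

lemma critical_level_set_eq:
  "critical_level_set (frames (mat 1) (qid K)) (proj_height (qid K)) (real q) = crit_level (qid K) q"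
proof (intro equalityI subsetI)
  fix x assume "x \<in> critical_level_set (frames (mat 1) (qid K)) (proj_height (qid K)) (real q)"
  then have x: "x \<in> critical_points (frames (mat 1) (qid K)) (proj_height (qid K))" "proj_height (qid K) x = real q"
    by (simp_all add: critical_level_set_def)
  obtain q' where "x \<in> crit_level (qid K) q'" "proj_height (qid K) x = real q'"
    using critical_pointE[OF x(1)] by metis
  then show "x \<in> crit_level (qid K) q" using x(2) by simp
qed (simp add: critical_level_set_def crit_level_subset_critical)

text \<open>
  A frame of height \<open>q\<close> exists over any pair of coordinate subspaces of the right dimensions.
\<close>

lemma crit_level_nonempty:
  fixes K :: "'n::finite set"
  assumes "q \<le> card K" "2 * card K \<le> CARD('n) + q"
  shows "crit_level (qid K) q \<noteq> {}"
proof -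
  have cC: "card (- K) = CARD('n) - card K" by (simp add: Compl_eq_Diff_UNIV card_Diff_subset)
  obtain A where A: "A \<subseteq> - K" "card A = card K - q"
    by (rule obtain_subset_with_card_n[of "card K - q" "- K"]) (use assms cC in auto)
  obtain C where C: "C \<subseteq> K" "card C = q"
    by (rule obtain_subset_with_card_n[OF assms(1)]) auto
  have "qid A \<in> projections (mat 1 - qid K) (card K - q)" "qid C \<in> projections (qid K) q"
    using A C by (simp_all add: projections_def qid_Compl[symmetric] qid_mult_qid Int_absorb1)
  then obtain x where "x \<in> crit_level (qid K) q"
    by (rule base_map_surj) (use assms(1) in auto)
  then show ?thesis by blast
qed

text \<open>
  The heights of critical points are natural numbers, so each level is cut out of the critical set by an
  open condition on the height.
\<close>

lemma Morse_Bott_height: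
  fixes K :: "'n::finite set"
  shows "Morse_Bott (frames (mat 1) (qid K)) (proj_height (qid K))"
proof -
  let ?X = "frames (mat 1) (qid K)" and ?h = "proj_height (qid K :: quat ^ 'n ^ 'n)"
  have smh: "smooth_on S ?h" for S
    unfolding proj_height_def by (intro smooth_intros)
  define \<C> where "\<C> = range (crit_level (qid K :: quat ^ 'n ^ 'n))"
  have "\<Union>\<C> = critical_points ?X ?h"
  proof (intro equalityI subsetI)
    fix x assume "x \<in> critical_points ?X ?h"
    then show "x \<in> \<Union>\<C>" unfolding \<C>_def by (elim critical_pointE) blast
  qed (auto simp: \<C>_def crit_level_subset_critical)
  moreover have "pairwise disjnt \<C>"
    unfolding pairwise_def disjnt_def \<C>_def by (auto simp: crit_level_def)
  moreover have "openin (top_of_set (critical_points ?X ?h)) C \<and> (\<exists>d. submanifold d C) \<and>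
      (\<forall>x\<in>C. hessian_kernel ?X ?h x = tangent_space C x)" if CC: "C \<in> \<C>" for C
  proof -
    obtain q where C: "C = crit_level (qid K) q" using CC by (auto simp: \<C>_def)
    define O1 where "O1 = {x. ?h x \<in> {real q - 1 <..< real q + 1}}"
    have "open O1" unfolding O1_def by (rule open_smooth_vimage[OF smh]) simp
    moreover have "C = critical_points ?X ?h \<inter> O1"
    proof (intro equalityI subsetI)
      fix x assume x: "x \<in> critical_points ?X ?h \<inter> O1"
      then obtain q' where q': "x \<in> crit_level (qid K) q'" "?h x = real q'"
        using critical_pointE[of x K] by blast
      then have "q' = q" using x by (simp add: O1_def)
      then show "x \<in> C" using q' C by simp
    qed (auto simp: C O1_def crit_level_subset_critical)
    ultimately have "openin (top_of_set (critical_points ?X ?h)) C" by blast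
    moreover have "hessian_kernel ?X ?h x = tangent_space C x" if "x \<in> C" for x
    proof -
      have xq: "x \<in> crit_level (qid K) q" using that C by simp
      interpret critical_frame "qid K" x "qadj x ** (qid K ** x)"
        by (rule crit_level_critical_frame[OF hproj_qid xq])
      show ?thesis
        unfolding C hessian_kernel_eq tangent_space_crit_level[OF hproj_qid xq] tangent_X ..
    qed
    moreover have "\<exists>d. submanifold d C" unfolding C by (rule submanifold_crit_level[OF hproj_qid])
    ultimately show ?thesis by blast
  qed
  ultimately show ?thesis unfolding Morse_Bott_def using smh by blast
qed

lemma morse_index_crit_level:
  fixes K :: "'n::finite set"
  assumes "x \<in> crit_level (qid K) q"
  shows "int (morse_index (frames (mat 1) (qid K)) (proj_height (qid K)) x)
    = 4 * (int CARD('n) - 2 * int (card K) + int q) * int q"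
proof -
  interpret critical_frame "qid K" x "qadj x ** (qid K ** x)"
    by (rule crit_level_critical_frame[OF hproj_qid assms])
  have "rtr (mat 1 :: quat ^ 'n ^ 'n) = CARD('n)" using rtr_qid[of "UNIV :: 'n set"] by (simp add: qid_UNIV)
  moreover have "rtr (qadj x ** (qid K ** x)) = real q" using assms by (simp add: crit_level_def)
  ultimately have "real (morse_index (frames (mat 1) (qid K)) (proj_height (qid K)) x)
      = 4 * (real CARD('n) - 2 * real (card K) + real q) * real q"
    using morse_index_eq by (simp add: rtr_compl)
  then have "of_int (int (morse_index (frames (mat 1) (qid K)) (proj_height (qid K)) x))
      = (of_int (4 * (int CARD('n) - 2 * int (card K) + int q) * int q) :: real)"
    by simp
  then show ?thesis by (rule of_int_eq_iff[THEN iffD1])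
qed

lemma critical_values:
  fixes K :: "'n::finite set"
  shows "proj_height (qid K) ` critical_points (frames (mat 1) (qid K)) (proj_height (qid K)) =
    real ` {q. q \<le> card K \<and> 2 * card K \<le> CARD('n) + q}"
proof (intro equalityI subsetI)
  fix c assume "c \<in> proj_height (qid K) ` critical_points (frames (mat 1) (qid K)) (proj_height (qid K))"
  then show "c \<in> real ` {q. q \<le> card K \<and> 2 * card K \<le> CARD('n) + q}"
    by (auto elim!: critical_pointE)
next
  fix c assume "c \<in> real ` {q. q \<le> card K \<and> 2 * card K \<le> CARD('n) + q}"
  then obtain q where q: "c = real q" "q \<le> card K" "2 * card K \<le> CARD('n) + q" by auto
  obtain x where "x \<in> crit_level (qid K) q" using crit_level_nonempty[OF q(2,3)] by blast
  then show "c \<in> proj_height (qid K) ` critical_points (frames (mat 1) (qid K)) (proj_height (qid K))"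
    using crit_level_subset_critical[OF hproj_qid] q(1) by (metis imageI)
qed

theorem theorem1:
  fixes K :: "'n::finite set" and n k :: nat
  assumes "CARD('n) = n" and "card K = k" and "k < n"
  shows "Morse_Bott (stiefel K) (height K) \<and>
    (n \<ge> 2 * k \<longrightarrow> height K ` critical_points (stiefel K) (height K) = real ` {0..k}) \<and>
    (n \<le> 2 * k \<longrightarrow> height K ` critical_points (stiefel K) (height K) = real ` {2 * k - n..k}) \<and>
    (\<forall>q. (n \<ge> 2 * k \<and> q \<in> {0..k}) \<or> (n \<le> 2 * k \<and> q \<in> {2 * k - n..k}) \<longrightarrow>
      (let p = k - q; \<Sigma> = critical_level_set (stiefel K) (height K) (real q) in
        (\<exists>\<pi> act. principal_bundle (Sp K) \<Sigma> (Gr_manifold (- K) p \<times> Gr_manifold K (k - p)) \<pi> act) \<and>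
        (\<forall>x\<in>\<Sigma>. int (morse_index (stiefel K) (height K) x) =
          4 * (int n - 2 * int k + int q) * int q)))"
proof -
  have crit_values: "height K ` critical_points (stiefel K) (height K) = real ` {q. q \<le> k \<and> 2 * k \<le> n + q}"
    unfolding stiefel_eq height_eq critical_values assms(1,2) ..
  have "{q. q \<le> k \<and> 2 * k \<le> n + q} = {0..k}" if "n \<ge> 2 * k" using that by auto
  moreover have "{q. q \<le> k \<and> 2 * k \<le> n + q} = {2 * k - n..k}" if "n \<le> 2 * k" using that by auto
  moreover have "let p = k - q; \<Sigma> = critical_level_set (stiefel K) (height K) (real q) in
        (\<exists>\<pi> act. principal_bundle (Sp K) \<Sigma> (Gr_manifold (- K) p \<times> Gr_manifold K (k - p)) \<pi> act) \<and>
        (\<forall>x\<in>\<Sigma>. int (morse_index (stiefel K) (height K) x) =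
          4 * (int n - 2 * int k + int q) * int q)" if "q \<le> k" for q
  proof -
    have "k - (k - q) = q" "card K = (k - q) + q" using that assms(2) by auto
    then show ?thesis
      unfolding Let_def stiefel_eq height_eq critical_level_set_eq Gr_manifold_eq_projections qid_Compl
      using principal_bundle_crit_level[of K "k - q" q] morse_index_crit_level[of _ K q] assms(1,2)
      by auto
  qed
  ultimately show ?thesis
    unfolding crit_values using Morse_Bott_height[of K] by (auto simp: stiefel_eq height_eq)
qed

end
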